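(* Let $\ell<0$ be an integer, and assume that $B$ is generated as an algebra by its homogeneous elements of degree at most $-\ell$. If $\mathcal{YD}(\operatorname{M}(B),\mathcal P(B))_\ell=0$, then the connecting map $$\tilde\partial_\ell\colon \mathrm{H}^2_\varepsilon(B,\Bbbk)^H_\ell\to\tilde{\mathrm{H}}_b^2(A)_\ell,\qquad [\eta]\mapsto[(\partial^c\tilde\eta,0)],$$ is surjective. Equivalently, for every $(F,G)\in\tilde{\mathrm{Z}}_b^2(A)_\ell$ there is an $H$-stable Hochschild $2$-cocycle $\eta\colon B\otimes B\to\Bbbk$, supported on $(B\otimes B)_{-\ell}$, such that $(F,G)-(\partial^c\tilde\eta,0)\in\tilde{\mathrm{B}}_b^2(A)$.
   Context: Let $\Bbbk$ be an algebraically closed field of characteristic $0$. Let $H$ be a Hopf algebra over $\Bbbk$ with bijective antipode $\mathcal S$. Let ${}^H_H\mathcal{YD}$ be the braided category of left Yetter–Drinfeld modules over $H$, with coaction written $b\mapsto b_{-1}\otimes b_0$. Let $B=\bigoplus_{n\ge0}B_n$ be a graded connected bialgebra in ${}^H_H\mathcal{YD}$: $B_0=\Bbbk$, and each $B_n$ is a Yetter–Drinfeld submodule. Put $B^+=\bigoplus_{n>0}B_n$. Let $A=B\#H$ be the bosonization (Radford–Majid biproduct). It is graded by $A_n=B_n\# H$, so that $A_0=H$. Let $\pi\colon A\to H$, $b\#h\mapsto\varepsilon(b)h$, be the canonical projection. Write $\Delta(a)=a_1\otimes a_2$ in $A$. Grade $A\otimes A$ and $B\otimes B$ by total degree. Standing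 assumption: there is a linear map $\lambda\colon H\to\Bbbk$ with $\lambda(1)=1$, $h_1\lambda(h_2)=\lambda(h)1_H$ for all $h\in H$, and $\lambda(h_1k\mathcal S(h_2))=\varepsilon(h)\lambda(k)$ for all $h,k\in H$. Let $\widehat{\mathrm{Z}}_b^2(A)$ be the set of pairs $(f,g)$ of linear maps $f\colon A\otimes A\to A$ and $g\colon A\to A\otimes A$ satisfying the following conditions. - Normalization: $f(1,\cdot)=f(\cdot,1)=0$, $\varepsilon f=0$, $g(1)=0$, and $(\varepsilon\otimes\mathrm{id})g=(\mathrm{id}\otimes\varepsilon)g=0$. - Hochschild cocycle condition: $af(b,c)+f(a,bc)=f(ab,c)+f(a,b)c$. - Coalgebra cocycle condition: $c_1\otimes g(c_2)+(\mathrm{id}\otimes\Delta)g(c)=(\Delta\otimes\mathrm{id})g(c)+g(c_1)\otimes c_2$. - Compatibility: $f(a_1,b_1)\otimes a_2b_2-\Delta f(a,b)+a_1b_1\otimes f(a_2,b_2)=-\Delta(a)g(b)+g(ab)-g(a)\Delta(b)$. Let $\widehat{\mathrm{B}}_b^2(A)$ be the set of pairs $(f,g)$ for which there is a linear map $s\colon A\to A$ with $f(a,b)=as(b)-s(ab)+s(a)b$ and $g(c)=-c_1\otimes s(c_2)+\Delta s(c)-s(c_1)\otimes c_2$. $\tilde{\mathrm{Z}}_b^2(A)$ is the set of $H$-bitrivial elements of $\widehat{\mathrm{Z}}_b^2(A)$, i.e. those with $f|_{A_0\otimes A}=0=f|_{A\otimes A_0}$ and $(\pi\otimes\mathrm{id})g=0=(\mathrm{id}\otimes\pi)g$.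 Put $\tilde{\mathrm{B}}_b^2(A)=\tilde{\mathrm{Z}}_b^2(A)\cap\widehat{\mathrm{B}}_b^2(A)$ and $\tilde{\mathrm{H}}_b^2(A)=\tilde{\mathrm{Z}}_b^2(A)/\tilde{\mathrm{B}}_b^2(A)$. The subscript $\ell$ means homogeneous of degree $\ell$, i.e. $f((A\otimes A)_p)\subseteq A_{p+\ell}$ and $g(A_p)\subseteq (A\otimes A)_{p+\ell}$. $\mathrm{H}^2_\varepsilon(B,\Bbbk)$ is the Hochschild $2$-cohomology of $B$ with coefficients in $\Bbbk$ via $\varepsilon$. The cocycles are linear maps $\eta\colon B\otimes B\to\Bbbk$ with $\varepsilon(a)\eta(b,c)-\eta(ab,c)+\eta(a,bc)-\eta(a,b)\varepsilon(c)=0$. $H$ acts on such maps by $(h\cdot\eta)(x,y)=\eta(h_1\cdot x,h_2\cdot y)$, and the superscript $H$ denotes $H$-stable classes. The subscript $\ell$ denotes classes of cocycles supported on $(B\otimes B)_{-\ell}$. For such $\eta$, $\tilde\eta\colon A\otimes A\to\Bbbk$ is $\tilde\eta(xh,yk)=\eta(x,h\cdot y)\varepsilon(k)$ for $x,y\in B$ and $h,k\in H$, and $\partial^c\tilde\eta(a,b)=a_1b_1\tilde\eta(a_2,b_2)-\tilde\eta(a_1,b_1)a_2b_2$. $\mathcal P(B)$ denotes the primitive elements of $B$. $\operatorname{M}(B)=\ker(B^+\otimes_BB^+\xrightarrow{\mathrm m}B^+)$, where $B^+\otimes_BB^+$ is $B^+\otimes B^+$ modulo the span of the elements $xy\otimes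 z-x\otimes yz$; it is a graded object of ${}^H_H\mathcal{YD}$. $\mathcal{YD}(\operatorname{M}(B),\mathcal P(B))_\ell$ denotes the morphisms in ${}^H_H\mathcal{YD}$ from $\operatorname{M}(B)$ to $\mathcal P(B)$ homogeneous of degree $\ell$. *)

theory Defs
  imports Main "HOL-Library.Function_Algebras" "HOL-Computational_Algebra.Polynomial"
begin

text \<open>Every vector space is modelled as the space of finitely supported
functions from a basis type to the field. Linear maps are given by their
values on basis vectors. The tensor product of spaces with bases 'a and 'b
is the space with basis 'a * 'b.\<close>

definition bas :: "'b \<Rightarrow> 'b \<Rightarrow> 'k::zero_neq_one" where
  "bas b = (\<lambda>c. if c = b then 1 else 0)"

definition supp :: "('b \<Rightarrow> 'k::zero) \<Rightarrow> 'b set" where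
  "supp v = {b. v b \<noteq> 0}"

definition fs :: "('b \<Rightarrow> 'k::zero) \<Rightarrow> bool" where
  "fs v \<longleftrightarrow> finite (supp v)"

definition ext :: "('b \<Rightarrow> 'c \<Rightarrow> 'k::comm_ring_1) \<Rightarrow> ('b \<Rightarrow> 'k) \<Rightarrow> 'c \<Rightarrow> 'k" where
  "ext L v = (\<lambda>c. \<Sum>b\<in>supp v. v b * L b c)"

definition fapp :: "('b \<Rightarrow> 'k::comm_ring_1) \<Rightarrow> ('b \<Rightarrow> 'k) \<Rightarrow> 'k" where
  "fapp \<phi> v = (\<Sum>b\<in>supp v. v b * \<phi> b)"

definition tens :: "('a \<Rightarrow> 'k::times) \<Rightarrow> ('b \<Rightarrow> 'k) \<Rightarrow> 'a \<times> 'b \<Rightarrow> 'k" where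
  "tens v w = (\<lambda>(x, y). v x * w y)"

definition tmap :: "('a \<Rightarrow> 'c \<Rightarrow> 'k::times) \<Rightarrow> ('b \<Rightarrow> 'd \<Rightarrow> 'k) \<Rightarrow> 'a \<times> 'b \<Rightarrow> 'c \<times> 'd \<Rightarrow> 'k" where
  "tmap L M = (\<lambda>(a, b). tens (L a) (M b))"

definition ext2 :: "('a \<Rightarrow> 'b \<Rightarrow> 'c \<Rightarrow> 'k::comm_ring_1) \<Rightarrow> ('a \<Rightarrow> 'k) \<Rightarrow> ('b \<Rightarrow> 'k) \<Rightarrow> 'c \<Rightarrow> 'k" where
  "ext2 m x y = ext (\<lambda>(a, b). m a b) (tens x y)"

definition fapp2 :: "('a \<Rightarrow> 'b \<Rightarrow> 'k::comm_ring_1) \<Rightarrow> ('a \<Rightarrow> 'k) \<Rightarrow> ('b \<Rightarrow> 'k) \<Rightarrow> 'k" where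
  "fapp2 eta x y = fapp (\<lambda>(a, b). eta a b) (tens x y)"

definition sc :: "'k::times \<Rightarrow> ('b \<Rightarrow> 'k) \<Rightarrow> 'b \<Rightarrow> 'k" where
  "sc c v = (\<lambda>x. c * v x)"

definition rassoc :: "(('a \<times> 'b) \<times> 'c \<Rightarrow> 'k) \<Rightarrow> 'a \<times> ('b \<times> 'c) \<Rightarrow> 'k" where
  "rassoc v = (\<lambda>(x, y, z). v ((x, y), z))"

definition linmap :: "('b \<Rightarrow> 'c \<Rightarrow> 'k::zero) \<Rightarrow> bool" where
  "linmap L \<longleftrightarrow> (\<forall>b. fs (L b))"

text \<open>homogeneity of degree n for a basis consisting of homogeneous elements\<close>
definition homog :: "('b \<Rightarrow> nat) \<Rightarrow> int \<Rightarrow> ('b \<Rightarrow> 'k::zero) \<Rightarrow> bool" where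
  "homog d n v \<longleftrightarrow> (\<forall>x. v x \<noteq> 0 \<longrightarrow> int (d x) = n)"

definition deg2 :: "('b \<Rightarrow> nat) \<Rightarrow> 'b \<times> 'b \<Rightarrow> nat" where
  "deg2 d = (\<lambda>(x, y). d x + d y)"

definition is_algebra :: "('a \<Rightarrow> 'a \<Rightarrow> 'a \<Rightarrow> 'k::comm_ring_1) \<Rightarrow> ('a \<Rightarrow> 'k) \<Rightarrow> bool" where
  "is_algebra m u \<longleftrightarrow> (\<forall>a b. fs (m a b)) \<and> fs u \<and>
     (\<forall>a b c. ext2 m (m a b) (bas c) = ext2 m (bas a) (m b c)) \<and>
     (\<forall>a. ext2 m u (bas a) = bas a \<and> ext2 m (bas a) u = bas a)"

definition is_coalgebra :: "('a \<Rightarrow> 'a \<times> 'a \<Rightarrow> 'k::comm_ring_1) \<Rightarrow> ('a \<Rightarrow> 'k) \<Rightarrow> bool" where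
  "is_coalgebra d e \<longleftrightarrow> linmap d \<and>
     (\<forall>a. rassoc (ext (tmap d bas) (d a)) = ext (tmap bas d) (d a)) \<and>
     (\<forall>a. ext (\<lambda>(x, y). sc (e x) (bas y)) (d a) = bas a \<and>
          ext (\<lambda>(x, y). sc (e y) (bas x)) (d a) = bas a)"

definition tprod :: "('a \<Rightarrow> 'a \<Rightarrow> 'a \<Rightarrow> 'k::comm_ring_1) \<Rightarrow> 'a \<times> 'a \<Rightarrow> 'a \<times> 'a \<Rightarrow> 'a \<times> 'a \<Rightarrow> 'k" where
  "tprod m = (\<lambda>(a1, a2) (b1, b2). tens (m a1 b1) (m a2 b2))"

definition is_hopf :: "('h \<Rightarrow> 'h \<Rightarrow> 'h \<Rightarrow> 'k::comm_ring_1) \<Rightarrow> ('h \<Rightarrow> 'k) \<Rightarrow> ('h \<Rightarrow> 'h \<times> 'h \<Rightarrow> 'k)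
    \<Rightarrow> ('h \<Rightarrow> 'k) \<Rightarrow> ('h \<Rightarrow> 'h \<Rightarrow> 'k) \<Rightarrow> bool" where
  "is_hopf mH uH dH eH SH \<longleftrightarrow> is_algebra mH uH \<and> is_coalgebra dH eH \<and>
     (\<forall>a b. ext dH (mH a b) = ext2 (tprod mH) (dH a) (dH b)) \<and>
     ext dH uH = tens uH uH \<and>
     (\<forall>a b. fapp eH (mH a b) = eH a * eH b) \<and> fapp eH uH = 1 \<and>
     linmap SH \<and>
     (\<forall>a. ext (\<lambda>(x, y). ext2 mH (SH x) (bas y)) (dH a) = sc (eH a) uH \<and>
          ext (\<lambda>(x, y). ext2 mH (bas x) (SH y)) (dH a) = sc (eH a) uH)"

definition bijective_antipode :: "('h \<Rightarrow> 'h \<Rightarrow> 'k::comm_ring_1) \<Rightarrow> bool" where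
  "bijective_antipode SH \<longleftrightarrow> (\<exists>T. linmap T \<and> (\<forall>a. ext T (SH a) = bas a \<and> ext SH (T a) = bas a))"

definition lambda_cond :: "('h \<Rightarrow> 'h \<Rightarrow> 'h \<Rightarrow> 'k::comm_ring_1) \<Rightarrow> ('h \<Rightarrow> 'k) \<Rightarrow> ('h \<Rightarrow> 'h \<times> 'h \<Rightarrow> 'k)
    \<Rightarrow> ('h \<Rightarrow> 'k) \<Rightarrow> ('h \<Rightarrow> 'h \<Rightarrow> 'k) \<Rightarrow> ('h \<Rightarrow> 'k) \<Rightarrow> bool" where
  "lambda_cond mH uH dH eH SH lam \<longleftrightarrow> fapp lam uH = 1 \<and>
     (\<forall>h. ext (\<lambda>(x, y). sc (lam y) (bas x)) (dH h) = sc (lam h) uH) \<and>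
     (\<forall>h k. fapp lam (ext (\<lambda>(x, y). ext2 mH (mH x k) (SH y)) (dH h)) = eH h * lam k)"

definition is_YD :: "('h \<Rightarrow> 'h \<Rightarrow> 'h \<Rightarrow> 'k::comm_ring_1) \<Rightarrow> ('h \<Rightarrow> 'k) \<Rightarrow> ('h \<Rightarrow> 'h \<times> 'h \<Rightarrow> 'k)
    \<Rightarrow> ('h \<Rightarrow> 'k) \<Rightarrow> ('h \<Rightarrow> 'h \<Rightarrow> 'k) \<Rightarrow> ('h \<Rightarrow> 'b \<Rightarrow> 'b \<Rightarrow> 'k) \<Rightarrow> ('b \<Rightarrow> 'h \<times> 'b \<Rightarrow> 'k) \<Rightarrow> bool" where
  "is_YD mH uH dH eH SH act coact \<longleftrightarrow>
     (\<forall>h b. fs (act h b)) \<and> linmap coact \<and>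
     (\<forall>b. ext2 act uH (bas b) = bas b) \<and>
     (\<forall>h k b. ext2 act (mH h k) (bas b) = ext2 act (bas h) (act k b)) \<and>
     (\<forall>b. rassoc (ext (tmap dH bas) (coact b)) = ext (tmap bas coact) (coact b)) \<and>
     (\<forall>b. ext (\<lambda>(x, y). sc (eH x) (bas y)) (coact b) = bas b) \<and>
     (\<forall>h b. ext coact (act h b) =
        ext (\<lambda>(h1, h2, h3). ext (\<lambda>(x, y). tens (ext2 mH (mH h1 x) (SH h3)) (act h2 y)) (coact b))
            (ext (tmap bas dH) (dH h)))"

definition actT :: "('h \<Rightarrow> 'b \<Rightarrow> 'b \<Rightarrow> 'k::comm_ring_1) \<Rightarrow> ('h \<Rightarrow> 'h \<times> 'h \<Rightarrow> 'k) \<Rightarrow> 'h \<Rightarrow> 'b \<times> 'b \<Rightarrow> 'b \<times> 'b \<Rightarrow> 'k" where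
  "actT act dH h = (\<lambda>(b, c). ext (\<lambda>(h1, h2). tens (act h1 b) (act h2 c)) (dH h))"

definition coactT :: "('h \<Rightarrow> 'h \<Rightarrow> 'h \<Rightarrow> 'k::comm_ring_1) \<Rightarrow> ('b \<Rightarrow> 'h \<times> 'b \<Rightarrow> 'k) \<Rightarrow> 'b \<times> 'b \<Rightarrow> 'h \<times> ('b \<times> 'b) \<Rightarrow> 'k" where
  "coactT mH coact = (\<lambda>(b, c). ext2 (\<lambda>(x, b0) (y, c0). tens (mH x y) (tens (bas b0) (bas c0))) (coact b) (coact c))"

definition bprod :: "('b \<Rightarrow> 'b \<Rightarrow> 'b \<Rightarrow> 'k::comm_ring_1) \<Rightarrow> ('h \<Rightarrow> 'b \<Rightarrow> 'b \<Rightarrow> 'k) \<Rightarrow> ('b \<Rightarrow> 'h \<times> 'b \<Rightarrow> 'k)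
    \<Rightarrow> 'b \<times> 'b \<Rightarrow> 'b \<times> 'b \<Rightarrow> 'b \<times> 'b \<Rightarrow> 'k" where
  "bprod mB act coact = (\<lambda>(x1, x2) (y1, y2).
      ext (\<lambda>(z, x20). tens (ext2 mB (bas x1) (act z y1)) (mB x20 y2)) (coact x2))"

text \<open>graded connected bialgebra in the category of YD modules; the basis of B
consists of homogeneous elements, deg gives their degrees\<close>
definition is_gc_YD_bialg :: "('h \<Rightarrow> 'h \<Rightarrow> 'h \<Rightarrow> 'k::comm_ring_1) \<Rightarrow> ('h \<Rightarrow> 'k) \<Rightarrow> ('h \<Rightarrow> 'h \<times> 'h \<Rightarrow> 'k)
    \<Rightarrow> ('h \<Rightarrow> 'k) \<Rightarrow> ('h \<Rightarrow> 'b \<Rightarrow> 'b \<Rightarrow> 'k) \<Rightarrow> ('b \<Rightarrow> 'h \<times> 'b \<Rightarrow> 'k)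
    \<Rightarrow> ('b \<Rightarrow> 'b \<Rightarrow> 'b \<Rightarrow> 'k) \<Rightarrow> ('b \<Rightarrow> 'k) \<Rightarrow> ('b \<Rightarrow> 'b \<times> 'b \<Rightarrow> 'k) \<Rightarrow> ('b \<Rightarrow> 'k) \<Rightarrow> ('b \<Rightarrow> nat) \<Rightarrow> bool" where
  "is_gc_YD_bialg mH uH dH eH act coact mB uB dB eB deg \<longleftrightarrow>
     is_algebra mB uB \<and> is_coalgebra dB eB \<and>
     \<comment> \<open>structure maps are YD morphisms\<close>
     (\<forall>h b c. ext (act h) (mB b c) = ext (\<lambda>(x, y). mB x y) (actT act dH h (b, c))) \<and>
     (\<forall>b c. ext coact (mB b c) = ext (tmap bas (\<lambda>(x, y). mB x y)) (coactT mH coact (b, c))) \<and>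
     (\<forall>h. ext (act h) uB = sc (eH h) uB) \<and> ext coact uB = tens uH uB \<and>
     (\<forall>h b. ext dB (act h b) = ext (actT act dH h) (dB b)) \<and>
     (\<forall>b. ext (tmap bas dB) (coact b) = ext (coactT mH coact) (dB b)) \<and>
     (\<forall>h b. fapp eB (act h b) = eH h * eB b) \<and>
     (\<forall>b. ext (\<lambda>(x, y). sc (eB y) (bas x)) (coact b) = sc (eB b) uH) \<and>
     \<comment> \<open>bialgebra in the braided category\<close>
     (\<forall>b c. ext dB (mB b c) = ext2 (bprod mB act coact) (dB b) (dB c)) \<and>
     ext dB uB = tens uB uB \<and>
     (\<forall>b c. fapp eB (mB b c) = eB b * eB c) \<and> fapp eB uB = 1 \<and>
     \<comment> \<open>grading, each B_n a YD submodule\<close>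
     (\<forall>b c. homog deg (int (deg b + deg c)) (mB b c)) \<and> homog deg 0 uB \<and>
     (\<forall>b. homog (deg2 deg) (int (deg b)) (dB b)) \<and>
     (\<forall>b. deg b > 0 \<longrightarrow> eB b = 0) \<and>
     (\<forall>h b. homog deg (int (deg b)) (act h b)) \<and>
     (\<forall>b x y. coact b (x, y) \<noteq> 0 \<longrightarrow> deg y = deg b) \<and>
     \<comment> \<open>connected: B_0 is one-dimensional\<close>
     (\<exists>b0. \<forall>b. deg b = 0 \<longleftrightarrow> b = b0)"

section \<open>Bosonization A = B # H, basis 'b * 'h (b # h)\<close>

definition bos_mult :: "('b \<Rightarrow> 'b \<Rightarrow> 'b \<Rightarrow> 'k::comm_ring_1) \<Rightarrow> ('h \<Rightarrow> 'b \<Rightarrow> 'b \<Rightarrow> 'k) \<Rightarrow> ('h \<Rightarrow> 'h \<Rightarrow> 'h \<Rightarrow> 'k)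
    \<Rightarrow> ('h \<Rightarrow> 'h \<times> 'h \<Rightarrow> 'k) \<Rightarrow> 'b \<times> 'h \<Rightarrow> 'b \<times> 'h \<Rightarrow> 'b \<times> 'h \<Rightarrow> 'k" where
  "bos_mult mB act mH dH = (\<lambda>(b, h) (c, k).
      ext (\<lambda>(h1, h2). tens (ext2 mB (bas b) (act h1 c)) (mH h2 k)) (dH h))"

definition bos_unit :: "('b \<Rightarrow> 'k::comm_ring_1) \<Rightarrow> ('h \<Rightarrow> 'k) \<Rightarrow> 'b \<times> 'h \<Rightarrow> 'k" where
  "bos_unit uB uH = tens uB uH"

definition bos_comult :: "('b \<Rightarrow> 'b \<times> 'b \<Rightarrow> 'k::comm_ring_1) \<Rightarrow> ('b \<Rightarrow> 'h \<times> 'b \<Rightarrow> 'k) \<Rightarrow> ('h \<Rightarrow> 'h \<Rightarrow> 'h \<Rightarrow> 'k)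
    \<Rightarrow> ('h \<Rightarrow> 'h \<times> 'h \<Rightarrow> 'k) \<Rightarrow> 'b \<times> 'h \<Rightarrow> ('b \<times> 'h) \<times> ('b \<times> 'h) \<Rightarrow> 'k" where
  "bos_comult dB coact mH dH = (\<lambda>(b, h).
      ext (\<lambda>(b1, b2). ext (\<lambda>(y, b20). ext (\<lambda>(h1, h2).
          tens (tens (bas b1) (mH y h1)) (tens (bas b20) (bas h2))) (dH h)) (coact b2)) (dB b))"

definition bos_counit :: "('b \<Rightarrow> 'k::comm_ring_1) \<Rightarrow> ('h \<Rightarrow> 'k) \<Rightarrow> 'b \<times> 'h \<Rightarrow> 'k" where
  "bos_counit eB eH = (\<lambda>(b, h). eB b * eH h)"

definition bos_deg :: "('b \<Rightarrow> nat) \<Rightarrow> 'b \<times> 'h \<Rightarrow> nat" where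
  "bos_deg deg = (\<lambda>(b, h). deg b)"

definition bos_pi :: "('b \<Rightarrow> 'k::comm_ring_1) \<Rightarrow> 'b \<times> 'h \<Rightarrow> 'h \<Rightarrow> 'k" where
  "bos_pi eB = (\<lambda>(b, h). sc (eB b) (bas h))"

definition Zhat :: "('a \<Rightarrow> 'a \<Rightarrow> 'a \<Rightarrow> 'k::comm_ring_1) \<Rightarrow> ('a \<Rightarrow> 'k) \<Rightarrow> ('a \<Rightarrow> 'a \<times> 'a \<Rightarrow> 'k) \<Rightarrow> ('a \<Rightarrow> 'k)
    \<Rightarrow> ('a \<Rightarrow> 'a \<Rightarrow> 'a \<Rightarrow> 'k) \<Rightarrow> ('a \<Rightarrow> 'a \<times> 'a \<Rightarrow> 'k) \<Rightarrow> bool" where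
  "Zhat mA uA dA eA f g \<longleftrightarrow>
     (\<forall>a b. fs (f a b)) \<and> linmap g \<and>
     \<comment> \<open>normalization\<close>
     (\<forall>a. ext2 f uA (bas a) = 0 \<and> ext2 f (bas a) uA = 0) \<and>
     (\<forall>a b. fapp eA (f a b) = 0) \<and>
     ext g uA = 0 \<and>
     (\<forall>c. ext (\<lambda>(x, y). sc (eA x) (bas y)) (g c) = 0 \<and> ext (\<lambda>(x, y). sc (eA y) (bas x)) (g c) = 0) \<and>
     \<comment> \<open>Hochschild cocycle condition\<close>
     (\<forall>a b c. ext2 mA (bas a) (f b c) + ext2 f (bas a) (mA b c) = ext2 f (mA a b) (bas c) + ext2 mA (f a b) (bas c)) \<and>
     \<comment> \<open>coalgebra cocycle condition\<close>
     (\<forall>c. ext (tmap bas g) (dA c) + ext (tmap bas dA) (g c) =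
          rassoc (ext (tmap dA bas) (g c) + ext (tmap g bas) (dA c))) \<and>
     \<comment> \<open>compatibility\<close>
     (\<forall>a b. ext2 (\<lambda>(a1, a2) (b1, b2). tens (f a1 b1) (mA a2 b2)) (dA a) (dA b) - ext dA (f a b)
             + ext2 (\<lambda>(a1, a2) (b1, b2). tens (mA a1 b1) (f a2 b2)) (dA a) (dA b)
           = - ext2 (tprod mA) (dA a) (g b) + ext g (mA a b) - ext2 (tprod mA) (g a) (dA b))"

definition Bhat :: "('a \<Rightarrow> 'a \<Rightarrow> 'a \<Rightarrow> 'k::comm_ring_1) \<Rightarrow> ('a \<Rightarrow> 'a \<times> 'a \<Rightarrow> 'k)
    \<Rightarrow> ('a \<Rightarrow> 'a \<Rightarrow> 'a \<Rightarrow> 'k) \<Rightarrow> ('a \<Rightarrow> 'a \<times> 'a \<Rightarrow> 'k) \<Rightarrow> bool" where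
  "Bhat mA dA f g \<longleftrightarrow> (\<exists>s. linmap s \<and>
     (\<forall>a b. f a b = ext2 mA (bas a) (s b) - ext s (mA a b) + ext2 mA (s a) (bas b)) \<and>
     (\<forall>c. g c = - ext (tmap bas s) (dA c) + ext dA (s c) - ext (tmap s bas) (dA c)))"

text \<open>H-bitrivial cocycles of the bosonization (A_0 = span of basis vectors of degree 0)\<close>
definition Ztilde :: "('h \<Rightarrow> 'h \<Rightarrow> 'h \<Rightarrow> 'k::comm_ring_1) \<Rightarrow> ('h \<Rightarrow> 'k) \<Rightarrow> ('h \<Rightarrow> 'h \<times> 'h \<Rightarrow> 'k)
    \<Rightarrow> ('h \<Rightarrow> 'k) \<Rightarrow> ('h \<Rightarrow> 'b \<Rightarrow> 'b \<Rightarrow> 'k) \<Rightarrow> ('b \<Rightarrow> 'h \<times> 'b \<Rightarrow> 'k)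
    \<Rightarrow> ('b \<Rightarrow> 'b \<Rightarrow> 'b \<Rightarrow> 'k) \<Rightarrow> ('b \<Rightarrow> 'k) \<Rightarrow> ('b \<Rightarrow> 'b \<times> 'b \<Rightarrow> 'k) \<Rightarrow> ('b \<Rightarrow> 'k) \<Rightarrow> ('b \<Rightarrow> nat)
    \<Rightarrow> ('b \<times> 'h \<Rightarrow> 'b \<times> 'h \<Rightarrow> 'b \<times> 'h \<Rightarrow> 'k) \<Rightarrow> ('b \<times> 'h \<Rightarrow> ('b \<times> 'h) \<times> ('b \<times> 'h) \<Rightarrow> 'k) \<Rightarrow> bool" where
  "Ztilde mH uH dH eH act coact mB uB dB eB deg f g \<longleftrightarrow>
     Zhat (bos_mult mB act mH dH) (bos_unit uB uH) (bos_comult dB coact mH dH) (bos_counit eB eH) f g \<and>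
     (\<forall>a a'. bos_deg deg a = 0 \<longrightarrow> f a a' = 0 \<and> f a' a = 0) \<and>
     (\<forall>c. ext (tmap (bos_pi eB) bas) (g c) = 0 \<and> ext (tmap bas (bos_pi eB)) (g c) = 0)"

definition Btilde where
  "Btilde mH uH dH eH act coact mB uB dB eB deg f g \<longleftrightarrow>
     Ztilde mH uH dH eH act coact mB uB dB eB deg f g \<and>
     Bhat (bos_mult mB act mH dH) (bos_comult dB coact mH dH) f g"

definition homog_pair :: "('b \<Rightarrow> nat) \<Rightarrow> int \<Rightarrow> ('b \<times> 'h \<Rightarrow> 'b \<times> 'h \<Rightarrow> 'b \<times> 'h \<Rightarrow> 'k::zero)
    \<Rightarrow> ('b \<times> 'h \<Rightarrow> ('b \<times> 'h) \<times> ('b \<times> 'h) \<Rightarrow> 'k) \<Rightarrow> bool" where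
  "homog_pair deg l f g \<longleftrightarrow>
     (\<forall>a b. homog (bos_deg deg) (int (bos_deg deg a + bos_deg deg b) + l) (f a b)) \<and>
     (\<forall>c. homog (deg2 (bos_deg deg)) (int (bos_deg deg c) + l) (g c))"

definition hoch_cocycle :: "('b \<Rightarrow> 'b \<Rightarrow> 'b \<Rightarrow> 'k::comm_ring_1) \<Rightarrow> ('b \<Rightarrow> 'k) \<Rightarrow> ('b \<Rightarrow> 'b \<Rightarrow> 'k) \<Rightarrow> bool" where
  "hoch_cocycle mB eB eta \<longleftrightarrow> (\<forall>a b c.
     eB a * eta b c - fapp2 eta (mB a b) (bas c) + fapp2 eta (bas a) (mB b c) - eta a b * eB c = 0)"

definition hact_coch :: "('h \<Rightarrow> 'h \<times> 'h \<Rightarrow> 'k::comm_ring_1) \<Rightarrow> ('h \<Rightarrow> 'b \<Rightarrow> 'b \<Rightarrow> 'k)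
    \<Rightarrow> ('b \<Rightarrow> 'b \<Rightarrow> 'k) \<Rightarrow> 'h \<Rightarrow> 'b \<Rightarrow> 'b \<Rightarrow> 'k" where
  "hact_coch dH act eta h b c = fapp (\<lambda>(x, y). fapp2 eta (act x b) (act y c)) (dH h)"

definition eta_tilde :: "('h \<Rightarrow> 'k::comm_ring_1) \<Rightarrow> ('h \<Rightarrow> 'b \<Rightarrow> 'b \<Rightarrow> 'k) \<Rightarrow> ('b \<Rightarrow> 'b \<Rightarrow> 'k)
    \<Rightarrow> 'b \<times> 'h \<Rightarrow> 'b \<times> 'h \<Rightarrow> 'k" where
  "eta_tilde eH act eta = (\<lambda>(b, h) (c, k). fapp2 eta (bas b) (act h c) * eH k)"

definition dc :: "('a \<Rightarrow> 'a \<Rightarrow> 'a \<Rightarrow> 'k::comm_ring_1) \<Rightarrow> ('a \<Rightarrow> 'a \<times> 'a \<Rightarrow> 'k) \<Rightarrow> ('a \<Rightarrow> 'a \<Rightarrow> 'k)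
    \<Rightarrow> 'a \<Rightarrow> 'a \<Rightarrow> 'a \<Rightarrow> 'k" where
  "dc mA dA et = (\<lambda>a b. ext2 (\<lambda>(a1, a2) (b1, b2). sc (et a2 b2) (mA a1 b1) - sc (et a1 b1) (mA a2 b2)) (dA a) (dA b))"

inductive_set subalg :: "('b \<Rightarrow> 'b \<Rightarrow> 'b \<Rightarrow> 'k::comm_ring_1) \<Rightarrow> ('b \<Rightarrow> 'k) \<Rightarrow> ('b \<Rightarrow> 'k) set \<Rightarrow> ('b \<Rightarrow> 'k) set"
  for mB uB S where
    gen: "v \<in> S \<Longrightarrow> v \<in> subalg mB uB S"
  | one: "uB \<in> subalg mB uB S"
  | add: "v \<in> subalg mB uB S \<Longrightarrow> w \<in> subalg mB uB S \<Longrightarrow> v + w \<in> subalg mB uB S"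
  | smult: "v \<in> subalg mB uB S \<Longrightarrow> sc c v \<in> subalg mB uB S"
  | mult: "v \<in> subalg mB uB S \<Longrightarrow> w \<in> subalg mB uB S \<Longrightarrow> ext2 mB v w \<in> subalg mB uB S"

text \<open>K = ker (m : B+ (x) B+ -> B+); M(B) = K / R with
R = span{xy (x) z - x (x) yz | x, z in B+, y in B}\<close>
definition Kset :: "('b \<Rightarrow> 'b \<Rightarrow> 'b \<Rightarrow> 'k::comm_ring_1) \<Rightarrow> ('b \<Rightarrow> nat) \<Rightarrow> ('b \<times> 'b \<Rightarrow> 'k) set" where
  "Kset mB deg = {t. fs t \<and> (\<forall>x y. t (x, y) \<noteq> 0 \<longrightarrow> deg x > 0 \<and> deg y > 0) \<and>
                     ext (\<lambda>(x, y). mB x y) t = 0}"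

definition YD_MP_zero :: "('h \<Rightarrow> 'h \<Rightarrow> 'h \<Rightarrow> 'k::comm_ring_1) \<Rightarrow> ('h \<Rightarrow> 'h \<times> 'h \<Rightarrow> 'k)
    \<Rightarrow> ('h \<Rightarrow> 'b \<Rightarrow> 'b \<Rightarrow> 'k) \<Rightarrow> ('b \<Rightarrow> 'h \<times> 'b \<Rightarrow> 'k)
    \<Rightarrow> ('b \<Rightarrow> 'b \<Rightarrow> 'b \<Rightarrow> 'k) \<Rightarrow> ('b \<Rightarrow> 'k) \<Rightarrow> ('b \<Rightarrow> 'b \<times> 'b \<Rightarrow> 'k) \<Rightarrow> ('b \<Rightarrow> nat) \<Rightarrow> int \<Rightarrow> bool" where
  "YD_MP_zero mH dH act coact mB uB dB deg l \<longleftrightarrow>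
    (\<forall>\<phi> :: ('b \<times> 'b \<Rightarrow> 'k) \<Rightarrow> 'b \<Rightarrow> 'k.
       \<comment> \<open>linear on K\<close>
       (\<forall>t\<in>Kset mB deg. \<forall>u\<in>Kset mB deg. \<phi> (t + u) = \<phi> t + \<phi> u) \<and>
       (\<forall>c. \<forall>t\<in>Kset mB deg. \<phi> (sc c t) = sc c (\<phi> t)) \<and>
       \<comment> \<open>vanishes on R, i.e. factors through M(B)\<close>
       (\<forall>x y z. deg x > 0 \<longrightarrow> deg z > 0 \<longrightarrow>
           \<phi> (tens (mB x y) (bas z) - tens (bas x) (mB y z)) = 0) \<and>
       \<comment> \<open>values in P(B)\<close>
       (\<forall>t\<in>Kset mB deg. fs (\<phi> t) \<and> ext dB (\<phi> t) = tens (\<phi> t) uB + tens uB (\<phi> t)) \<and>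
       \<comment> \<open>H-linear\<close>
       (\<forall>h. \<forall>t\<in>Kset mB deg. \<phi> (ext (actT act dH h) t) = ext (act h) (\<phi> t)) \<and>
       \<comment> \<open>H-colinear: delta(phi t) = (id (x) phi) delta(t)\<close>
       (\<forall>t\<in>Kset mB deg. \<forall>x b. ext coact (\<phi> t) (x, b) = \<phi> (\<lambda>p. ext (coactT mH coact) t (x, p)) b) \<and>
       \<comment> \<open>homogeneous of degree l\<close>
       (\<forall>t\<in>Kset mB deg. \<forall>p. homog (deg2 deg) p t \<longrightarrow> homog deg (p + l) (\<phi> t))
     \<longrightarrow> (\<forall>t\<in>Kset mB deg. \<phi> t = 0))"

definition alg_closed :: "'k::field itself \<Rightarrow> bool" where
  "alg_closed _ \<longleftrightarrow> (\<forall>p :: 'k poly. degree p > 0 \<longrightarrow> (\<exists>x. poly p x = 0))"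

end

(* The cocycle F lowers degrees by L = -l. In total degree L it takes values in H, and there the compatibility
   condition says F(x,y) (x) 1 + x_{-1} y_{-1} (x) F(x_0,y_0) = Delta F(x,y); applying id (x) lambda shows
   that F is the coboundary of eta = - lambda F, and the invariance of lambda makes eta H-stable. After
   subtracting it, F vanishes in total degree at most L. Inductively, let F vanish in total degree at most n,
   where n >= L. As A is generated in degrees at most L, compatibility forces G to vanish up to degree n.
   Then F in degree n + 1 restricts to a Yetter-Drinfeld morphism from M(B) to P(B), which is zero by
   assumption, so F vanishes on the kernel of the multiplication A^+ (x) A^+ -> A and F(a,b) = - s(ab) for a
   unique s on A_{n+1}. Subtracting the coboundary of s kills degree n + 1. *)
theory Submission
  imports Defs "HOL-Library.Poly_Mapping"
begin

section \<open>Finitely supported vectors\<close>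

text \<open>Bitriviality makes F determined by its restriction F_B to B \<otimes> B, with h F_B(x,y)
  = F_B(h_1 x, h_2 y) h_3. If F and G vanish below the total degree of x and y, compatibility
  becomes Delta F_B(x,y) = F_B(x,y) \<otimes> 1 + x_{-1} y_{-1} \<otimes> F_B(x_0,y_0) - G(xy), and
  the last term disappears on the kernel of multiplication. Let pi: A -> H be the projection and
  theta: A -> B the map b # h -> epsilon(h) b. In degree n + 1 > L the values of F_B have positive
  degree, so pi kills them. Then theta \<otimes> pi shows that the values on the kernel lie in B #
  1, pi \<otimes> theta gives colinearity and theta \<otimes> theta primitivity. In total degree L
  the values have degree 0, pi loses nothing, and lambda takes over. The correction s comes from
  arbitrary preimages under multiplication and is not chosen H-linear. That the corrected cocycle is
  again bitrivial is recovered from the cocycle identity. Each s lives in a single degree, so the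
  infinite sum of corrections is finite in every degree.\<close>

abbreviation "lookup \<equiv> Poly_Mapping.lookup"
abbreviation "keys \<equiv> Poly_Mapping.keys"

lift_definition sm :: "'k::comm_ring_1 \<Rightarrow> ('b \<Rightarrow>\<^sub>0 'k) \<Rightarrow> ('b \<Rightarrow>\<^sub>0 'k)"
  is "\<lambda>c v b. c * v b"
  by (rule finite_subset[rotated]) auto

lemma lookup_sm [simp]: "lookup (sm c v) b = c * lookup v b"
  by transfer simp

lemma sm_simps [simp]:
  "sm 1 v = v" "sm 0 v = 0" "sm c 0 = 0" "sm c (sm d v) = sm (c * d) v"
  by (auto intro!: poly_mapping_eqI simp: mult.assoc)

lemma sm_add: "sm c (v + w) = sm c v + sm c w"
  and sm_add_left: "sm (c + d) v = sm c v + sm d v"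
  and sm_minus: "sm c (- v) = - sm c v"
  and sm_minus_left: "sm (- c) v = - sm c v"
  by (auto intro!: poly_mapping_eqI simp: lookup_add lookup_minus algebra_simps)

abbreviation ret :: "'b \<Rightarrow> ('b \<Rightarrow>\<^sub>0 'k::comm_ring_1)" where
  "ret b \<equiv> Poly_Mapping.single b 1"

text \<open>
  \<open>sm\<close>, \<open>tn\<close>, \<open>fa\<close> are \<open>sc\<close>, \<open>tens\<close>, \<open>fapp\<close> on vectors whose finite support is
  part of the type. \<open>bind\<close> is linear extension, the bind of a commutative monad, and
  \<open>bind2 (d a) (\<lambda>a1 a2. K a1 a2)\<close> is Sweedler notation. A structure axiom is restated as a lemma
  \<open>_K\<close> with a continuation \<open>K\<close>, so that it rewrites inside longer Sweedler expressions.
\<close>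

definition bind :: "('b \<Rightarrow>\<^sub>0 'k::comm_ring_1) \<Rightarrow> ('b \<Rightarrow> 'c \<Rightarrow>\<^sub>0 'k) \<Rightarrow> 'c \<Rightarrow>\<^sub>0 'k" where
  "bind v f = (\<Sum>b\<in>keys v. sm (lookup v b) (f b))"

definition bind2 :: "('a \<times> 'b \<Rightarrow>\<^sub>0 'k::comm_ring_1) \<Rightarrow> ('a \<Rightarrow> 'b \<Rightarrow> 'c \<Rightarrow>\<^sub>0 'k) \<Rightarrow> 'c \<Rightarrow>\<^sub>0 'k" where
  "bind2 v f = bind v (\<lambda>p. f (fst p) (snd p))"

lemma bind_superset:
  assumes "finite S" "keys v \<subseteq> S"
  shows "bind v f = (\<Sum>b\<in>S. sm (lookup v b) (f b))"
  unfolding bind_def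
  by (rule sum.mono_neutral_left) (use assms in \<open>auto simp: in_keys_iff\<close>)

lemma lookup_bind: "lookup (bind v f) c = (\<Sum>b\<in>keys v. lookup v b * lookup (f b) c)"
  by (simp add: bind_def lookup_sum)

lemma bind_cong [fundef_cong]:
  "v = w \<Longrightarrow> (\<And>b. b \<in> keys w \<Longrightarrow> f b = g b) \<Longrightarrow> bind v f = bind w g"
  unfolding bind_def by (auto intro: sum.cong)

lemma bind2_cong:
  "(\<And>x y. (x, y) \<in> keys v \<Longrightarrow> f x y = g x y) \<Longrightarrow> bind2 v f = bind2 v g"
  unfolding bind2_def by (auto intro!: bind_cong)

lemma bind_ret [simp]: "bind (ret b) f = f b"
  by (simp add: bind_def)

lemma bind_ret_right [simp]: "bind v ret = v"
proof (rule poly_mapping_eqI)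
  fix k
  show "lookup (bind v ret) k = lookup v k"
    by (cases "k \<in> keys v")
      (auto simp: lookup_bind lookup_single when_def if_distrib[of "\<lambda>x. _ * x"] in_keys_iff
        cong: if_cong)
qed

lemma bind_add_left: "bind (v + w) f = bind v f + bind w f"
proof -
  let ?S = "keys v \<union> keys w"
  have "bind (v + w) f = (\<Sum>b\<in>?S. sm (lookup (v + w) b) (f b))"
    by (rule bind_superset) (auto simp: keys_add)
  moreover have "bind v f = (\<Sum>b\<in>?S. sm (lookup v b) (f b))"
    "bind w f = (\<Sum>b\<in>?S. sm (lookup w b) (f b))"
    by (rule bind_superset; auto)+
  ultimately show ?thesis
    by (simp add: lookup_add sm_add_left sum.distrib)
qed

lemma bind_sm_left: "bind (sm c v) f = sm c (bind v f)"
proof -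
  have "bind (sm c v) f = (\<Sum>b\<in>keys v. sm (lookup (sm c v) b) (f b))"
    by (rule bind_superset) (auto simp: in_keys_iff)
  also have "\<dots> = sm c (bind v f)"
    by (auto intro!: poly_mapping_eqI
        simp: bind_def lookup_sum sum_distrib_left mult.assoc)
  finally show ?thesis .
qed

lemma bind_zero_left [simp]: "bind 0 f = 0"
  by (simp add: bind_def)

lemma bind_minus_left: "bind (- v) f = - bind v f"
  using bind_sm_left[of "-1" v f] by (simp add: sm_minus_left)

lemma bind_diff_left: "bind (v - w) f = bind v f - bind w f"
  using bind_add_left[of v "- w" f] by (simp add: bind_minus_left)

lemma bind_sum_left: "bind (sum h S) f = (\<Sum>i\<in>S. bind (h i) f)"
  by (induction S rule: infinite_finite_induct) (auto simp: bind_add_left)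

lemma bind_add: "bind v (\<lambda>x. f x + g x) = bind v f + bind v g"
  by (simp add: bind_def sm_add sum.distrib)

lemma bind_sm: "bind v (\<lambda>x. sm c (f x)) = sm c (bind v f)"
  by (auto intro!: poly_mapping_eqI simp: lookup_bind sum_distrib_left mult.left_commute)

lemma bind_zero [simp]: "bind v (\<lambda>x. 0) = 0"
  by (simp add: bind_def)

lemma bind_minus: "bind v (\<lambda>x. - f x) = - bind v f"
  using bind_sm[of v "-1" f] by (simp add: sm_minus_left)

lemma bind_diff: "bind v (\<lambda>x. f x - g x) = bind v f - bind v g"
  using bind_add[of v f "\<lambda>x. - g x"] by (simp add: bind_minus)

lemma bind_assoc: "bind (bind v f) g = bind v (\<lambda>x. bind (f x) g)"
  by (simp add: bind_def[of v] bind_sum_left bind_sm_left)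

lemma bind_commute: "bind v (\<lambda>x. bind w (\<lambda>y. f x y)) = bind w (\<lambda>y. bind v (\<lambda>x. f x y))"
proof (rule poly_mapping_eqI)
  fix k
  show "lookup (bind v (\<lambda>x. bind w (\<lambda>y. f x y))) k = lookup (bind w (\<lambda>y. bind v (\<lambda>x. f x y))) k"
    by (simp add: lookup_bind sum_distrib_left mult.left_commute
        sum.swap[of _ "keys v" "keys w"])
qed

lemma bind_eq_0: "(\<And>b. b \<in> keys v \<Longrightarrow> f b = 0) \<Longrightarrow> bind v f = 0"
  using bind_cong[of v v f "\<lambda>_. 0"] by simp

lemma bind2_eq_0: "(\<And>x y. (x, y) \<in> keys v \<Longrightarrow> f x y = 0) \<Longrightarrow> bind2 v f = 0"
  unfolding bind2_def by (rule bind_eq_0) auto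

lemma keys_bindD: "c \<in> keys (bind v f) \<Longrightarrow> \<exists>b\<in>keys v. c \<in> keys (f b)"
  by (rule ccontr) (auto simp: in_keys_iff lookup_bind intro!: sum.neutral)

lemma keys_bind2D: "c \<in> keys (bind2 v f) \<Longrightarrow> \<exists>x y. (x, y) \<in> keys v \<and> c \<in> keys (f x y)"
  unfolding bind2_def by (drule keys_bindD) force

lemma bind2_ret [simp]: "bind2 (ret (a, b)) f = f a b"
  by (simp add: bind2_def)

lemma bind2_ret_right [simp]: "bind2 v (\<lambda>x y. ret (x, y)) = v"
  by (simp add: bind2_def)

lemma bind2_left:
  "bind2 (v + w) g = bind2 v g + bind2 w g" "bind2 (v - w) g = bind2 v g - bind2 w g"
  "bind2 (- v) g = - bind2 v g" "bind2 (sm c v) g = sm c (bind2 v g)"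
  by (simp_all add: bind2_def bind_add_left bind_diff_left bind_minus_left bind_sm_left)

lemma bind2_right:
  "bind2 v (\<lambda>x y. f x y + g x y) = bind2 v f + bind2 v g"
  "bind2 v (\<lambda>x y. f x y - g x y) = bind2 v f - bind2 v g"
  "bind2 v (\<lambda>x y. - f x y) = - bind2 v f"
  by (simp_all add: bind2_def bind_add bind_diff bind_minus)

lemma bind2_sm: "bind2 v (\<lambda>x y. sm c (f x y)) = sm c (bind2 v f)"
  by (simp add: bind2_def bind_sm)

lemma bind2_zero [simp]: "bind2 0 g = 0" "bind2 v (\<lambda>x y. 0) = 0"
  by (simp_all add: bind2_def)

lemma bind2_bind_assoc: "bind2 (bind v f) g = bind v (\<lambda>x. bind2 (f x) g)"
  by (simp add: bind2_def bind_assoc)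

lemma bind_bind2_assoc: "bind (bind2 v h) k = bind2 v (\<lambda>x y. bind (h x y) k)"
  by (simp add: bind2_def bind_assoc)

lemma bind2_bind2_assoc: "bind2 (bind2 v h) g = bind2 v (\<lambda>x y. bind2 (h x y) g)"
  by (simp add: bind2_def bind_assoc)

lemma bind2_bind_commute:
  "bind2 v (\<lambda>x y. bind w (\<lambda>z. f x y z)) = bind w (\<lambda>z. bind2 v (\<lambda>x y. f x y z))"
  by (simp add: bind2_def bind_commute[of v])

lemma bind2_commute:
  "bind2 v (\<lambda>x y. bind2 w (\<lambda>z u. f x y z u)) = bind2 w (\<lambda>z u. bind2 v (\<lambda>x y. f x y z u))"
  by (simp add: bind2_def bind_commute[of v])

lemmas bind_linear = bind_add_left bind_diff_left bind_minus_left bind_sm_left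
  bind_add bind_diff bind_minus bind_sm bind2_left bind2_right bind2_sm

lemmas bind_assocs = bind_assoc bind2_bind_assoc bind_bind2_assoc bind2_bind2_assoc

definition tn :: "('a \<Rightarrow>\<^sub>0 'k::comm_ring_1) \<Rightarrow> ('b \<Rightarrow>\<^sub>0 'k) \<Rightarrow> ('a \<times> 'b \<Rightarrow>\<^sub>0 'k)" where
  "tn v w = bind v (\<lambda>x. bind w (\<lambda>y. ret (x, y)))"

lemma lookup_tn: "lookup (tn v w) (x, y) = lookup v x * lookup w y"
proof -
  have "lookup (tn v w) (x, y) = (\<Sum>a\<in>keys v. lookup v a * (\<Sum>b\<in>keys w. lookup w b * (if a = x \<and> b = y then 1 else 0)))"
    by (simp add: tn_def lookup_bind lookup_single when_def)
  also have "\<dots> = (\<Sum>a\<in>keys v. if a = x then lookup v x * (\<Sum>b\<in>keys w. if b = y then lookup w y else 0) else 0)"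
    by (intro sum.cong refl)
      (auto intro!: sum.cong simp: if_distrib[of "\<lambda>t. _ * t"] in_keys_iff cong: if_cong)
  also have "\<dots> = lookup v x * lookup w y"
    by (cases "x \<in> keys v"; cases "y \<in> keys w") (auto simp: in_keys_iff)
  finally show ?thesis .
qed

lemma bind2_tn: "bind2 (tn v w) f = bind v (\<lambda>x. bind w (\<lambda>y. f x y))"
  by (simp add: tn_def bind_assocs)

section \<open>Cocycles of graded bialgebras\<close>

text \<open>Associativity, multiplicativity of the coproduct and the grading are what turns a map
  \<open>s\<close> into a cocycle pair and what drives the induction on degrees.\<close>

locale graded_prebialgebra =
  fixes m :: "'a \<Rightarrow> 'a \<Rightarrow> ('a \<Rightarrow>\<^sub>0 'k::comm_ring_1)"
    and d :: "'a \<Rightarrow> ('a \<times> 'a \<Rightarrow>\<^sub>0 'k)"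
    and deg :: "'a \<Rightarrow> nat"
  assumes m_assoc: "bind (m a b) (\<lambda>x. m x c) = bind (m b c) (\<lambda>x. m a x)"
    and d_m: "bind (m a b) d = bind2 (d a) (\<lambda>a1 a2. bind2 (d b) (\<lambda>b1 b2. tn (m a1 b1) (m a2 b2)))"
    and m_deg: "c \<in> keys (m a b) \<Longrightarrow> deg c = deg a + deg b"
    and d_deg: "(x, y) \<in> keys (d a) \<Longrightarrow> deg x + deg y = deg a"
begin

lemma m_assoc_K: "bind (m a b) (\<lambda>x. bind (m x c) K) = bind (m b c) (\<lambda>x. bind (m a x) K)"
  using arg_cong[OF m_assoc[of a b c], of "\<lambda>v. bind v K"] by (simp add: bind_assoc)

lemma d_m_K: "bind (m a b) (\<lambda>x. bind2 (d x) K) =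
    bind2 (d a) (\<lambda>a1 a2. bind2 (d b) (\<lambda>b1 b2. bind (m a1 b1) (\<lambda>x. bind (m a2 b2) (\<lambda>y. K x y))))"
  using arg_cong[OF d_m[of a b], of "\<lambda>v. bind2 v K"] by (simp add: bind_assocs bind2_tn)

definition hoch :: "('a \<Rightarrow> 'a \<Rightarrow> ('a \<Rightarrow>\<^sub>0 'k)) \<Rightarrow> bool" where
  "hoch F \<longleftrightarrow> (\<forall>a b c. bind (F b c) (m a) + bind (m b c) (F a) =
     bind (m a b) (\<lambda>x. F x c) + bind (F a b) (\<lambda>x. m x c))"

definition compat :: "('a \<Rightarrow> 'a \<Rightarrow> ('a \<Rightarrow>\<^sub>0 'k)) \<Rightarrow> ('a \<Rightarrow> ('a \<times> 'a \<Rightarrow>\<^sub>0 'k)) \<Rightarrow> bool" where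
  "compat F G \<longleftrightarrow> (\<forall>a b.
     bind2 (d a) (\<lambda>a1 a2. bind2 (d b) (\<lambda>b1 b2. tn (F a1 b1) (m a2 b2))) - bind (F a b) d
     + bind2 (d a) (\<lambda>a1 a2. bind2 (d b) (\<lambda>b1 b2. tn (m a1 b1) (F a2 b2)))
     = - bind2 (d a) (\<lambda>a1 a2. bind2 (G b) (\<lambda>b1 b2. tn (m a1 b1) (m a2 b2))) + bind (m a b) G
       - bind2 (G a) (\<lambda>a1 a2. bind2 (d b) (\<lambda>b1 b2. tn (m a1 b1) (m a2 b2))))"

definition hoch_cobd :: "('a \<Rightarrow> ('a \<Rightarrow>\<^sub>0 'k)) \<Rightarrow> 'a \<Rightarrow> 'a \<Rightarrow> ('a \<Rightarrow>\<^sub>0 'k)" where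
  "hoch_cobd s a b = bind (s b) (m a) - bind (m a b) s + bind (s a) (\<lambda>x. m x b)"

definition co_cobd :: "('a \<Rightarrow> ('a \<Rightarrow>\<^sub>0 'k)) \<Rightarrow> 'a \<Rightarrow> ('a \<times> 'a \<Rightarrow>\<^sub>0 'k)" where
  "co_cobd s c = - bind2 (d c) (\<lambda>x y. tn (ret x) (s y)) + bind (s c) d - bind2 (d c) (\<lambda>x y. tn (s x) (ret y))"

text \<open>Associativity matches the terms: the facts 1, 2 and 3 treat a value of \<open>s\<close>
  as last, middle and first factor of a triple product, \<open>m_assoc_K\<close> treats
  \<open>s\<close> of a triple product, and the other terms cancel.\<close>

lemma hoch_hoch_cobd: "hoch (hoch_cobd s)"
proof -
  have 1: "bind (s c) (\<lambda>x. bind (m b x) (m a)) = bind (m a b) (\<lambda>y. bind (s c) (\<lambda>x. m y x))" for a b c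
    by (subst bind_commute) (simp add: m_assoc)
  have 2: "bind (s b) (\<lambda>x. bind (m a x) (\<lambda>y. m y c)) = bind (s b) (\<lambda>x. bind (m x c) (m a))" for a b c
    by (simp add: m_assoc)
  have 3: "bind (s a) (\<lambda>x. bind (m x b) (\<lambda>y. m y c)) = bind (m b c) (\<lambda>y. bind (s a) (\<lambda>x. m x y))" for a b c
    by (subst bind_commute) (simp add: m_assoc)
  show ?thesis
    by (simp add: hoch_def hoch_cobd_def[abs_def] bind_linear bind_assocs m_assoc_K 1 2 3)
qed

text \<open>Multiplicativity of the coproduct spreads Delta(a s(b)), Delta(s(a) b) and the terms of
  g(ab) over the Sweedler components of \<open>a\<close> and \<open>b\<close>; both sides then
  consist of the same terms.\<close>

lemma compat_cobd: "compat (hoch_cobd s) (co_cobd s)"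
proof -
  have dm: "bind (m a b) d = bind2 (d a) (\<lambda>a1 a2. bind2 (d b) (\<lambda>b1 b2.
      bind (m a1 b1) (\<lambda>x. bind (m a2 b2) (\<lambda>y. ret (x, y)))))" for a b
    by (simp add: d_m tn_def)
  have 1: "bind (s b) (\<lambda>x. bind2 (d a) (\<lambda>y z. Q x y z)) = bind2 (d a) (\<lambda>y z. bind (s b) (\<lambda>x. Q x y z))"
    for a b and Q :: "_ \<Rightarrow> _ \<Rightarrow> _ \<Rightarrow> 'a \<times> 'a \<Rightarrow>\<^sub>0 'k"
    by (rule bind2_bind_commute[symmetric])
  have 2: "bind (m a b) (\<lambda>x. bind (s c) (\<lambda>y. Q x y)) = bind (s c) (\<lambda>y. bind (m a b) (\<lambda>x. Q x y))"
    for a b c and Q :: "_ \<Rightarrow> _ \<Rightarrow> 'a \<times> 'a \<Rightarrow>\<^sub>0 'k"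
    by (rule bind_commute)
  show ?thesis
    unfolding compat_def hoch_cobd_def[abs_def] co_cobd_def[abs_def] tn_def
    by (simp add: bind_linear bind_assocs dm d_m_K 1 2 algebra_simps)
qed

lemma hoch_diff: "hoch F \<Longrightarrow> hoch F' \<Longrightarrow> hoch (\<lambda>a b. F a b - F' a b)"
  unfolding hoch_def by (simp add: bind_linear) (metis add_diff_add)

lemma compat_diff:
  assumes "compat F G" "compat F' G'"
  shows "compat (\<lambda>a b. F a b - F' a b) (\<lambda>c. G c - G' c)"
proof -
  have *: "(x - x') - (y - y') + (z - z') = - (u - u') + (v - v') - (w - w')"
    if "x - y + z = - u + v - w" "x' - y' + z' = - u' + v' - w'"
    for x x' y y' z z' u u' v v' w w' :: "'a \<times> 'a \<Rightarrow>\<^sub>0 'k"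
  proof -
    have "(x - x') - (y - y') + (z - z') = (x - y + z) - (x' - y' + z')" by simp
    also have "\<dots> = - (u - u') + (v - v') - (w - w')" unfolding that by simp
    finally show ?thesis .
  qed
  show ?thesis
    using assms unfolding compat_def tn_def
    by (simp only: bind_linear) (blast intro: *)
qed

end

lemma keys_diffD: "x \<in> keys (v - w) \<Longrightarrow> x \<in> keys v \<or> x \<in> keys w"
  by (auto simp: in_keys_iff lookup_minus)

lemma keys_addD: "x \<in> keys (v + w) \<Longrightarrow> x \<in> keys v \<or> x \<in> keys w"
  by (auto simp: in_keys_iff lookup_add)

lemma keys_tnD: "(x, y) \<in> keys (tn v w) \<Longrightarrow> x \<in> keys v \<and> y \<in> keys w"
  by (auto simp: in_keys_iff lookup_tn)

section \<open>Degree induction that trivializes a cocycle\<close>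

locale graded_cocycles = graded_prebialgebra m d deg
  for m :: "'a \<Rightarrow> 'a \<Rightarrow> ('a \<Rightarrow>\<^sub>0 'k::comm_ring_1)" and d deg +
  fixes L :: nat
begin

text \<open>Bitriviality is expressed through degrees: a tensor with a leg in degree 0 is seen by
  the projection to H, so both legs of \<open>G c\<close> have positive degree. Degree
  \<open>-L\<close> is written additively, which avoids truncated subtraction and also forces
  vanishing where the target degree would be negative.\<close>

definition cocyc :: "('a \<Rightarrow> 'a \<Rightarrow> ('a \<Rightarrow>\<^sub>0 'k)) \<Rightarrow> ('a \<Rightarrow> ('a \<times> 'a \<Rightarrow>\<^sub>0 'k)) \<Rightarrow> bool" where
  "cocyc F G \<longleftrightarrow> hoch F \<and> compat F G \<and> (\<forall>a b. deg a = 0 \<or> deg b = 0 \<longrightarrow> F a b = 0) \<and>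
    (\<forall>c x y. (x, y) \<in> keys (G c) \<longrightarrow> deg x > 0 \<and> deg y > 0) \<and>
    (\<forall>a b c. c \<in> keys (F a b) \<longrightarrow> deg c + L = deg a + deg b) \<and>
    (\<forall>c x y. (x, y) \<in> keys (G c) \<longrightarrow> deg x + deg y + L = deg c)"

definition hom_pos :: "nat \<Rightarrow> ('a \<times> 'a \<Rightarrow>\<^sub>0 'k) \<Rightarrow> bool" where
  "hom_pos r t \<longleftrightarrow> (\<forall>x y. (x, y) \<in> keys t \<longrightarrow> deg x > 0 \<and> deg y > 0 \<and> deg x + deg y = r)"

definition zero_upto :: "nat \<Rightarrow> ('a \<Rightarrow> 'a \<Rightarrow> ('a \<Rightarrow>\<^sub>0 'k)) \<Rightarrow> bool" where
  "zero_upto n F \<longleftrightarrow> (\<forall>a b. deg a + deg b \<le> n \<longrightarrow> F a b = 0)"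

definition s_homog :: "('a \<Rightarrow> ('a \<Rightarrow>\<^sub>0 'k)) \<Rightarrow> bool" where
  "s_homog s \<longleftrightarrow> (\<forall>a c. c \<in> keys (s a) \<longrightarrow> deg c + L = deg a)"

lemma hoch_cobd_homog:
  assumes s: "s_homog s" and c: "c \<in> keys (hoch_cobd s a b)"
  shows "deg c + L = deg a + deg b"
  using c s unfolding hoch_cobd_def s_homog_def
  by (fastforce dest!: keys_addD keys_diffD keys_bindD dest: m_deg)

lemma co_cobd_homog:
  assumes s: "s_homog s" and c: "(x, y) \<in> keys (co_cobd s c)"
  shows "deg x + deg y + L = deg c"
  using c s unfolding co_cobd_def s_homog_def
  by (auto dest!: keys_addD keys_diffD keys_bindD keys_bind2D keys_tnD)
    (fastforce dest: d_deg)+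

end

text \<open>\<open>decomposable\<close> is the usable form of generation in degrees at most
  \<open>L\<close>: above degree \<open>L\<close> every basis vector lies in the image of A^+
  \<otimes> A^+ under multiplication.\<close>

locale generated_cocycles = graded_cocycles m d deg L
  for m :: "'a \<Rightarrow> 'a \<Rightarrow> ('a \<Rightarrow>\<^sub>0 'k::comm_ring_1)" and d deg L +
  assumes decomposable: "deg c > L \<Longrightarrow> \<exists>t. hom_pos (deg c) t \<and> bind2 t m = ret c"
begin

text \<open>Up to degree \<open>L\<close> there is no room for two legs of positive degree. Above
  it, \<open>c\<close> is a sum of products xy of elements of smaller degree, and compatibility
  expresses G(xy) through \<open>G x\<close>, \<open>G y\<close> and values of \<open>F\<close> in
  total degree at most \<open>n\<close>.\<close>

lemma G_vanish:
  assumes FG: "cocyc F G" and F: "zero_upto n F"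
  shows "deg c \<le> n \<Longrightarrow> G c = 0"
proof (induction "deg c" arbitrary: c rule: less_induct)
  case less
  show ?case
  proof (cases "deg c > L")
    case False
    then have "keys (G c) = {}"
      using FG unfolding cocyc_def by fastforce
    then show ?thesis by simp
  next
    case True
    then obtain t where t: "hom_pos (deg c) t" "bind2 t m = ret c"
      using decomposable by blast
    have "G c = bind2 t (\<lambda>x y. bind (m x y) G)"
      using arg_cong[OF t(2), of "\<lambda>v. bind v G"] by (simp add: bind_assocs)
    also have "\<dots> = 0"
    proof (rule bind2_eq_0)
      fix x y assume "(x, y) \<in> keys t"
      then have xy: "deg x > 0" "deg y > 0" "deg x + deg y = deg c"
        using t(1) unfolding hom_pos_def by auto
      have G0: "G x = 0" "G y = 0"
        using less xy by auto
      have F0: "F a b = 0" if "deg a + deg b \<le> deg c" for a b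
        using F less.prems that unfolding zero_upto_def by auto
      have 1: "bind2 (d x) (\<lambda>a1 a2. bind2 (d y) (\<lambda>b1 b2. tn (F a1 b1) (m a2 b2))) = 0"
        by (intro bind2_eq_0, subst F0) (use xy in \<open>auto dest!: d_deg simp: tn_def\<close>)
      have 2: "bind2 (d x) (\<lambda>a1 a2. bind2 (d y) (\<lambda>b1 b2. tn (m a1 b1) (F a2 b2))) = 0"
        by (intro bind2_eq_0, subst F0) (use xy in \<open>auto dest!: d_deg simp: tn_def\<close>)
      have "compat F G" using FG by (simp add: cocyc_def)
      then show "bind (m x y) G = 0"
        unfolding compat_def
        by (elim allE[of _ x] allE[of _ y]) (simp add: 1 2 G0 F0 xy)
    qed
    finally show ?thesis .
  qed
qed

text \<open>Killing degree \<open>Suc n\<close> is quick; most of the proof shows that the corrected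
  pair satisfies \<open>cocyc\<close> again, so that the next round can start.\<close>

lemma step:
  assumes FG: "cocyc F G" and F: "zero_upto n F" and n: "n \<ge> L"
    and ker: "\<And>t. hom_pos (Suc n) t \<Longrightarrow> bind2 t m = 0 \<Longrightarrow> bind2 t F = 0"
  shows "\<exists>s. s_homog s \<and> (\<forall>a. deg a \<noteq> Suc n \<longrightarrow> s a = 0) \<and>
     cocyc (\<lambda>a b. F a b - hoch_cobd s a b) (\<lambda>c. G c - co_cobd s c) \<and>
     zero_upto (Suc n) (\<lambda>a b. F a b - hoch_cobd s a b)"
proof -
  have "\<exists>t. hom_pos (deg c) t \<and> bind2 t m = ret c" if "deg c = Suc n" for c
    by (rule decomposable) (use that n in simp)
  \<comment> \<open>\<open>\<tau>\<close> picks arbitrary preimages under multiplication; no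
    linearity over degree 0 is imposed.\<close>
  then obtain \<tau> where \<tau>: "\<And>c. deg c = Suc n \<Longrightarrow> hom_pos (Suc n) (\<tau> c)"
    "\<And>c. deg c = Suc n \<Longrightarrow> bind2 (\<tau> c) m = ret c"
    by metis
  define s where "s c = (if deg c = Suc n then - bind2 (\<tau> c) F else 0)" for c
  define D where "D a b = F a b - hoch_cobd s a b" for a b
  define E where "E c = G c - co_cobd s c" for c
  have hF: "hoch F" and F0: "\<And>a b. deg a = 0 \<or> deg b = 0 \<Longrightarrow> F a b = 0"
    using FG unfolding cocyc_def by auto
  have s0: "deg a \<noteq> Suc n \<Longrightarrow> s a = 0" for a
    by (simp add: s_def)
  have sh: "s_homog s"
    unfolding s_homog_def
  proof (intro allI impI)
    fix a c assume c: "c \<in> keys (s a)"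
    then have a: "deg a = Suc n" using s0 by fastforce
    then have "c \<in> keys (bind2 (\<tau> a) F)" using c by (simp add: s_def)
    then obtain x y where "(x, y) \<in> keys (\<tau> a)" "c \<in> keys (F x y)"
      by (auto dest: keys_bind2D)
    then show "deg c + L = deg a"
      using \<tau>(1)[OF a] FG a unfolding hom_pos_def cocyc_def by metis
  qed
  have hD: "hoch D"
    unfolding D_def by (intro hoch_diff hF hoch_hoch_cobd)
  have cD: "compat D E"
    unfolding D_def E_def using FG compat_cobd compat_diff by (auto simp: cocyc_def)
  have degm: "deg c = Suc n" if "deg a + deg b = Suc n" "c \<in> keys (m a b)" for a b c
    using m_deg[OF that(2)] that(1) by simp
  have D_pos: "D a b = 0" if ab: "deg a > 0" "deg b > 0" "deg a + deg b = Suc n" for a b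
  proof -
    \<comment> \<open>Splitting the product of \<open>a\<close> and \<open>b\<close> anew by
      \<open>\<tau>\<close> differs from the pair itself by an element of the kernel of
      multiplication, on which \<open>F\<close> vanishes.\<close>
    have "hom_pos (Suc n) (bind (m a b) \<tau> - ret (a, b))"
      unfolding hom_pos_def
    proof (intro allI impI)
      fix x y assume "(x, y) \<in> keys (bind (m a b) \<tau> - ret (a, b))"
      then consider "(x, y) = (a, b)" | c where "c \<in> keys (m a b)" "(x, y) \<in> keys (\<tau> c)"
        by (auto dest!: keys_diffD keys_bindD split: if_splits)
      then show "0 < deg x \<and> 0 < deg y \<and> deg x + deg y = Suc n"
        by cases (use ab \<tau>(1)[OF degm[OF ab(3)]] in \<open>auto simp: hom_pos_def\<close>)
    qed
    moreover have "bind (m a b) (\<lambda>c. bind2 (\<tau> c) m) = bind (m a b) ret"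
      by (rule bind_cong[OF refl]) (simp add: \<tau>(2) degm[OF ab(3)])
    then have "bind2 (bind (m a b) \<tau> - ret (a, b)) m = 0"
      by (simp add: bind_linear bind_assocs)
    ultimately have "bind2 (bind (m a b) \<tau> - ret (a, b)) F = 0"
      by (rule ker)
    then have "F a b = bind (m a b) (\<lambda>c. bind2 (\<tau> c) F)"
      by (simp add: bind_linear bind_assocs)
    also have "\<dots> = - bind (m a b) s"
      unfolding bind_minus[symmetric]
      by (rule bind_cong[OF refl]) (simp add: s_def degm[OF ab(3)])
    \<comment> \<open>Both degrees are positive, hence different from \<open>Suc n\<close>, so
      \<open>s a\<close> and \<open>s b\<close> vanish and the middle term of the coboundary
      survives.\<close>
    also have "\<dots> = hoch_cobd s a b"
      using ab by (simp add: hoch_cobd_def s0)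
    finally show ?thesis by (simp add: D_def)
  qed
  have D_less: "D a b = 0" if ab: "deg a + deg b \<le> n" for a b
  proof -
    have "bind (m a b) s = 0"
      by (rule bind_eq_0) (use m_deg ab s0 in fastforce)
    then show ?thesis
      using F ab by (simp add: D_def hoch_cobd_def s0 zero_upto_def)
  qed
  have D_ne: "D a b = 0" if ab: "deg a + deg b \<noteq> Suc n" "deg a = 0 \<or> deg b = 0" for a b
  proof -
    have "bind (m a b) s = 0"
      by (rule bind_eq_0) (use m_deg ab s0 in fastforce)
    then show ?thesis
      using F0[OF ab(2)] ab by (cases "deg a = 0") (simp_all add: D_def hoch_cobd_def s0)
  qed
  \<comment> \<open>As \<open>s\<close> need not be linear over degree 0, this is not automatic.
    Write \<open>b\<close> as a sum of products xy: the cocycle identity gives D(a,xy) = D(ax,y) +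
    D(a,x) y - a D(x,y), and the three terms vanish by \<open>D_pos\<close> and
    \<open>D_less\<close>.\<close>
  have D_left: "D a b = 0" if ab: "deg a = 0" "deg b = Suc n" for a b
  proof -
    have "D a b = bind2 (\<tau> b) (\<lambda>x y. bind (m x y) (D a))"
      using arg_cong[OF \<tau>(2)[OF ab(2)], of "\<lambda>v. bind v (D a)"] by (simp add: bind_assocs)
    also have "\<dots> = 0"
    proof (rule bind2_eq_0)
      fix x y assume "(x, y) \<in> keys (\<tau> b)"
      then have xy: "deg x > 0" "deg y > 0" "deg x + deg y = Suc n"
        using \<tau>(1)[OF ab(2)] unfolding hom_pos_def by auto
      have "bind (D x y) (m a) + bind (m x y) (D a) =
          bind (m a x) (\<lambda>z. D z y) + bind (D a x) (\<lambda>z. m z y)"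
        using hD unfolding hoch_def by blast
      moreover have "bind (m a x) (\<lambda>z. D z y) = 0"
        by (rule bind_eq_0, rule D_pos) (use m_deg xy ab in auto)
      ultimately show "bind (m x y) (D a) = 0"
        using D_pos[OF xy] D_less[of a x] xy ab by simp
    qed
    finally show ?thesis .
  qed
  have D_right: "D a b = 0" if ab: "deg b = 0" "deg a = Suc n" for a b
  proof -
    have "D a b = bind2 (\<tau> a) (\<lambda>x y. bind (m x y) (\<lambda>z. D z b))"
      using arg_cong[OF \<tau>(2)[OF ab(2)], of "\<lambda>v. bind v (\<lambda>z. D z b)"] by (simp add: bind_assocs)
    also have "\<dots> = 0"
    proof (rule bind2_eq_0)
      fix x y assume "(x, y) \<in> keys (\<tau> a)"
      then have xy: "deg x > 0" "deg y > 0" "deg x + deg y = Suc n"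
        using \<tau>(1)[OF ab(2)] unfolding hom_pos_def by auto
      have "bind (D y b) (m x) + bind (m y b) (D x) =
          bind (m x y) (\<lambda>z. D z b) + bind (D x y) (\<lambda>z. m z b)"
        using hD unfolding hoch_def by blast
      moreover have "bind (m y b) (\<lambda>z. D x z) = 0"
        by (rule bind_eq_0, rule D_pos) (use m_deg xy ab in auto)
      ultimately show "bind (m x y) (\<lambda>z. D z b) = 0"
        using D_pos[OF xy] D_less[of y b] xy ab by simp
    qed
    finally show ?thesis .
  qed
  have D0: "D a b = 0" if "deg a = 0 \<or> deg b = 0" for a b
    using that D_ne[of a b] D_left[of a b] D_right[of b a] by (cases "deg a + deg b = Suc n") auto
  have D_upto: "zero_upto (Suc n) D"
    unfolding zero_upto_def
  proof (intro allI impI)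
    fix a b assume ab: "deg a + deg b \<le> Suc n"
    show "D a b = 0"
      using D0[of a b] D_pos[of a b] D_less[of a b] ab by fastforce
  qed
  have E_small: "E c = 0" if "deg c \<le> n" for c
  proof -
    have "bind2 (d c) (\<lambda>x y. tn (ret x) (s y)) = 0" "bind2 (d c) (\<lambda>x y. tn (s x) (ret y)) = 0"
      by (rule bind2_eq_0; subst s0; use that d_deg in \<open>fastforce simp: tn_def\<close>)+
    then show ?thesis
      using G_vanish[OF FG F that] that by (simp add: E_def co_cobd_def s0)
  qed
  \<comment> \<open>The argument of \<open>G_vanish\<close> for the corrected pair. That lemma
    cannot be cited yet: it presupposes positive legs of \<open>E\<close>, and \<open>E_pos\<close>
    rests on this fact.\<close>
  have E_eq: "E c = 0" if c: "deg c = Suc n" for c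
  proof -
    have "E c = bind2 (\<tau> c) (\<lambda>x y. bind (m x y) E)"
      using arg_cong[OF \<tau>(2)[OF c], of "\<lambda>v. bind v E"] by (simp add: bind_assocs)
    also have "\<dots> = 0"
    proof (rule bind2_eq_0)
      fix x y assume "(x, y) \<in> keys (\<tau> c)"
      then have xy: "deg x > 0" "deg y > 0" "deg x + deg y = Suc n"
        using \<tau>(1)[OF c] unfolding hom_pos_def by auto
      have F0: "D a b = 0" if "deg a + deg b \<le> Suc n" for a b
        using D_upto that unfolding zero_upto_def by auto
      have 1: "bind2 (d x) (\<lambda>a1 a2. bind2 (d y) (\<lambda>b1 b2. tn (D a1 b1) (m a2 b2))) = 0"
        by (intro bind2_eq_0, subst F0) (use xy in \<open>auto dest!: d_deg simp: tn_def\<close>)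
      have 2: "bind2 (d x) (\<lambda>a1 a2. bind2 (d y) (\<lambda>b1 b2. tn (m a1 b1) (D a2 b2))) = 0"
        by (intro bind2_eq_0, subst F0) (use xy in \<open>auto dest!: d_deg simp: tn_def\<close>)
      have "E x = 0" "E y = 0" using E_small xy by auto
      with cD show "bind (m x y) E = 0"
        unfolding compat_def
        by (elim allE[of _ x] allE[of _ y]) (simp add: 1 2 F0 xy)
    qed
    finally show ?thesis .
  qed
  have E_pos: "deg x > 0 \<and> deg y > 0" if xy: "(x, y) \<in> keys (E c)" for c x y
  proof -
    have c: "deg c > Suc n"
      using xy E_small[of c] E_eq[of c] by (cases "deg c \<le> n"; cases "deg c = Suc n") auto
    from xy consider "(x, y) \<in> keys (G c)" | "(x, y) \<in> keys (co_cobd s c)"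
      unfolding E_def by (auto dest: keys_diffD)
    then show ?thesis
    proof cases
      case 1
      then show ?thesis using FG by (auto simp: cocyc_def)
    next
      case 2
      \<comment> \<open>Here \<open>n \<ge> L\<close> enters: nonzero values of \<open>s\<close>
        have degree \<open>Suc n - L\<close>, which is positive.\<close>
      have ss: "deg z > 0 \<and> deg w = Suc n" if "z \<in> keys (s w)" for z w
        using that sh s0[of w] n unfolding s_homog_def by (cases "deg w = Suc n") fastforce+
      have "s c = 0" using c s0 by auto
      with 2 consider (l) y' where "(x, y') \<in> keys (d c)" "y \<in> keys (s y')"
        | (r) x' where "(x', y) \<in> keys (d c)" "x \<in> keys (s x')"
        unfolding co_cobd_def by (fastforce dest!: keys_diffD keys_bind2D keys_tnD split: if_splits)
      then show ?thesis
        by cases (use ss d_deg c in fastforce)+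
    qed
  qed
  have "cocyc D E"
    unfolding cocyc_def
  proof (intro conjI allI impI)
    show "deg c + L = deg a + deg b" if "c \<in> keys (D a b)" for a b c
      using that FG hoch_cobd_homog[OF sh] unfolding D_def cocyc_def by (blast dest: keys_diffD)
    show "deg x + deg y + L = deg c" if "(x, y) \<in> keys (E c)" for c x y
      using that FG co_cobd_homog[OF sh] unfolding E_def cocyc_def by (blast dest: keys_diffD)
  qed (use hD cD D0 E_pos in blast)+
  then show ?thesis
    using sh s0 D_upto unfolding D_def[abs_def] E_def[abs_def] by blast
qed

lemma hoch_cobd_add: "hoch_cobd (\<lambda>a. s a + s' a) a b = hoch_cobd s a b + hoch_cobd s' a b"
  by (simp add: hoch_cobd_def bind_linear)

lemma co_cobd_add: "co_cobd (\<lambda>a. s a + s' a) c = co_cobd s c + co_cobd s' c"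
  by (simp add: co_cobd_def bind_linear tn_def)

text \<open>The accumulated corrections stabilize in every degree, so they have a degreewise limit.
  The kernel hypothesis ranges over all cocycles because it is applied to the successively corrected
  ones.\<close>

theorem coboundary:
  assumes FG: "cocyc F G" and F: "zero_upto L F"
    and ker: "\<And>F G n t. cocyc F G \<Longrightarrow> n \<ge> L \<Longrightarrow> zero_upto n F \<Longrightarrow> hom_pos (Suc n) t \<Longrightarrow>
       bind2 t m = 0 \<Longrightarrow> bind2 t F = 0"
  shows "\<exists>s. (\<forall>a b. F a b = hoch_cobd s a b) \<and> (\<forall>c. G c = co_cobd s c)"
proof -
  let ?P = "\<lambda>k s. cocyc (\<lambda>a b. F a b - hoch_cobd s a b) (\<lambda>c. G c - co_cobd s c) \<and>
     zero_upto (L + k) (\<lambda>a b. F a b - hoch_cobd s a b)"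
  let ?Q = "\<lambda>k s s'. \<forall>a. deg a \<le> L + k \<longrightarrow> s' a = s a"
  have base: "?P 0 (\<lambda>_. 0)"
    using FG F by (simp add: hoch_cobd_def co_cobd_def tn_def)
  have ext: "\<exists>s'. ?P (Suc k) s' \<and> ?Q k s s'" if P: "?P k s" for k s
  proof -
    have k: "bind2 t (\<lambda>a b. F a b - hoch_cobd s a b) = 0"
      if t: "hom_pos (Suc (L + k)) t" "bind2 t m = 0" for t
      by (rule ker[OF conjunct1[OF P] le_add1 conjunct2[OF P] t])
    obtain s' where s': "\<forall>a. deg a \<noteq> Suc (L + k) \<longrightarrow> s' a = 0"
      "cocyc (\<lambda>a b. F a b - hoch_cobd s a b - hoch_cobd s' a b) (\<lambda>c. G c - co_cobd s c - co_cobd s' c)"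
      "zero_upto (Suc (L + k)) (\<lambda>a b. F a b - hoch_cobd s a b - hoch_cobd s' a b)"
      using step[OF conjunct1[OF P] conjunct2[OF P] le_add1 k] by blast
    show ?thesis
      by (rule exI[of _ "\<lambda>a. s a + s' a"]) (use s' in \<open>simp add: hoch_cobd_add co_cobd_add diff_diff_eq\<close>)
  qed
  obtain S where S: "\<And>k. ?P k (S k)" "\<And>k. ?Q k (S k) (S (Suc k))"
    using dependent_nat_choice[of ?P ?Q] base ext by blast
  have Sle: "S j a = S k a" if "deg a \<le> L + k" "k \<le> j" for a j k
    using that(2) by (induction rule: dec_induct) (use S(2) that(1) in auto)
  \<comment> \<open>The diagonal limit: any index at least \<open>deg a\<close> gives the same
    value, and each equation below involves boundedly many degrees, so one \<open>S k\<close>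
    suffices for it.\<close>
  define s where "s a = S (deg a) a" for a
  have sS: "s a = S k a" if "deg a \<le> k" for a k
    unfolding s_def using Sle[of a "deg a" k] that by simp
  have "F a b = hoch_cobd s a b" for a b
  proof -
    let ?k = "deg a + deg b"
    have "bind (m a b) s = bind (m a b) (S ?k)"
      by (rule bind_cong[OF refl]) (use m_deg sS in auto)
    then have "hoch_cobd s a b = hoch_cobd (S ?k) a b"
      by (simp add: hoch_cobd_def sS[of _ ?k])
    then show ?thesis
      using S(1)[of ?k] by (simp add: zero_upto_def)
  qed
  moreover have "G c = co_cobd s c" for c
  proof -
    let ?k = "deg c"
    have "bind2 (d c) (\<lambda>x y. tn (ret x) (s y)) = bind2 (d c) (\<lambda>x y. tn (ret x) (S ?k y))"
      by (rule bind2_cong, subst sS[of _ ?k]) (auto dest: d_deg)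
    moreover have "bind2 (d c) (\<lambda>x y. tn (s x) (ret y)) = bind2 (d c) (\<lambda>x y. tn (S ?k x) (ret y))"
      by (rule bind2_cong, subst sS[of _ ?k]) (auto dest: d_deg)
    ultimately have "co_cobd s c = co_cobd (S ?k) c"
      by (simp add: co_cobd_def sS[of _ ?k])
    \<comment> \<open>The choice of \<open>S\<close> controls the first component; the second
      follows because \<open>G_vanish\<close> reaches degree \<open>L + deg c\<close>.\<close>
    moreover have "G c - co_cobd (S ?k) c = 0"
      using G_vanish[of "\<lambda>a b. F a b - hoch_cobd (S ?k) a b" "\<lambda>c. G c - co_cobd (S ?k) c" "L + ?k" c]
        S(1)[of ?k] by simp
    ultimately show ?thesis by simp
  qed
  ultimately show ?thesis by blast
qed

end

section \<open>The bosonization\<close>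

definition fa :: "('b \<Rightarrow> 'k::comm_ring_1) \<Rightarrow> ('b \<Rightarrow>\<^sub>0 'k) \<Rightarrow> 'k" where
  "fa \<phi> v = (\<Sum>b\<in>keys v. lookup v b * \<phi> b)"

text \<open>The bridge from functionals to \<open>bind\<close>: a scalar is carried as the
  coefficient of a fixed vector, so that scalar identities take part in Sweedler rewriting.\<close>

lemma bind_fa: "bind v (\<lambda>x. sm (\<phi> x) w) = sm (fa \<phi> v) w"
  by (rule poly_mapping_eqI) (simp add: lookup_bind fa_def sum_distrib_right mult.assoc)

lemma fa_ret [simp]: "fa \<phi> (ret b) = \<phi> b"
  by (simp add: fa_def)

section \<open>The axioms of H and B as rewrite rules\<close>

locale hopf_data =
  fixes mH :: "'h \<Rightarrow> 'h \<Rightarrow> ('h \<Rightarrow>\<^sub>0 'k::field)" and uH :: "'h \<Rightarrow>\<^sub>0 'k"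
    and dH :: "'h \<Rightarrow> ('h \<times> 'h \<Rightarrow>\<^sub>0 'k)" and eH :: "'h \<Rightarrow> 'k" and SH :: "'h \<Rightarrow> ('h \<Rightarrow>\<^sub>0 'k)"
  assumes mH_assoc: "bind (mH a b) (\<lambda>x. mH x c) = bind (mH b c) (\<lambda>x. mH a x)"
    and mH_unit_left: "bind uH (\<lambda>e. mH e a) = ret a"
    and mH_unit_right: "bind uH (\<lambda>e. mH a e) = ret a"
    and dH_coassoc: "bind2 (dH a) (\<lambda>x y. bind2 (dH x) (\<lambda>u v. ret (u, v, y))) =
        bind2 (dH a) (\<lambda>x y. bind2 (dH y) (\<lambda>u v. ret (x, u, v)))"
    and dH_counit_left: "bind2 (dH a) (\<lambda>x y. sm (eH x) (ret y)) = ret a"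
    and dH_counit_right: "bind2 (dH a) (\<lambda>x y. sm (eH y) (ret x)) = ret a"
    and dH_mH: "bind (mH a b) dH =
        bind2 (dH a) (\<lambda>a1 a2. bind2 (dH b) (\<lambda>b1 b2. tn (mH a1 b1) (mH a2 b2)))"
    and dH_uH: "bind uH dH = tn uH uH"
    and eH_mH: "fa eH (mH a b) = eH a * eH b"
    and eH_uH: "fa eH uH = 1"
    and SH_left: "bind2 (dH a) (\<lambda>x y. bind (SH x) (\<lambda>s. mH s y)) = sm (eH a) uH"
    and SH_right: "bind2 (dH a) (\<lambda>x y. bind (SH y) (\<lambda>s. mH x s)) = sm (eH a) uH"
begin

lemma mH_assoc_K: "bind (mH a b) (\<lambda>x. bind (mH x c) K) = bind (mH b c) (\<lambda>x. bind (mH a x) K)"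
  using arg_cong[OF mH_assoc[of a b c], of "\<lambda>v. bind v K"] by (simp add: bind_assoc)

lemma mH_unit_left_K: "bind uH (\<lambda>e. bind (mH e a) K) = K a"
  using arg_cong[OF mH_unit_left[of a], of "\<lambda>v. bind v K"] by (simp add: bind_assoc)

lemma mH_unit_right_K: "bind uH (\<lambda>e. bind (mH a e) K) = K a"
  using arg_cong[OF mH_unit_right[of a], of "\<lambda>v. bind v K"] by (simp add: bind_assoc)

lemma dH_coassoc_K: "bind2 (dH a) (\<lambda>x y. bind2 (dH x) (\<lambda>u v. K u v y)) =
    bind2 (dH a) (\<lambda>x y. bind2 (dH y) (\<lambda>u v. K x u v))"
  using arg_cong[OF dH_coassoc[of a], of "\<lambda>v. bind2 v (\<lambda>x yz. K x (fst yz) (snd yz))"]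
  by (simp add: bind_assocs)

lemma dH_counit_left_K: "bind2 (dH a) (\<lambda>x y. sm (eH x) (K y)) = K a"
  using arg_cong[OF dH_counit_left[of a], of "\<lambda>v. bind v K"] by (simp add: bind_assocs bind_sm_left)

lemma dH_counit_right_K: "bind2 (dH a) (\<lambda>x y. sm (eH y) (K x)) = K a"
  using arg_cong[OF dH_counit_right[of a], of "\<lambda>v. bind v K"] by (simp add: bind_assocs bind_sm_left)

lemma dH_mH_K: "bind (mH a b) (\<lambda>x. bind2 (dH x) K) =
    bind2 (dH a) (\<lambda>a1 a2. bind2 (dH b) (\<lambda>b1 b2. bind (mH a1 b1) (\<lambda>x. bind (mH a2 b2) (\<lambda>y. K x y))))"
  using arg_cong[OF dH_mH[of a b], of "\<lambda>v. bind2 v K"] by (simp add: bind_assocs bind2_tn)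

lemma dH_uH_K: "bind uH (\<lambda>x. bind2 (dH x) K) = bind uH (\<lambda>x. bind uH (\<lambda>y. K x y))"
  using arg_cong[OF dH_uH, of "\<lambda>v. bind2 v K"] by (simp add: bind_assocs bind2_tn)

lemma eH_mH_K: "bind (mH a b) (\<lambda>x. sm (eH x) w) = sm (eH a * eH b) w"
  by (simp add: bind_fa eH_mH)

lemma eH_uH_K: "bind uH (\<lambda>x. sm (eH x) w) = w"
  by (simp add: bind_fa eH_uH)

lemma SH_left_K: "bind2 (dH a) (\<lambda>x y. bind (SH x) (\<lambda>s. bind (mH s y) K)) = sm (eH a) (bind uH K)"
  using arg_cong[OF SH_left[of a], of "\<lambda>v. bind v K"] by (simp add: bind_assocs bind_sm_left)

lemma SH_right_K: "bind2 (dH a) (\<lambda>x y. bind (SH y) (\<lambda>s. bind (mH x s) K)) = sm (eH a) (bind uH K)"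
  using arg_cong[OF SH_right[of a], of "\<lambda>v. bind v K"] by (simp add: bind_assocs bind_sm_left)

end

locale bos_data = hopf_data mH uH dH eH SH
  for mH :: "'h \<Rightarrow> 'h \<Rightarrow> ('h \<Rightarrow>\<^sub>0 'k::field)" and uH dH eH SH +
  fixes act :: "'h \<Rightarrow> 'b \<Rightarrow> ('b \<Rightarrow>\<^sub>0 'k)" and coact :: "'b \<Rightarrow> ('h \<times> 'b \<Rightarrow>\<^sub>0 'k)"
    and mB :: "'b \<Rightarrow> 'b \<Rightarrow> ('b \<Rightarrow>\<^sub>0 'k)" and uB :: "'b \<Rightarrow>\<^sub>0 'k"
    and dB :: "'b \<Rightarrow> ('b \<times> 'b \<Rightarrow>\<^sub>0 'k)" and eB :: "'b \<Rightarrow> 'k" and deg :: "'b \<Rightarrow> nat" and b0 :: 'b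
  assumes act_uH: "bind uH (\<lambda>e. act e b) = ret b"
    and act_mH: "bind (mH h k) (\<lambda>x. act x b) = bind (act k b) (act h)"
    and coact_dH: "bind2 (coact b) (\<lambda>x y. bind2 (dH x) (\<lambda>u v. ret (u, v, y))) =
        bind2 (coact b) (\<lambda>x y. bind2 (coact y) (\<lambda>u v. ret (x, u, v)))"
    and coact_eH: "bind2 (coact b) (\<lambda>x y. sm (eH x) (ret y)) = ret b"
    and coact_act: "bind (act h b) coact = bind2 (dH h) (\<lambda>h1 h'. bind2 (dH h') (\<lambda>h2 h3.
        bind2 (coact b) (\<lambda>x y. tn (bind (mH h1 x) (\<lambda>p. bind (SH h3) (\<lambda>s. mH p s))) (act h2 y))))"
    and mB_assoc: "bind (mB a b) (\<lambda>x. mB x c) = bind (mB b c) (\<lambda>x. mB a x)"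
    and mB_unit_left: "bind uB (\<lambda>e. mB e a) = ret a"
    and mB_unit_right: "bind uB (\<lambda>e. mB a e) = ret a"
    and dB_coassoc: "bind2 (dB a) (\<lambda>x y. bind2 (dB x) (\<lambda>u v. ret (u, v, y))) =
        bind2 (dB a) (\<lambda>x y. bind2 (dB y) (\<lambda>u v. ret (x, u, v)))"
    and dB_counit_left: "bind2 (dB a) (\<lambda>x y. sm (eB x) (ret y)) = ret a"
    and dB_counit_right: "bind2 (dB a) (\<lambda>x y. sm (eB y) (ret x)) = ret a"
    and act_mB: "bind (mB b c) (act h) = bind2 (dH h) (\<lambda>h1 h2. bind (act h1 b) (\<lambda>x. bind (act h2 c) (\<lambda>y. mB x y)))"
    and coact_mB: "bind (mB b c) coact = bind2 (coact b) (\<lambda>x b'. bind2 (coact c) (\<lambda>y c'.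
        tn (mH x y) (mB b' c')))"
    and act_uB: "bind uB (act h) = sm (eH h) uB"
    and coact_uB: "bind uB coact = tn uH uB"
    and dB_act: "bind (act h b) dB = bind2 (dB b) (\<lambda>x y. bind2 (dH h) (\<lambda>h1 h2. tn (act h1 x) (act h2 y)))"
    and dB_coact: "bind2 (coact b) (\<lambda>x y. bind2 (dB y) (\<lambda>u v. ret (x, (u, v)))) =
        bind2 (dB b) (\<lambda>u v. bind2 (coact u) (\<lambda>x u'. bind2 (coact v) (\<lambda>y v'. bind (mH x y) (\<lambda>z. ret (z, (u', v'))))))"
    and eB_act: "fa eB (act h b) = eH h * eB b"
    and eB_coact: "bind2 (coact b) (\<lambda>x y. sm (eB y) (ret x)) = sm (eB b) uH"
    and dB_mB: "bind (mB b c) dB = bind2 (dB b) (\<lambda>x1 x2. bind2 (dB c) (\<lambda>y1 y2. bind2 (coact x2) (\<lambda>z x2'.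
        bind (act z y1) (\<lambda>w. tn (mB x1 w) (mB x2' y2)))))"
    and dB_uB: "bind uB dB = tn uB uB"
    and eB_mB: "fa eB (mB b c) = eB b * eB c"
    and eB_uB: "fa eB uB = 1"
    and mB_deg: "x \<in> keys (mB b c) \<Longrightarrow> deg x = deg b + deg c"
    and uB_deg: "x \<in> keys uB \<Longrightarrow> deg x = 0"
    and dB_deg: "(x, y) \<in> keys (dB b) \<Longrightarrow> deg x + deg y = deg b"
    and eB_deg: "deg b > 0 \<Longrightarrow> eB b = 0"
    and act_deg: "x \<in> keys (act h b) \<Longrightarrow> deg x = deg b"
    and coact_deg: "(g, y) \<in> keys (coact b) \<Longrightarrow> deg y = deg b"
    and connected: "deg b = 0 \<longleftrightarrow> b = b0"
begin

lemma act_uH_K: "bind uH (\<lambda>e. bind (act e b) K) = K b"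
  using arg_cong[OF act_uH[of b], of "\<lambda>v. bind v K"] by (simp add: bind_assoc)

lemma act_mH_K: "bind (mH h k) (\<lambda>x. bind (act x b) K) = bind (act k b) (\<lambda>y. bind (act h y) K)"
  using arg_cong[OF act_mH[of h k b], of "\<lambda>v. bind v K"] by (simp add: bind_assoc)

lemma coact_dH_K: "bind2 (coact b) (\<lambda>x y. bind2 (dH x) (\<lambda>u v. K u v y)) =
    bind2 (coact b) (\<lambda>x y. bind2 (coact y) (\<lambda>u v. K x u v))"
  using arg_cong[OF coact_dH[of b], of "\<lambda>v. bind2 v (\<lambda>x yz. K x (fst yz) (snd yz))"]
  by (simp add: bind_assocs)

lemma coact_eH_K: "bind2 (coact b) (\<lambda>x y. sm (eH x) (K y)) = K b"
  using arg_cong[OF coact_eH[of b], of "\<lambda>v. bind v K"] by (simp add: bind_assocs bind_sm_left)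

lemma coact_act_K: "bind (act h b) (\<lambda>c. bind2 (coact c) K) = bind2 (dH h) (\<lambda>h1 h'. bind2 (dH h') (\<lambda>h2 h3.
    bind2 (coact b) (\<lambda>x y. bind (mH h1 x) (\<lambda>p. bind (SH h3) (\<lambda>s. bind (mH p s) (\<lambda>q.
      bind (act h2 y) (\<lambda>z. K q z)))))))"
  using arg_cong[OF coact_act[of h b], of "\<lambda>v. bind2 v K"] by (simp add: bind_assocs bind2_tn)

lemma mB_assoc_K: "bind (mB a b) (\<lambda>x. bind (mB x c) K) = bind (mB b c) (\<lambda>x. bind (mB a x) K)"
  using arg_cong[OF mB_assoc[of a b c], of "\<lambda>v. bind v K"] by (simp add: bind_assoc)

lemma mB_unit_left_K: "bind uB (\<lambda>e. bind (mB e a) K) = K a"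
  using arg_cong[OF mB_unit_left[of a], of "\<lambda>v. bind v K"] by (simp add: bind_assoc)

lemma mB_unit_right_K: "bind uB (\<lambda>e. bind (mB a e) K) = K a"
  using arg_cong[OF mB_unit_right[of a], of "\<lambda>v. bind v K"] by (simp add: bind_assoc)

lemma dB_coassoc_K: "bind2 (dB a) (\<lambda>x y. bind2 (dB x) (\<lambda>u v. K u v y)) =
    bind2 (dB a) (\<lambda>x y. bind2 (dB y) (\<lambda>u v. K x u v))"
  using arg_cong[OF dB_coassoc[of a], of "\<lambda>v. bind2 v (\<lambda>x yz. K x (fst yz) (snd yz))"]
  by (simp add: bind_assocs)

lemma dB_counit_left_K: "bind2 (dB a) (\<lambda>x y. sm (eB x) (K y)) = K a"
  using arg_cong[OF dB_counit_left[of a], of "\<lambda>v. bind v K"] by (simp add: bind_assocs bind_sm_left)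

lemma dB_counit_right_K: "bind2 (dB a) (\<lambda>x y. sm (eB y) (K x)) = K a"
  using arg_cong[OF dB_counit_right[of a], of "\<lambda>v. bind v K"] by (simp add: bind_assocs bind_sm_left)

lemma act_mB_K: "bind (mB b c) (\<lambda>x. bind (act h x) K) =
    bind2 (dH h) (\<lambda>h1 h2. bind (act h1 b) (\<lambda>x. bind (act h2 c) (\<lambda>y. bind (mB x y) K)))"
  using arg_cong[OF act_mB[of b c h], of "\<lambda>v. bind v K"] by (simp add: bind_assocs)

lemma coact_mB_K: "bind (mB b c) (\<lambda>x. bind2 (coact x) K) = bind2 (coact b) (\<lambda>x b'. bind2 (coact c) (\<lambda>y c'.
    bind (mH x y) (\<lambda>z. bind (mB b' c') (\<lambda>w. K z w))))"
  using arg_cong[OF coact_mB[of b c], of "\<lambda>v. bind2 v K"] by (simp add: bind_assocs bind2_tn)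

lemma act_uB_K: "bind uB (\<lambda>x. bind (act h x) K) = sm (eH h) (bind uB K)"
  using arg_cong[OF act_uB[of h], of "\<lambda>v. bind v K"] by (simp add: bind_assocs bind_sm_left)

lemma coact_uB_K: "bind uB (\<lambda>x. bind2 (coact x) K) = bind uH (\<lambda>x. bind uB (\<lambda>y. K x y))"
  using arg_cong[OF coact_uB, of "\<lambda>v. bind2 v K"] by (simp add: bind_assocs bind2_tn)

lemma dB_act_K: "bind (act h b) (\<lambda>c. bind2 (dB c) K) =
    bind2 (dB b) (\<lambda>x y. bind2 (dH h) (\<lambda>h1 h2. bind (act h1 x) (\<lambda>u. bind (act h2 y) (\<lambda>v. K u v))))"
  using arg_cong[OF dB_act[of h b], of "\<lambda>v. bind2 v K"] by (simp add: bind_assocs bind2_tn)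

lemma dB_coact_K: "bind2 (coact b) (\<lambda>x y. bind2 (dB y) (\<lambda>u v. K x u v)) =
    bind2 (dB b) (\<lambda>u v. bind2 (coact u) (\<lambda>x u'. bind2 (coact v) (\<lambda>y v'. bind (mH x y) (\<lambda>z. K z u' v'))))"
  using arg_cong[OF dB_coact[of b], of "\<lambda>v. bind2 v (\<lambda>x yz. K x (fst yz) (snd yz))"]
  by (simp add: bind_assocs)

lemma eB_act_K: "bind (act h b) (\<lambda>x. sm (eB x) w) = sm (eH h * eB b) w"
  by (simp add: bind_fa eB_act)

lemma eB_coact_K: "bind2 (coact b) (\<lambda>x y. sm (eB y) (K x)) = sm (eB b) (bind uH K)"
  using arg_cong[OF eB_coact[of b], of "\<lambda>v. bind v K"] by (simp add: bind_assocs bind_sm_left)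

lemma dB_mB_K: "bind (mB b c) (\<lambda>x. bind2 (dB x) K) = bind2 (dB b) (\<lambda>x1 x2. bind2 (dB c) (\<lambda>y1 y2.
    bind2 (coact x2) (\<lambda>z x2'. bind (act z y1) (\<lambda>w. bind (mB x1 w) (\<lambda>u. bind (mB x2' y2) (\<lambda>v. K u v))))))"
  using arg_cong[OF dB_mB[of b c], of "\<lambda>v. bind2 v K"] by (simp add: bind_assocs bind2_tn)

lemma eB_mB_K: "bind (mB a b) (\<lambda>x. sm (eB x) w) = sm (eB a * eB b) w"
  by (simp add: bind_fa eB_mB)

lemma eB_uB_K: "bind uB (\<lambda>x. sm (eB x) w) = w"
  by (simp add: bind_fa eB_uB)

end

section \<open>Multiplication and comultiplication of the bosonization\<close>

context bos_data
begin

definition mA :: "'b \<times> 'h \<Rightarrow> 'b \<times> 'h \<Rightarrow> ('b \<times> 'h \<Rightarrow>\<^sub>0 'k)" where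
  "mA = (\<lambda>(b, h) (c, k). bind2 (dH h) (\<lambda>h1 h2. tn (bind (act h1 c) (mB b)) (mH h2 k)))"

definition dA :: "'b \<times> 'h \<Rightarrow> (('b \<times> 'h) \<times> ('b \<times> 'h) \<Rightarrow>\<^sub>0 'k)" where
  "dA = (\<lambda>(b, h). bind2 (dB b) (\<lambda>b1 b2. bind2 (coact b2) (\<lambda>y b2'. bind2 (dH h) (\<lambda>h1 h2.
     tn (tn (ret b1) (mH y h1)) (ret (b2', h2))))))"

lemma mA_K: "bind (mA (b, h) (c, k)) K = bind2 (dH h) (\<lambda>h1 h2. bind (act h1 c) (\<lambda>w. bind (mB b w) (\<lambda>x.
    bind (mH h2 k) (\<lambda>y. K (x, y)))))"
  by (simp add: mA_def tn_def bind_assocs)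

lemma mA_eq: "mA (b, h) (c, k) = bind2 (dH h) (\<lambda>h1 h2. bind (act h1 c) (\<lambda>w. bind (mB b w) (\<lambda>x.
    bind (mH h2 k) (\<lambda>y. ret (x, y)))))"
  by (simp add: mA_def tn_def bind_assocs)

lemma dA_eq: "dA (b, h) = bind2 (dB b) (\<lambda>b1 b2. bind2 (coact b2) (\<lambda>y b2'. bind2 (dH h) (\<lambda>h1 h2.
    bind (mH y h1) (\<lambda>g. ret ((b1, g), (b2', h2))))))"
  by (simp add: dA_def tn_def bind_assocs)

lemma dA_K: "bind2 (dA (b, h)) K = bind2 (dB b) (\<lambda>b1 b2. bind2 (coact b2) (\<lambda>y b2'. bind2 (dH h) (\<lambda>h1 h2.
    bind (mH y h1) (\<lambda>g. K (b1, g) (b2', h2)))))"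
  by (simp add: dA_eq bind_assocs)

text \<open>
  Sweedler expressions are normalized by moving coproducts and coactions outwards, products inwards
  and nesting coproducts to the right.
\<close>

lemmas sink_products = bind2_bind_commute[symmetric]
  bind_commute[of "mH a b" "act c d" for a b c d] bind_commute[of "mH a b" "mB c d" for a b c d]
  bind_commute[of "mB a b" "act c d" for a b c d]

lemmas float_coproducts = bind2_commute[of "dH a" "dB c" for a c] bind2_commute[of "coact a" "dB c" for a c]
  bind2_commute[of "dH a" "coact c" for a c]

lemmas nest_coproducts = dB_coassoc_K dH_coassoc_K coact_dH_K[symmetric] dB_coact_K

lemma mH_assoc_K3: "bind (mH a b) (\<lambda>z. bind (mH c d) (\<lambda>y. bind (mH z y) K)) =
    bind (mH c d) (\<lambda>y. bind (mH b y) (\<lambda>y'. bind (mH a y') K))"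
  by (subst bind_commute) (simp add: mH_assoc_K)

text \<open>This and the next swaps move an independent operation out from between two consecutive
  ones of a chain, so that associativity or coassociativity can fire. Fixing the outer operation
  keeps the commutation from looping.\<close>

lemma dH_adjacent_left: "bind2 (dH a) (\<lambda>p q. bind2 (dH z) (\<lambda>r s. bind2 (dH p) (\<lambda>t u. K p q r s t u))) =
    bind2 (dH a) (\<lambda>p q. bind2 (dH p) (\<lambda>t u. bind2 (dH z) (\<lambda>r s. K p q r s t u)))"
  by (rule bind2_cong, rule bind2_commute)

lemma act_adjacent: "bind (act a b) (\<lambda>u. bind (act c d) (\<lambda>v. bind (act e u) (\<lambda>w. K u v w))) =
    bind (act a b) (\<lambda>u. bind (act e u) (\<lambda>w. bind (act c d) (\<lambda>v. K u v w)))"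
  by (rule bind_cong[OF refl], rule bind_commute)

lemma dH_adjacent: "bind2 (dH a) (\<lambda>p q. bind2 (dH z) (\<lambda>r s. bind2 (dH q) (\<lambda>t u. K p q r s t u))) =
    bind2 (dH a) (\<lambda>p q. bind2 (dH q) (\<lambda>t u. bind2 (dH z) (\<lambda>r s. K p q r s t u)))"
  by (rule bind2_cong, rule bind2_commute)

lemma coact_order: "bind2 (dB a) (\<lambda>p q. bind2 (coact q) (\<lambda>r s. bind2 (coact p) (\<lambda>t u. K p q r s t u))) =
    bind2 (dB a) (\<lambda>p q. bind2 (coact p) (\<lambda>t u. bind2 (coact q) (\<lambda>r s. K p q r s t u)))"
  by (rule bind2_cong, rule bind2_commute)

lemma mH_adjacent: "bind (mH a b) (\<lambda>x. bind (mH c d) (\<lambda>y. bind (mH e x) (\<lambda>z. K x y z))) =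
    bind (mH a b) (\<lambda>x. bind (mH e x) (\<lambda>z. bind (mH c d) (\<lambda>y. K x y z)))"
  by (rule bind_cong[OF refl], rule bind_commute)

text \<open>B is an H-module algebra, so the smash product is associative: \<open>act_mB_K\<close>,
  \<open>act_mH_K\<close> and \<open>dH_mH_K\<close> bring both sides to the same expression up to
  the order of independent operations.\<close>

lemma mA_assoc: "bind (mA a b) (\<lambda>x. mA x c) = bind (mA b c) (\<lambda>x. mA a x)"
proof -
  obtain x h where a: "a = (x, h)" by (cases a)
  obtain y k where b: "b = (y, k)" by (cases b)
  obtain z l where c: "c = (z, l)" by (cases c)
  show ?thesis
    unfolding a b c
    by (simp add: mA_K mA_eq dH_mH_K act_mH_K sink_products act_mB_K mB_assoc_K mH_assoc_K bind_assocs float_coproducts nest_coproducts)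
      (simp add: bind2_commute[of "dH k" "dH b" for b] bind_commute[of "act a z" "act b y" for a b])
qed

text \<open>The dual argument: colinearity of the coproduct of B (\<open>dB_coact_K\<close>) makes B
  an H-comodule coalgebra.\<close>

lemma dA_coassoc:  "bind2 (dA a) (\<lambda>x y. bind2 (dA x) (\<lambda>u v. ret (u, v, y))) =
    bind2 (dA a) (\<lambda>x y. bind2 (dA y) (\<lambda>u v. ret (x, u, v)))"
proof -
  obtain x h where a: "a = (x, h)" by (cases a)
  show ?thesis
    unfolding a
    by (simp add: dA_K dA_eq dH_mH_K act_mH_K sink_products act_mB_K mB_assoc_K mH_assoc_K bind_assocs float_coproducts nest_coproducts)
      (simp add: dH_adjacent dH_adjacent_left dH_coassoc_K coact_order mH_adjacent bind2_commute[of "dH a" "dH h" for a])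
qed

text \<open>The Yetter-Drinfeld condition without antipode: (h_1 b)_{-1} h_2 \<otimes> (h_1 b)_0 =
  h_1 b_{-1} \<otimes> h_2 b_0. The extra factor on the left meets the antipode from
  \<open>coact_act_K\<close> and cancels it.\<close>

lemma YD_compat: "bind2 (dH h) (\<lambda>h1 h2. bind (act h1 b) (\<lambda>c. bind2 (coact c) (\<lambda>z c0. bind (mH z h2) (\<lambda>q. K q c0)))) =
  bind2 (dH h) (\<lambda>h1 h2. bind2 (coact b) (\<lambda>y b0. bind (mH h1 y) (\<lambda>q. bind (act h2 b0) (\<lambda>c0. K q c0))))"
proof -
  have "bind2 (dH h) (\<lambda>h1 h2. bind (act h1 b) (\<lambda>c. bind2 (coact c) (\<lambda>z c0. bind (mH z h2) (\<lambda>q. K q c0)))) =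
    bind2 (coact b) (\<lambda>x y. bind2 (dH h) (\<lambda>h1 h2. bind2 (dH h2) (\<lambda>h3 h4. bind (mH h1 x) (\<lambda>p. bind (act h3 y) (\<lambda>z.
      bind2 (dH h4) (\<lambda>h5 h6. bind (SH h5) (\<lambda>s. bind (mH s h6) (\<lambda>q. bind (mH p q) (\<lambda>q. K q z)))))))))"
    by (simp add: coact_act_K dH_coassoc_K sink_products mH_assoc_K float_coproducts bind_commute[of "SH a" "act c d" for a c d])
  also have "\<dots> = bind2 (coact b) (\<lambda>x y. bind2 (dH h) (\<lambda>h1 h2. bind (mH h1 x) (\<lambda>p. bind (act h2 y) (\<lambda>z. K p z))))"
    by (simp add: SH_left_K mH_unit_right_K bind_sm bind2_sm dH_counit_right_K)
  finally show ?thesis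
    by (simp add: float_coproducts)
qed

lemma mH_assoc_K2: "bind (mH a b) (\<lambda>z. bind (mH c d) (\<lambda>y. bind (mH e f) (\<lambda>t. bind (mH z y) (\<lambda>g. K g t)))) =
    bind (mH c d) (\<lambda>y. bind (mH b y) (\<lambda>y'. bind (mH a y') (\<lambda>g. bind (mH e f) (\<lambda>t. K g t))))"
proof -
  have "bind (mH a b) (\<lambda>z. bind (mH c d) (\<lambda>y. bind (mH e f) (\<lambda>t. bind (mH z y) (\<lambda>g. K g t)))) =
    bind (mH c d) (\<lambda>y. bind (mH a b) (\<lambda>z. bind (mH z y) (\<lambda>g. bind (mH e f) (\<lambda>t. K g t))))"
    by (subst bind_commute) (simp add: bind_commute[of "mH e f"])
  then show ?thesis by (simp add: mH_assoc_K)
qed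

lemmas float_dH = bind2_commute[of "coact a" "dH b" for a b] dH_adjacent

text \<open>This is where the braiding of B enters: once \<open>dB_mB_K\<close> is expanded, both
  sides agree except for one spot where acting by h and coacting come in opposite order, and
  \<open>YD_compat\<close> exchanges them.\<close>

lemma dA_mA: "bind (mA a b) dA = bind2 (dA a) (\<lambda>a1 a2. bind2 (dA b) (\<lambda>b1 b2. tn (mA a1 b1) (mA a2 b2)))"
proof -
  obtain x h where a: "a = (x, h)" by (cases a)
  obtain y k where b: "b = (y, k)" by (cases b)
  \<comment> \<open>The common context of both sides; the hole \<open>M\<close> is the spot to which
    \<open>YD_compat\<close> applies.\<close>
  let ?E = "\<lambda>M. bind2 (dB x) (\<lambda>x1 x2. bind2 (dB y) (\<lambda>y1 y2. bind2 (coact x2) (\<lambda>z x2'.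
    bind2 (dH h) (\<lambda>h1 h'. bind2 (dH h') (\<lambda>g h4. bind (act h1 y1) (\<lambda>u. M g y2 (\<lambda>q c.
    bind2 (dH z) (\<lambda>z1 z2. bind2 (dH k) (\<lambda>k1 k2.
    bind (act z1 u) (\<lambda>w. bind (mB x1 w) (\<lambda>p. bind (mB x2' c) (\<lambda>w. bind (mH q k1) (\<lambda>r. bind (mH z2 r) (\<lambda>g. bind (mH h4 k2) (\<lambda>t.
      ret ((p, g), (w, t)))))))))))))))))"
  have "bind (mA (x, h) (y, k)) dA = ?E (\<lambda>g y2 K. bind2 (dH g) (\<lambda>h2 h3. bind (act h2 y2) (\<lambda>v.
      bind2 (coact v) (\<lambda>q c. bind (mH q h3) (\<lambda>q. K q c)))))"
    by (simp add: dA_eq mA_K dH_mH_K act_mH_K sink_products coact_mB_K dB_mB_K dB_act_K mH_assoc_K bind_assocs float_coproducts nest_coproducts)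
      (simp add: mH_assoc_K2 mH_assoc_K, simp add: sink_products float_dH)
  also have "\<dots> = ?E (\<lambda>g y2 K. bind2 (dH g) (\<lambda>h1 h2. bind2 (coact y2) (\<lambda>y b0. bind (mH h1 y) (\<lambda>q.
      bind (act h2 b0) (\<lambda>c. K q c)))))"
    by (simp only: YD_compat)
  also have "\<dots> = bind2 (dA (x, h)) (\<lambda>a1 a2. bind2 (dA (y, k)) (\<lambda>b1 b2. tn (mA a1 b1) (mA a2 b2)))"
    by (simp add: dA_K mA_eq tn_def dH_mH_K act_mH_K sink_products mH_assoc_K bind_assocs float_coproducts nest_coproducts)
      (simp add: mH_assoc_K3 mH_assoc_K,
      simp add: sink_products float_dH dH_adjacent_left dH_coassoc_K act_adjacent bind2_commute[of "dH k" "dH b" for b])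
  finally show ?thesis by (simp add: a b)
qed
end

lemma sm_mult: "sm (c * d) v = sm c (sm d v)"
  by simp

text \<open>The counit laws match single scalars, not products of scalars.\<close>

declare sm_simps(4) [simp del]

section \<open>Connectedness and the degree-zero legs of coproducts\<close>

context bos_data
begin

text \<open>Connectedness puts the unit of B on the line of \<open>b0\<close>, say as c times
  \<open>b0\<close>; epsilon(1) = 1 makes c inverse to epsilon(\<open>b0\<close>). The basis vector
  \<open>b0\<close> itself may differ from the unit.\<close>

lemma uB_scale: "\<exists>c. eB b0 * c = 1 \<and> (\<forall>f :: 'b \<Rightarrow> ('c \<Rightarrow>\<^sub>0 'k). bind uB f = sm c (f b0))"
proof (intro exI conjI allI)
  have k: "keys uB \<subseteq> {b0}" using uB_deg connected by auto
  show *: "bind uB f = sm (lookup uB b0) (f b0)" for f :: "'b \<Rightarrow> ('z \<Rightarrow>\<^sub>0 'k)"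
    by (subst bind_superset[OF _ k]) auto
  have "sm (lookup uB b0 * eB b0) (ret ()) = ret ()"
    using eB_uB_K[of "ret ()"] by (simp add: * sm_mult)
  then show "eB b0 * lookup uB b0 = 1"
    by (metis lookup_sm lookup_single_eq mult.commute mult.right_neutral)
qed

text \<open>A right leg of degree 0 is \<open>b0\<close>, and a positive one is killed by
  \<open>K\<close> as well as by the counit. Hence \<open>K y z\<close> may be replaced by a
  multiple of epsilon(z), and the counit law extracts the term x \<otimes> 1.\<close>

lemma dB_right:
  fixes K :: "'b \<Rightarrow> 'b \<Rightarrow> 'c \<Rightarrow>\<^sub>0 'k"
  assumes "\<And>y z. (y, z) \<in> keys (dB x) \<Longrightarrow> deg z > 0 \<Longrightarrow> K y z = 0"
  shows "bind2 (dB x) K = bind uB (\<lambda>z. K x z)"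
proof -
  obtain c where c: "eB b0 * c = 1" "\<And>f. bind uB f = sm c (f b0 :: 'c \<Rightarrow>\<^sub>0 'k)"
    using uB_scale[where 'c = 'c] by blast
  have "bind2 (dB x) K = bind2 (dB x) (\<lambda>y z. sm (eB z) (sm c (K y b0)))"
  proof (rule bind2_cong)
    fix y z assume "(y, z) \<in> keys (dB x)"
    then show "K y z = sm (eB z) (sm c (K y b0))"
      using assms[of y z] c(1) connected[of z] eB_deg[of z] by (cases "deg z = 0") (auto simp flip: sm_mult)
  qed
  also have "\<dots> = bind uB (\<lambda>z. K x z)"
    by (simp only: dB_counit_right_K c(2))
  finally show ?thesis .
qed

lemma dB_left:
  fixes K :: "'b \<Rightarrow> 'b \<Rightarrow> 'c \<Rightarrow>\<^sub>0 'k"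
  assumes "\<And>y z. (y, z) \<in> keys (dB x) \<Longrightarrow> deg y > 0 \<Longrightarrow> K y z = 0"
  shows "bind2 (dB x) K = bind uB (\<lambda>y. K y x)"
proof -
  obtain c where c: "eB b0 * c = 1" "\<And>f. bind uB f = sm c (f b0 :: 'c \<Rightarrow>\<^sub>0 'k)"
    using uB_scale[where 'c = 'c] by blast
  have "bind2 (dB x) K = bind2 (dB x) (\<lambda>y z. sm (eB y) (sm c (K b0 z)))"
  proof (rule bind2_cong)
    fix y z assume "(y, z) \<in> keys (dB x)"
    then show "K y z = sm (eB y) (sm c (K b0 z))"
      using assms[of y z] c(1) connected[of y] eB_deg[of y] by (cases "deg y = 0") (auto simp flip: sm_mult)
  qed
  also have "\<dots> = bind uB (\<lambda>y. K y x)"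
    by (simp only: dB_counit_left_K c(2))
  finally show ?thesis .
qed

definition dgA :: "'b \<times> 'h \<Rightarrow> nat" where "dgA a = deg (fst a)"

lemma dgA_simp [simp]: "dgA (b, h) = deg b"
  by (simp add: dgA_def)

definition eA :: "'b \<times> 'h \<Rightarrow> 'k" where "eA = (\<lambda>(b, h). eB b * eH h)"

lemma eA_simp [simp]: "eA (b, h) = eB b * eH h"
  by (simp add: eA_def)

lemma mA_deg: "c \<in> keys (mA a b) \<Longrightarrow> dgA c = dgA a + dgA b"
  by (cases a; cases b)
    (auto simp: mA_eq dest!: keys_bind2D keys_bindD mB_deg act_deg split: if_splits)

lemma dA_deg: "(x, y) \<in> keys (dA a) \<Longrightarrow> dgA x + dgA y = dgA a"
  by (cases a)
    (fastforce simp: dA_eq dest!: keys_bind2D keys_bindD dest: dB_deg coact_deg split: if_splits)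

sublocale A: graded_prebialgebra mA dA dgA
  by unfold_locales (auto simp: mA_assoc dA_mA mA_deg dest: dA_deg)

lemma dA_counit_left_K: "bind2 (dA a) (\<lambda>x y. sm (eA x) (K y)) = K a"
proof -
  obtain b h where a: "a = (b, h)" by (cases a)
  have "bind2 (dA a) (\<lambda>x y. sm (eA x) (K y)) = bind2 (dB b) (\<lambda>b1 b2. sm (eB b1)
     (bind2 (coact b2) (\<lambda>y b2'. sm (eH y) (bind2 (dH h) (\<lambda>h1 h2. sm (eH h1) (K (b2', h2)))))))"
    unfolding a
    by (simp add: dA_K sm_mult bind_sm bind2_sm eH_mH_K)
  then show ?thesis
    by (simp add: dH_counit_left_K coact_eH_K dB_counit_left_K a)
qed

lemma dA_counit_right_K: "bind2 (dA a) (\<lambda>x y. sm (eA y) (K x)) = K a"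
proof -
  obtain b h where a: "a = (b, h)" by (cases a)
  have "bind2 (dA a) (\<lambda>x y. sm (eA y) (K x)) = bind2 (dB b) (\<lambda>b1 b2. bind2 (coact b2) (\<lambda>y b2'. sm (eB b2')
     (bind2 (dH h) (\<lambda>h1 h2. sm (eH h2) (bind (mH y h1) (\<lambda>g. K (b1, g)))))))"
    unfolding a
    by (simp add: dA_K sm_mult bind_sm bind2_sm)
  then show ?thesis
    by (simp add: dH_counit_right_K eB_coact_K dB_counit_right_K mH_unit_left_K a)
qed

lemma eA_mA_K: "bind (mA a b) (\<lambda>x. sm (eA x) w) = sm (eA a * eA b) w"
proof -
  obtain x h where a: "a = (x, h)" by (cases a)
  obtain y k where b: "b = (y, k)" by (cases b)
  have "bind (mA a b) (\<lambda>x. sm (eA x) w) = bind2 (dH h) (\<lambda>h1 h2. bind (act h1 y) (\<lambda>v. bind (mB x v) (\<lambda>p.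
    sm (eB p) (bind (mH h2 k) (\<lambda>q. sm (eH q) w)))))"
    unfolding a b by (simp add: mA_K bind_sm sm_mult)
  also have "\<dots> = bind2 (dH h) (\<lambda>h1 h2. sm (eH h1) (sm (eH h2) (sm (eB x * eB y * eH k) w)))"
    by (simp add: eH_mH_K eB_mB_K) (simp add: sm_mult bind_sm eB_act_K, simp add: ac_simps flip: sm_mult)
  also have "\<dots> = sm (eA a * eA b) w"
    unfolding dH_counit_left_K[of h "\<lambda>h2. sm (eH h2) (sm (eB x * eB y * eH k) w)"]
    by (simp add: a b mult_ac flip: sm_mult)
  finally show ?thesis .
qed

lemma mA_unit_right_K: "bind uB (\<lambda>u. bind (mA (b, k) (u, g)) K) = bind (mH k g) (\<lambda>k'. K (b, k'))"
proof -
  have "bind uB (\<lambda>u. bind (mA (b, k) (u, g)) K) =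
    bind2 (dH k) (\<lambda>h1 h2. bind uB (\<lambda>u. bind (act h1 u) (\<lambda>w. bind (mB b w) (\<lambda>x. bind (mH h2 g) (\<lambda>y. K (x, y))))))"
    by (simp add: mA_K sink_products)
  then show ?thesis
    by (simp add: act_uB_K mB_unit_right_K dH_counit_left_K)
qed

lemma mA_unit_left_K: "bind uB (\<lambda>u. bind (mA (u, h) (b, k)) K) =
    bind2 (dH h) (\<lambda>h1 h2. bind (act h1 b) (\<lambda>b'. bind (mH h2 k) (\<lambda>k'. K (b', k'))))"
proof -
  have "bind uB (\<lambda>u. bind (mA (u, h) (b, k)) K) =
    bind2 (dH h) (\<lambda>h1 h2. bind (act h1 b) (\<lambda>w. bind uB (\<lambda>u. bind (mB u w) (\<lambda>x. bind (mH h2 k) (\<lambda>y. K (x, y))))))"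
    by (simp add: mA_K sink_products bind_commute[of uB "act a b" for a b])
  then show ?thesis
    by (simp add: mB_unit_left_K)
qed

text \<open>By \<open>dB_right\<close> the surviving part of the coproduct of x # h is (x # h_1)
  \<otimes> (1 # h_2).\<close>

lemma dA_right:
  assumes "\<And>a1 a2. dgA a1 + dgA a2 = deg x \<Longrightarrow> dgA a2 > 0 \<Longrightarrow> K a1 a2 = 0"
  shows "bind2 (dA (x, h)) K = bind2 (dH h) (\<lambda>h1 h2. bind uB (\<lambda>u. K (x, h1) (u, h2)))"
proof -
  have "bind2 (dA (x, h)) K = bind uB (\<lambda>z. bind2 (coact z) (\<lambda>y z'. bind2 (dH h) (\<lambda>h1 h2.
     bind (mH y h1) (\<lambda>g. K (x, g) (z', h2)))))"
    unfolding dA_K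
  proof (rule dB_right)
    fix y z assume yz: "(y, z) \<in> keys (dB x)" "deg z > 0"
    show "bind2 (coact z) (\<lambda>ya z'. bind2 (dH h) (\<lambda>h1 h2. bind (mH ya h1) (\<lambda>g. K (y, g) (z', h2)))) = 0"
      by (intro bind2_eq_0 bind_eq_0 assms) (use yz dB_deg coact_deg in fastforce)+
  qed
  also have "\<dots> = bind2 (dH h) (\<lambda>h1 h2. bind uB (\<lambda>z'. bind uH (\<lambda>y. bind (mH y h1) (\<lambda>g. K (x, g) (z', h2)))))"
    by (simp add: coact_uB_K sink_products bind_commute[of uH uB])
  finally show ?thesis
    by (simp add: mH_unit_left_K)
qed

text \<open>By \<open>dB_left\<close> the surviving part is (1 # x_{-1} h_1) \<otimes> (x_0 # h_2).
  The coaction stays because it acts on the right leg.\<close>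

lemma dA_left:
  assumes "\<And>a1 a2. dgA a1 + dgA a2 = deg x \<Longrightarrow> dgA a1 > 0 \<Longrightarrow> K a1 a2 = 0"
  shows "bind2 (dA (x, h)) K = bind2 (coact x) (\<lambda>y x'. bind2 (dH h) (\<lambda>h1 h2. bind uB (\<lambda>u.
     bind (mH y h1) (\<lambda>g. K (u, g) (x', h2)))))"
proof -
  have "bind2 (dA (x, h)) K = bind uB (\<lambda>u. bind2 (coact x) (\<lambda>y x'. bind2 (dH h) (\<lambda>h1 h2.
     bind (mH y h1) (\<lambda>g. K (u, g) (x', h2)))))"
    unfolding dA_K
  proof (rule dB_left)
    fix y z assume yz: "(y, z) \<in> keys (dB x)" "deg y > 0"
    show "bind2 (coact z) (\<lambda>ya z'. bind2 (dH h) (\<lambda>h1 h2. bind (mH ya h1) (\<lambda>g. K (y, g) (z', h2)))) = 0"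
      by (intro bind2_eq_0 bind_eq_0 assms) (use yz dB_deg coact_deg in fastforce)+
  qed
  then show ?thesis
    by (simp add: sink_products)
qed

text \<open>
  The unit of \<open>H\<close> is a vector, not a basis element, so the restriction of \<open>F\<close> to \<open>B \<otimes> B\<close> sums over \<open>uH\<close>.
  \<open>RA\<close> and \<open>LA\<close> are right and left multiplication by \<open>1 # g\<close>.
\<close>

definition FB :: "('b \<times> 'h \<Rightarrow> 'b \<times> 'h \<Rightarrow> ('c \<Rightarrow>\<^sub>0 'k)) \<Rightarrow> 'b \<Rightarrow> 'b \<Rightarrow> ('c \<Rightarrow>\<^sub>0 'k)" where
  "FB F x y = bind uH (\<lambda>e. bind uH (\<lambda>e'. F (x, e) (y, e')))"

definition RA :: "'h \<Rightarrow> 'b \<times> 'h \<Rightarrow> ('b \<times> 'h \<Rightarrow>\<^sub>0 'k)" where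
  "RA g = (\<lambda>(b, k). bind (mH k g) (\<lambda>k'. ret (b, k')))"

definition LA :: "'h \<Rightarrow> 'b \<times> 'h \<Rightarrow> ('b \<times> 'h \<Rightarrow>\<^sub>0 'k)" where
  "LA h = (\<lambda>(b, k). bind2 (dH h) (\<lambda>h1 h2. bind (act h1 b) (\<lambda>b'. bind (mH h2 k) (\<lambda>k'. ret (b', k')))))"

lemma mA_unit_right: "bind uB (\<lambda>u. mA a (u, g)) = RA g a"
  using mA_unit_right_K[of "fst a" "snd a" g ret] by (simp add: RA_def case_prod_beta)

lemma mA_unit_left: "bind uB (\<lambda>u. mA (u, h) a) = LA h a"
  using mA_unit_left_K[of h "fst a" "snd a" ret] by (simp add: LA_def case_prod_beta)

lemma FB_mA: "bind uH (\<lambda>e. bind uH (\<lambda>e'. bind (mA (x, e) (y, e')) K)) = bind uH (\<lambda>e. bind (mB x y) (\<lambda>w. K (w, e)))"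
proof -
  have "bind uH (\<lambda>e. bind uH (\<lambda>e'. bind (mA (x, e) (y, e')) K)) =
    bind uH (\<lambda>e. bind2 (dH e) (\<lambda>h1 h2. bind (act h1 y) (\<lambda>w. bind (mB x w) (\<lambda>x. bind uH (\<lambda>e'. bind (mH h2 e') (\<lambda>k. K (x, k)))))))"
    by (simp add: mA_K sink_products bind_commute[of uH "act a b" for a b] bind_commute[of uH "mB a b" for a b])
  then show ?thesis
    by (simp add: mH_unit_right_K dH_uH_K bind_commute[of uH "act a b" for a b] bind_commute[of uH "mB a b" for a b] act_uH_K)
qed

section \<open>H-linearity of a bitrivial Hochschild cocycle\<close>

context
  fixes F :: "'b \<times> 'h \<Rightarrow> 'b \<times> 'h \<Rightarrow> ('b \<times> 'h \<Rightarrow>\<^sub>0 'k)"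
  assumes hF: "A.hoch F" and F0: "\<And>a b. dgA a = 0 \<or> dgA b = 0 \<Longrightarrow> F a b = 0"
begin

text \<open>The cocycle identity with middle argument 1 # h: the two terms in which \<open>F\<close>
  has an argument of degree 0 drop out, so h can be moved across the comma.\<close>

lemma F_left_unit: "bind uB (\<lambda>u. bind (mA (x, e) (u, h)) (\<lambda>w. F w c)) =
   bind uB (\<lambda>u. bind (mA (u, h) c) (F (x, e)))"
proof -
  have "bind uB (\<lambda>u. bind (mA (x, e) (u, h)) (\<lambda>w. F w c)) =
    bind uB (\<lambda>u. bind (F (u, h) c) (mA (x, e)) + bind (mA (u, h) c) (F (x, e))
      - bind (F (x, e) (u, h)) (\<lambda>z. mA z c))"
    using hF unfolding A.hoch_def by (intro bind_cong refl) (metis add_diff_cancel_right')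
  also have "\<dots> = bind uB (\<lambda>u. bind (mA (u, h) c) (F (x, e)))"
    by (intro bind_cong refl) (simp add: F0 uB_deg)
  finally show ?thesis .
qed

lemma F_move_left: "F (x, h) (y, k) = bind2 (dH h) (\<lambda>h1 h2. bind (act h1 y) (\<lambda>z. bind (mH h2 k) (\<lambda>g.
    bind uH (\<lambda>e. F (x, e) (z, g)))))"
proof -
  have "F (x, h) (y, k) = bind uH (\<lambda>e. bind uB (\<lambda>u. bind (mA (x, e) (u, h)) (\<lambda>w. F w (y, k))))"
    by (simp add: mA_unit_right_K mH_unit_left_K)
  also have "\<dots> = bind uH (\<lambda>e. bind2 (dH h) (\<lambda>h1 h2. bind (act h1 y) (\<lambda>z. bind (mH h2 k) (\<lambda>g.
     F (x, e) (z, g)))))"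
    by (simp add: F_left_unit mA_unit_left_K)
  also have "\<dots> = bind2 (dH h) (\<lambda>h1 h2. bind (act h1 y) (\<lambda>z. bind (mH h2 k) (\<lambda>g.
    bind uH (\<lambda>e. F (x, e) (z, g)))))"
    by (simp add: sink_products bind_commute[of uH "act a b" for a b] bind_commute[of uH "mH a b" for a b])
  finally show ?thesis .
qed

text \<open>The cocycle identity with last argument 1 # g makes \<open>F\<close> right
  H-linear.\<close>

lemma F_move_right: "bind uH (\<lambda>e. F (x, e) (z, g)) = bind (FB F x z) (RA g)"
proof -
  have "bind uB (\<lambda>u. bind (mA (z, e') (u, g)) (F (x, e))) = bind uB (\<lambda>u. bind (F (x, e) (z, e')) (\<lambda>w. mA w (u, g)))" for e e'
  proof -
    have "bind uB (\<lambda>u. bind (mA (z, e') (u, g)) (F (x, e))) =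
      bind uB (\<lambda>u. bind (mA (x, e) (z, e')) (\<lambda>w. F w (u, g)) + bind (F (x, e) (z, e')) (\<lambda>w. mA w (u, g))
      - bind (F (z, e') (u, g)) (mA (x, e)))"
      using hF unfolding A.hoch_def by (intro bind_cong refl) (metis add_diff_cancel_left')
    also have "\<dots> = bind uB (\<lambda>u. bind (F (x, e) (z, e')) (\<lambda>w. mA w (u, g)))"
      by (intro bind_cong refl) (simp add: F0 uB_deg)
    finally show ?thesis .
  qed
  then have "bind (mH e' g) (\<lambda>k'. F (x, e) (z, k')) = bind (F (x, e) (z, e')) (\<lambda>w. RA g w)" for e e'
    by (simp add: mA_unit_right_K mA_unit_right bind_commute[of uB "F a b" for a b])
  then have "bind uH (\<lambda>e. bind uH (\<lambda>e'. bind (mH e' g) (\<lambda>k'. F (x, e) (z, k')))) = bind (FB F x z) (RA g)"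
    by (simp add: FB_def bind_assocs)
  then show ?thesis
    by (simp add: mH_unit_left_K)
qed

lemma F_reduce: "F (x, h) (y, k) = bind2 (dH h) (\<lambda>h1 h2. bind (act h1 y) (\<lambda>z. bind (mH h2 k) (\<lambda>g.
    bind (FB F x z) (RA g))))"
  by (subst F_move_left) (simp only: F_move_right)

text \<open>The cocycle identity with first argument 1 # h gives left H-linearity. The component of
  h that has passed x is pushed across by \<open>F_reduce\<close>; what is left over becomes the
  factor h_3 on the right.\<close>

lemma FB_LA: "bind (FB F x y) (LA h) = bind2 (dH h) (\<lambda>h1 h'. bind2 (dH h') (\<lambda>h2 h3.
    bind (act h1 x) (\<lambda>x'. bind (act h2 y) (\<lambda>y'. bind (FB F x' y') (RA h3)))))"
proof -
  have "bind uB (\<lambda>u. bind (F (x, e) (y, e')) (mA (u, h))) = bind uB (\<lambda>u. bind (mA (u, h) (x, e)) (\<lambda>w. F w (y, e')))" for e e'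
  proof -
    have "bind uB (\<lambda>u. bind (F (x, e) (y, e')) (mA (u, h))) =
      bind uB (\<lambda>u. bind (mA (u, h) (x, e)) (\<lambda>w. F w (y, e')) + bind (F (u, h) (x, e)) (\<lambda>w. mA w (y, e'))
       - bind (mA (x, e) (y, e')) (F (u, h)))"
      using hF unfolding A.hoch_def by (intro bind_cong refl) (metis add_diff_cancel_right')
    also have "\<dots> = bind uB (\<lambda>u. bind (mA (u, h) (x, e)) (\<lambda>w. F w (y, e')))"
      by (intro bind_cong refl) (simp add: F0 uB_deg bind_eq_0)
    finally show ?thesis .
  qed
  then have *: "bind (F (x, e) (y, e')) (LA h) = bind2 (dH h) (\<lambda>h1 h2. bind (act h1 x) (\<lambda>b'.
    bind (mH h2 e) (\<lambda>k'. F (b', k') (y, e'))))" for e e'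
    by (simp add: mA_unit_left_K mA_unit_left bind_commute[of uB "F a b" for a b])
  have "bind (FB F x y) (LA h) = bind uH (\<lambda>e'. bind2 (dH h) (\<lambda>h1 h2. bind (act h1 x) (\<lambda>b'.
     bind uH (\<lambda>e. bind (mH h2 e) (\<lambda>k'. F (b', k') (y, e'))))))"
    by (simp add: FB_def bind_assocs *)
     (subst bind_commute, simp add: sink_products bind_commute[of uH "act a b" for a b])
  also have "\<dots> = bind uH (\<lambda>e'. bind2 (dH h) (\<lambda>h1 h2. bind (act h1 x) (\<lambda>b'.
     bind2 (dH h2) (\<lambda>h2 h3. bind (act h2 y) (\<lambda>y'. bind (mH h3 e') (\<lambda>g. bind (FB F b' y') (RA g)))))))"
    by (simp only: mH_unit_right_K) (simp only: F_reduce)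
  also have "\<dots> = bind2 (dH h) (\<lambda>h1 h'. bind2 (dH h') (\<lambda>h2 h3.
    bind (act h1 x) (\<lambda>x'. bind (act h2 y) (\<lambda>y'. bind uH (\<lambda>e'. bind (mH h3 e') (\<lambda>g. bind (FB F x' y') (RA g)))))))"
    by (simp add: sink_products bind_commute[of uH "act a b" for a b])
  finally show ?thesis by (simp only: mH_unit_right_K)
qed

text \<open>As x and z have positive degree, F(y,z) and F(x,y) lie below the total degree and
  vanish. The two remaining terms of the cocycle identity say that F_B factors through the tensor
  product over B.\<close>

lemma FB_balanced:
  assumes "\<And>a b. dgA a + dgA b < deg x + deg y + deg z \<Longrightarrow> F a b = 0" "deg x > 0" "deg z > 0"
  shows "bind (mB x y) (\<lambda>w. FB F w z) = bind (mB y z) (\<lambda>w. FB F x w)"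
proof -
  have "bind (mA (x, e) (y, e')) (\<lambda>w. F w (z, e'')) = bind (mA (y, e') (z, e'')) (F (x, e))" for e e' e''
  proof -
    have "F (y, e') (z, e'') = 0" "F (x, e) (y, e') = 0"
      by (rule assms(1); use assms(2,3) in simp)+
    then show ?thesis
      using hF unfolding A.hoch_def by (metis add.left_neutral add.right_neutral bind_zero_left)
  qed
  then have "bind uH (\<lambda>e. bind uH (\<lambda>e'. bind (mA (x, e) (y, e')) (\<lambda>w. bind uH (\<lambda>e''. F w (z, e''))))) =
    bind uH (\<lambda>e. bind uH (\<lambda>e'. bind uH (\<lambda>e''. bind (mA (y, e') (z, e'')) (F (x, e)))))"
    by (simp add: bind_commute[of "mA a b" uH for a b])
  then show ?thesis
    by (simp add: FB_mA FB_def bind_commute[of "mB a b" uH for a b])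
qed

end

end

section \<open>Compatibility on B in the lowest degree that survives\<close>

context bos_data
begin

text \<open>Positive right legs leave \<open>F\<close> with arguments of too small total degree, so
  \<open>dA_right\<close> leaves F_B(x,y) \<otimes> 1. The codomain of \<open>F\<close> is kept
  free: the lemma also serves scalar cochains, seen as vectors over a one-point basis.\<close>

lemma FB_dA_right:
  fixes F :: "'b \<times> 'h \<Rightarrow> 'b \<times> 'h \<Rightarrow> ('c \<Rightarrow>\<^sub>0 'k)"
  assumes F0: "\<And>a b. dgA a + dgA b < deg x + deg y \<Longrightarrow> F a b = 0"
  shows "bind uH (\<lambda>e. bind uH (\<lambda>e'. bind2 (dA (x, e)) (\<lambda>a1 a2. bind2 (dA (y, e')) (\<lambda>b1 b2. tn (F a1 b1) (mA a2 b2))))) = bind (FB F x y) (\<lambda>w. bind uH (\<lambda>e. bind uB (\<lambda>u. ret (w, (u, e)))))"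
proof -
  let ?T1 = "\<lambda>e e'. bind2 (dA (x, e)) (\<lambda>a1 a2. bind2 (dA (y, e')) (\<lambda>b1 b2. tn (F a1 b1) (mA a2 b2)))"
  have T1: "?T1 e e' = bind2 (dH e) (\<lambda>e1 e2. bind uB (\<lambda>u. bind2 (dH e') (\<lambda>e1' e2'. bind uB (\<lambda>u'.
      tn (F (x, e1) (y, e1')) (mA (u, e2) (u', e2'))))))" for e e'
  proof -
    have "?T1 e e' = bind2 (dH e) (\<lambda>e1 e2. bind uB (\<lambda>u. bind2 (dA (y, e'))
       (\<lambda>b1 b2. tn (F (x, e1) b1) (mA (u, e2) b2))))"
      by (rule dA_right) (rule bind2_eq_0, subst F0, use dA_deg in \<open>fastforce simp: tn_def\<close>, simp add: tn_def)
    also have "\<dots> = bind2 (dH e) (\<lambda>e1 e2. bind uB (\<lambda>u. bind2 (dH e') (\<lambda>e1' e2'. bind uB (\<lambda>u'.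
      tn (F (x, e1) (y, e1')) (mA (u, e2) (u', e2'))))))"
      by (intro bind2_cong bind_cong refl dA_right, subst F0) (auto simp: tn_def)
    finally show ?thesis .
  qed
  have inner: "bind uH (\<lambda>e'. bind2 (dH e') (\<lambda>e1' e2'. bind uB (\<lambda>u'. tn (F (x, e1) (y, e1')) (mA (u, e2) (u', e2'))))) =
    bind uH (\<lambda>e'. bind (F (x, e1) (y, e')) (\<lambda>w. ret (w, (u, e2))))" for e1 e2 u
    apply (simp only: dH_uH_K tn_def)
    apply (simp only: bind_commute[of uB "F a b" for a b])
    apply (simp only: mA_unit_right_K)
    apply (simp only: bind_commute[of uH "F a b" for a b])
    apply (simp only: mH_unit_right_K)
    done
  have "bind uH (\<lambda>e. bind uH (\<lambda>e'. ?T1 e e')) = bind uH (\<lambda>e. bind2 (dH e) (\<lambda>e1 e2. bind uB (\<lambda>u.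
     bind uH (\<lambda>e'. bind2 (dH e') (\<lambda>e1' e2'. bind uB (\<lambda>u'. tn (F (x, e1) (y, e1')) (mA (u, e2) (u', e2'))))))))"
    by (simp only: T1 bind2_bind_commute[where w = uH, symmetric] bind_commute[of uH uB])
  also have "\<dots> = bind uH (\<lambda>e1. bind uH (\<lambda>e2. bind uH (\<lambda>e'. bind uB (\<lambda>u.
     bind (F (x, e1) (y, e')) (\<lambda>w. ret (w, (u, e2)))))))"
    by (simp only: inner, simp only: dH_uH_K bind_commute[of uB uH])
  also have "\<dots> = bind uH (\<lambda>e1. bind uH (\<lambda>e'. bind uH (\<lambda>e2. bind uB (\<lambda>u.
     bind (F (x, e1) (y, e')) (\<lambda>w. ret (w, (u, e2)))))))"
    by (rule bind_cong[OF refl], rule bind_commute)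
  finally show ?thesis
    by (simp add: FB_def bind_assocs bind_commute[of uB "F a b" for a b] bind_commute[of uH "F a b" for a b])
qed

text \<open>The mirror image by \<open>dA_left\<close>; the coactions of x and y remain and give
  x_{-1} y_{-1} \<otimes> F_B(x_0,y_0).\<close>

lemma FB_dA_left:
  fixes F :: "'b \<times> 'h \<Rightarrow> 'b \<times> 'h \<Rightarrow> ('c \<Rightarrow>\<^sub>0 'k)"
  assumes F0: "\<And>a b. dgA a + dgA b < deg x + deg y \<Longrightarrow> F a b = 0"
  shows "bind uH (\<lambda>e. bind uH (\<lambda>e'. bind2 (dA (x, e)) (\<lambda>a1 a2. bind2 (dA (y, e')) (\<lambda>b1 b2. tn (mA a1 b1) (F a2 b2))))) =
     bind2 (coact x) (\<lambda>g x'. bind2 (coact y) (\<lambda>g' y'. bind (mH g g') (\<lambda>p. bind uB (\<lambda>u.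
        bind (FB F x' y') (\<lambda>w. ret ((u, p), w))))))"
proof -
  let ?T2 = "\<lambda>e e'. bind2 (dA (x, e)) (\<lambda>a1 a2. bind2 (dA (y, e')) (\<lambda>b1 b2. tn (mA a1 b1) (F a2 b2)))"
  have T2: "?T2 e e' = bind2 (coact x) (\<lambda>g x'. bind2 (dH e) (\<lambda>e1 e2. bind uB (\<lambda>u. bind (mH g e1) (\<lambda>p.
      bind2 (coact y) (\<lambda>g' y'. bind2 (dH e') (\<lambda>e1' e2'. bind uB (\<lambda>u'. bind (mH g' e1') (\<lambda>p'.
      tn (mA (u, p) (u', p')) (F (x', e2) (y', e2'))))))))))" for e e'
  proof -
    have "?T2 e e' = bind2 (coact x) (\<lambda>g x'. bind2 (dH e) (\<lambda>e1 e2. bind uB (\<lambda>u. bind (mH g e1) (\<lambda>p.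
       bind2 (dA (y, e')) (\<lambda>b1 b2. tn (mA (u, p) b1) (F (x', e2) b2))))))"
      by (rule dA_left) (rule bind2_eq_0, subst F0, use dA_deg in \<open>fastforce simp: tn_def\<close>, simp add: tn_def)
    also have "\<dots> = bind2 (coact x) (\<lambda>g x'. bind2 (dH e) (\<lambda>e1 e2. bind uB (\<lambda>u. bind (mH g e1) (\<lambda>p.
      bind2 (coact y) (\<lambda>g' y'. bind2 (dH e') (\<lambda>e1' e2'. bind uB (\<lambda>u'. bind (mH g' e1') (\<lambda>p'.
      tn (mA (u, p) (u', p')) (F (x', e2) (y', e2'))))))))))"
      by (intro bind2_cong bind_cong refl dA_left, subst F0) (auto simp: tn_def dest: coact_deg)
    finally show ?thesis .
  qed
  have inner: "bind uH (\<lambda>e'. bind2 (dH e') (\<lambda>e1' e2'. bind uB (\<lambda>u'. bind (mH g' e1') (\<lambda>p'.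
      tn (mA (u, p) (u', p')) (F (x', e2) (y', e2')))))) =
    bind uH (\<lambda>e'. bind (mH p g') (\<lambda>p. bind (F (x', e2) (y', e')) (\<lambda>w. ret ((u, p), w))))" for u p g' x' y' e2
  proof -
    have "bind uH (\<lambda>e'. bind2 (dH e') (\<lambda>e1' e2'. bind uB (\<lambda>u'. bind (mH g' e1') (\<lambda>p'.
      tn (mA (u, p) (u', p')) (F (x', e2) (y', e2')))))) =
      bind uH (\<lambda>e2'. bind uB (\<lambda>u'. bind uH (\<lambda>e1'. bind (mH g' e1') (\<lambda>p'.
      tn (mA (u, p) (u', p')) (F (x', e2) (y', e2'))))))"
      by (simp only: dH_uH_K bind_commute[of uB uH]) (rule bind_commute)
    then show ?thesis
      by (simp add: mH_unit_right_K tn_def mA_unit_right_K)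
  qed
  have "bind uH (\<lambda>e. bind uH (\<lambda>e'. ?T2 e e')) = bind2 (coact x) (\<lambda>g x'. bind uH (\<lambda>e. bind2 (dH e) (\<lambda>e1 e2. bind uB (\<lambda>u. bind (mH g e1) (\<lambda>p.
    bind2 (coact y) (\<lambda>g' y'. bind uH (\<lambda>e'. bind2 (dH e') (\<lambda>e1' e2'. bind uB (\<lambda>u'. bind (mH g' e1') (\<lambda>p'.
    tn (mA (u, p) (u', p')) (F (x', e2) (y', e2'))))))))))))"
    by (simp only: T2 bind2_bind_commute[where w = uH, symmetric] bind_commute[of uH uB] bind_commute[of uH "mH a b" for a b])
  also have "\<dots> = bind2 (coact x) (\<lambda>g x'. bind uH (\<lambda>e1. bind uH (\<lambda>e2. bind uB (\<lambda>u. bind (mH g e1) (\<lambda>p.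
    bind2 (coact y) (\<lambda>g' y'. bind uH (\<lambda>e'. bind (mH p g') (\<lambda>p. bind (F (x', e2) (y', e')) (\<lambda>w. ret ((u, p), w))))))))))"
    by (simp only: inner, simp only: dH_uH_K)
  also have "\<dots> = bind2 (coact x) (\<lambda>g x'. bind uH (\<lambda>e2. bind uB (\<lambda>u. bind uH (\<lambda>e1. bind (mH g e1) (\<lambda>p.
    bind2 (coact y) (\<lambda>g' y'. bind uH (\<lambda>e'. bind (mH p g') (\<lambda>p. bind (F (x', e2) (y', e')) (\<lambda>w. ret ((u, p), w))))))))))"
    by (simp only: bind_commute[of uB uH]) (rule bind2_cong, rule bind_commute)
  also have "\<dots> = bind2 (coact x) (\<lambda>g x'. bind2 (coact y) (\<lambda>g' y'. bind (mH g g') (\<lambda>p. bind uB (\<lambda>u.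
    bind uH (\<lambda>e2. bind uH (\<lambda>e'. bind (F (x', e2) (y', e')) (\<lambda>w. ret ((u, p), w))))))))"
    by (simp only: mH_unit_right_K bind2_bind_commute[symmetric] bind_commute[of uH uB] bind_commute[of uH "mH a b" for a b] bind_commute[of uB "mH a b" for a b])
  finally show ?thesis
    by (simp add: FB_def bind_assocs)
qed

text \<open>Used twice: in total degree L to find the scalar cocycle, and in degree n + 1 to obtain
  a Yetter-Drinfeld morphism. Positive degrees of x and y remove the terms with G(x) and G(y) and
  keep G(xy).\<close>

lemma FB_compat:
  assumes FG: "A.compat F G"
    and F0: "\<And>a b. dgA a + dgA b < deg x + deg y \<Longrightarrow> F a b = 0"
    and G0: "\<And>c. dgA c < deg x + deg y \<Longrightarrow> G c = 0"
    and pos: "deg x > 0" "deg y > 0"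
  shows "bind (FB F x y) dA = bind (FB F x y) (\<lambda>w. bind uH (\<lambda>e. bind uB (\<lambda>u. ret (w, (u, e)))))
    + bind2 (coact x) (\<lambda>g x'. bind2 (coact y) (\<lambda>g' y'. bind (mH g g') (\<lambda>p. bind uB (\<lambda>u.
        bind (FB F x' y') (\<lambda>w. ret ((u, p), w))))))
    - bind (mB x y) (\<lambda>z. bind uH (\<lambda>e. G (z, e)))"
proof -
  let ?T1 = "\<lambda>e e'. bind2 (dA (x, e)) (\<lambda>a1 a2. bind2 (dA (y, e')) (\<lambda>b1 b2. tn (F a1 b1) (mA a2 b2)))"
  let ?T2 = "\<lambda>e e'. bind2 (dA (x, e)) (\<lambda>a1 a2. bind2 (dA (y, e')) (\<lambda>b1 b2. tn (mA a1 b1) (F a2 b2)))"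
  have "bind (F (x, e) (y, e')) dA = ?T1 e e' + ?T2 e e' - bind (mA (x, e) (y, e')) G" for e e'
  proof -
    have G: "G (x, e) = 0" "G (y, e') = 0"
      using G0 pos by simp_all
    have "?T1 e e' - bind (F (x, e) (y, e')) dA + ?T2 e e' = bind (mA (x, e) (y, e')) G"
      using FG unfolding A.compat_def by (elim allE[of _ "(x, e)"] allE[of _ "(y, e')"]) (simp add: G)
    then show ?thesis
      by (simp add: algebra_simps)
  qed
  then have "bind (FB F x y) dA = bind uH (\<lambda>e. bind uH (\<lambda>e'. ?T1 e e'))
     + bind uH (\<lambda>e. bind uH (\<lambda>e'. ?T2 e e')) - bind uH (\<lambda>e. bind uH (\<lambda>e'. bind (mA (x, e) (y, e')) G))"
    by (simp add: FB_def bind_assocs bind_linear)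
  moreover have "bind uH (\<lambda>e. bind uH (\<lambda>e'. bind (mA (x, e) (y, e')) G)) = bind (mB x y) (\<lambda>z. bind uH (\<lambda>e. G (z, e)))"
    by (simp only: FB_mA) (rule bind_commute)
  ultimately show ?thesis
    by (simp only: FB_dA_right[OF F0] FB_dA_left[OF F0])
qed

end

section \<open>The coboundary of a scalar cocycle\<close>

lemma bind_sm_ret_swap: "bind v (\<lambda>u. bind w (\<lambda>x. sm (f x) (ret u))) = bind w (\<lambda>x. sm (f x) v)"
  by (subst bind_commute) (simp add: bind_sm)

lemma bind_sm_swap: "bind v (\<lambda>x. bind w (\<lambda>y. sm (f y) (g x))) = bind w (\<lambda>y. sm (f y) (bind v g))"
  by (subst bind_commute) (simp add: bind_sm)

lemma bind_sm_nested: "bind v (\<lambda>x. bind w (\<lambda>y. sm (f x) (g y))) = bind v (\<lambda>x. sm (f x) (bind w g))"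
  by (simp add: bind_sm)

lemmas bind_under_bind2 = bind2_bind_commute[symmetric]

lemma tn_diff: "tn (v - v') w = tn v w - tn v' w" "tn v (w - w') = tn v w - tn v w'"
  by (simp_all add: tn_def bind_linear)

lemma sm_commute: "sm c (sm d' v) = sm d' (sm c v)"
  by (simp add: mult.commute flip: sm_mult)

locale graded_counital = graded_prebialgebra m d deg
  for m :: "'a \<Rightarrow> 'a \<Rightarrow> ('a \<Rightarrow>\<^sub>0 'k::comm_ring_1)" and d deg +
  fixes e :: "'a \<Rightarrow> 'k"
  assumes d_coassoc: "bind2 (d a) (\<lambda>x y. bind2 (d x) (\<lambda>u v. ret (u, v, y))) =
      bind2 (d a) (\<lambda>x y. bind2 (d y) (\<lambda>u v. ret (x, u, v)))"
    and d_counit_left: "bind2 (d a) (\<lambda>x y. sm (e x) (ret y)) = ret a"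
    and d_counit_right: "bind2 (d a) (\<lambda>x y. sm (e y) (ret x)) = ret a"
    and e_m: "bind (m a b) (\<lambda>x. sm (e x) (ret ())) = sm (e a * e b) (ret ())"
begin

lemma d_coassoc_K: "bind2 (d a) (\<lambda>x y. bind2 (d x) (\<lambda>u v. K u v y)) =
    bind2 (d a) (\<lambda>x y. bind2 (d y) (\<lambda>u v. K x u v))"
  using arg_cong[OF d_coassoc[of a], of "\<lambda>v. bind2 v (\<lambda>x yz. K x (fst yz) (snd yz))"]
  by (simp add: bind_assocs)

lemma d_counit_left_K: "bind2 (d a) (\<lambda>x y. sm (e x) (K y)) = K a"
  using arg_cong[OF d_counit_left[of a], of "\<lambda>v. bind v K"] by (simp add: bind_assocs bind_sm_left)

lemma d_counit_right_K: "bind2 (d a) (\<lambda>x y. sm (e y) (K x)) = K a"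
  using arg_cong[OF d_counit_right[of a], of "\<lambda>v. bind v K"] by (simp add: bind_assocs bind_sm_left)

lemma e_m_K: "bind (m a b) (\<lambda>x. sm (e x) w) = sm (e a * e b) w"
  using arg_cong[OF e_m[of a b], of "\<lambda>v. bind v (\<lambda>_. w)"] by (simp add: bind_assocs bind_sm_left)

text \<open>The convolution product of \<open>et\<close> with the multiplication, \<open>et\<close>
  standing on the left. \<open>conv_r\<close> has it on the right, and the difference
  \<open>conv_cobd\<close> is the operator \<partial>^c of the statement.\<close>

definition conv_l :: "('a \<Rightarrow> 'a \<Rightarrow> 'k) \<Rightarrow> 'a \<Rightarrow> 'a \<Rightarrow> ('a \<Rightarrow>\<^sub>0 'k)" where
  "conv_l et a b = bind2 (d a) (\<lambda>a1 a2. bind2 (d b) (\<lambda>b1 b2. sm (et a1 b1) (m a2 b2)))"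

definition conv_r :: "('a \<Rightarrow> 'a \<Rightarrow> 'k) \<Rightarrow> 'a \<Rightarrow> 'a \<Rightarrow> ('a \<Rightarrow>\<^sub>0 'k)" where
  "conv_r et a b = bind2 (d a) (\<lambda>a1 a2. bind2 (d b) (\<lambda>b1 b2. sm (et a2 b2) (m a1 b1)))"

definition conv_cobd :: "('a \<Rightarrow> 'a \<Rightarrow> 'k) \<Rightarrow> 'a \<Rightarrow> 'a \<Rightarrow> ('a \<Rightarrow>\<^sub>0 'k)" where
  "conv_cobd et a b = conv_r et a b - conv_l et a b"

text \<open>The Hochschild condition with trivial coefficients, written with multiples of the single
  basis vector \<open>ret ()\<close> so that the rules for \<open>bind\<close> apply.\<close>

definition scalar_cocycle :: "('a \<Rightarrow> 'a \<Rightarrow> 'k) \<Rightarrow> bool" where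
  "scalar_cocycle et \<longleftrightarrow> (\<forall>a b c. sm (e a) (sm (et b c) (ret ())) + bind (m b c) (\<lambda>x. sm (et a x) (ret ())) =
     bind (m a b) (\<lambda>x. sm (et x c) (ret ())) + sm (e c) (sm (et a b) (ret ())))"

lemma d_coassoc2_K: "bind2 (d a) (\<lambda>a1 a2. bind2 (d b) (\<lambda>b1 b2. bind2 (d a1) (\<lambda>a11 a12. bind2 (d b1) (\<lambda>b11 b12.
      K a11 a12 a2 b11 b12 b2)))) =
    bind2 (d a) (\<lambda>a1 a2. bind2 (d b) (\<lambda>b1 b2. bind2 (d a2) (\<lambda>a21 a22. bind2 (d b2) (\<lambda>b21 b22.
      K a1 a21 a22 b1 b21 b22))))"
proof -
  have "bind2 (d a) (\<lambda>a1 a2. bind2 (d b) (\<lambda>b1 b2. bind2 (d a1) (\<lambda>a11 a12. bind2 (d b1) (\<lambda>b11 b12.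
      K a11 a12 a2 b11 b12 b2)))) =
    bind2 (d a) (\<lambda>a1 a2. bind2 (d a1) (\<lambda>a11 a12. bind2 (d b) (\<lambda>b1 b2. bind2 (d b1) (\<lambda>b11 b12.
      K a11 a12 a2 b11 b12 b2))))"
    by (rule bind2_cong, rule bind2_commute)
  also have "\<dots> = bind2 (d a) (\<lambda>a1 a2. bind2 (d a2) (\<lambda>a21 a22. bind2 (d b) (\<lambda>b1 b2. bind2 (d b2) (\<lambda>b21 b22.
      K a1 a21 a22 b1 b21 b22))))"
    by (simp only: d_coassoc_K)
  also have "\<dots> = bind2 (d a) (\<lambda>a1 a2. bind2 (d b) (\<lambda>b1 b2. bind2 (d a2) (\<lambda>a21 a22. bind2 (d b2) (\<lambda>b21 b22.
      K a1 a21 a22 b1 b21 b22))))"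
    by (rule bind2_cong, rule bind2_commute)
  finally show ?thesis .
qed

text \<open>With m the multiplication, coassociativity gives Delta conv_r = m \<otimes> conv_r and
  Delta conv_l = conv_l \<otimes> m, while conv_r \<otimes> m and m \<otimes> conv_l coincide. So
  everything cancels with zero second component.\<close>

lemma compat_conv_cobd: "compat (conv_cobd et) (\<lambda>_. 0)"
proof -
  have 1: "bind2 (d a) (\<lambda>a1 a2. bind2 (d b) (\<lambda>b1 b2. tn (conv_r et a1 b1) (m a2 b2))) =
    bind2 (d a) (\<lambda>a1 a2. bind2 (d b) (\<lambda>b1 b2. tn (m a1 b1) (conv_l et a2 b2)))" for a b
    by (simp add: conv_r_def conv_l_def tn_def bind_assocs bind_under_bind2 bind_sm bind2_sm bind_sm_left d_coassoc2_K)
  have 2: "bind (conv_r et a b) d = bind2 (d a) (\<lambda>a1 a2. bind2 (d b) (\<lambda>b1 b2. tn (m a1 b1) (conv_r et a2 b2)))" for a b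
    by (simp add: conv_r_def tn_def bind_assocs bind_under_bind2 bind_sm bind2_sm bind_sm_left d_m flip: d_coassoc2_K)
  have 3: "bind (conv_l et a b) d = bind2 (d a) (\<lambda>a1 a2. bind2 (d b) (\<lambda>b1 b2. tn (conv_l et a1 b1) (m a2 b2)))" for a b
    by (simp add: conv_l_def tn_def bind_assocs bind_under_bind2 bind_sm bind2_sm bind_sm_left d_m d_coassoc2_K)
  show ?thesis
    unfolding compat_def
    by (simp add: conv_cobd_def[abs_def] tn_diff bind_linear 1 2 3)
qed

text \<open>Applied to either convolution product, the counit leaves et(a,b).\<close>

lemma e_conv_cobd: "bind (conv_cobd et a b) (\<lambda>x. sm (e x) w) = 0"
proof -
  have r: "sm (et a2 b2) (sm (e a1 * e b1) w) = sm (e a1) (sm (e b1) (sm (et a2 b2) w))" for a1 a2 b1 b2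
    by (simp add: ac_simps flip: sm_mult)
  have "bind (conv_r et a b) (\<lambda>x. sm (e x) w) = bind2 (d a) (\<lambda>a1 a2. sm (e a1) (bind2 (d b) (\<lambda>b1 b2.
      sm (e b1) (sm (et a2 b2) w))))"
    by (simp only: conv_r_def bind_assocs bind_sm_left e_m_K r bind2_sm)
  moreover have "bind (conv_l et a b) (\<lambda>x. sm (e x) w) = bind2 (d a) (\<lambda>a1 a2. sm (e a2) (bind2 (d b) (\<lambda>b1 b2.
      sm (e b2) (sm (et a1 b1) w))))"
    by (simp only: conv_l_def bind_assocs bind_sm_left e_m_K r bind2_sm)
  ultimately show ?thesis
    by (simp add: conv_cobd_def bind_linear d_counit_left_K d_counit_right_K)
qed

context
  fixes et :: "'a \<Rightarrow> 'a \<Rightarrow> 'k"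
  assumes et: "scalar_cocycle et"
begin

lemma et_K: "sm (e a) (sm (et b c) w) + bind (m b c) (\<lambda>x. sm (et a x) w) =
     bind (m a b) (\<lambda>x. sm (et x c) w) + sm (e c) (sm (et a b) w)"
  using arg_cong[OF et[unfolded scalar_cocycle_def, rule_format, of a b c], of "\<lambda>v. bind v (\<lambda>_. w)"]
  by (simp add: bind_assocs bind_sm_left bind_add_left del: sm_simps(4))

text \<open>The scalar cocycle identity at (a_2, b_2, c_2), weighted by the product a_1 b_1 c_1; the
  counit law supplies the missing coproduct where an argument of \<open>et\<close> is
  absent.\<close>

lemma hoch_conv_r: "hoch (conv_r et)"
  unfolding hoch_def
proof (intro allI)
  fix a b c
  \<comment> \<open>The common shape of the four terms: \<open>Q\<close> receives the second legs
    and the product of the first legs.\<close>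
  let ?S = "\<lambda>Q. bind2 (d a) (\<lambda>a1 a2. bind2 (d b) (\<lambda>b1 b2. bind2 (d c) (\<lambda>c1 c2.
     bind (m b1 c1) (\<lambda>y. bind (m a1 y) (\<lambda>v. Q a2 b2 c2 (ret v))))))"
  have 1: "bind (conv_r et b c) (m a) = ?S (\<lambda>a2 b2 c2 w. sm (e a2) (sm (et b2 c2) w))"
  proof -
    have "bind (conv_r et b c) (m a) = bind2 (d a) (\<lambda>a1 a2. sm (e a2) (bind (conv_r et b c) (m a1)))"
      by (simp add: d_counit_right_K)
    then show ?thesis
      by (simp add: conv_r_def bind_assocs bind_sm bind2_sm bind_sm_left del: sm_simps(4))
  qed
  have 2: "bind (m b c) (conv_r et a) = ?S (\<lambda>a2 b2 c2 w. bind (m b2 c2) (\<lambda>x. sm (et a2 x) w))"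
    by (simp only: conv_r_def[abs_def] bind_under_bind2 d_m_K bind_sm_ret_swap bind_sm_swap)
  have 3: "bind (m a b) (\<lambda>x. conv_r et x c) = ?S (\<lambda>a2 b2 c2 w. bind (m a2 b2) (\<lambda>x. sm (et x c2) w))"
    by (simp only: conv_r_def d_m_K bind_under_bind2 bind_sm_ret_swap bind_sm_swap m_assoc)
  have 4: "bind (conv_r et a b) (\<lambda>x. m x c) = ?S (\<lambda>a2 b2 c2 w. sm (e c2) (sm (et a2 b2) w))"
    by (simp add: conv_r_def bind_assocs bind_sm_left bind_sm bind2_sm m_assoc
        sm_commute[of "e c" "et a b" for a b c] d_counit_right_K)
  show "bind (conv_r et b c) (m a) + bind (m b c) (conv_r et a) =
      bind (m a b) (\<lambda>x. conv_r et x c) + bind (conv_r et a b) (\<lambda>x. m x c)"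
    unfolding 1 2 3 4 by (simp only: bind_add[symmetric] bind2_right(1)[symmetric] et_K)
qed

lemma hoch_conv_l: "hoch (conv_l et)"
  unfolding hoch_def
proof (intro allI)
  fix a b c
  let ?S = "\<lambda>Q. bind2 (d a) (\<lambda>a1 a2. bind2 (d b) (\<lambda>b1 b2. bind2 (d c) (\<lambda>c1 c2.
     bind (m b2 c2) (\<lambda>y. bind (m a2 y) (\<lambda>v. Q a1 b1 c1 (ret v))))))"
  have 1: "bind (conv_l et b c) (m a) = ?S (\<lambda>a1 b1 c1 w. sm (e a1) (sm (et b1 c1) w))"
  proof -
    have "bind (conv_l et b c) (m a) = bind2 (d a) (\<lambda>a1 a2. sm (e a1) (bind (conv_l et b c) (m a2)))"
      by (simp add: d_counit_left_K)
    then show ?thesis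
      by (simp add: conv_l_def bind_assocs bind_sm bind2_sm bind_sm_left del: sm_simps(4))
  qed
  have 2: "bind (m b c) (conv_l et a) = ?S (\<lambda>a1 b1 c1 w. bind (m b1 c1) (\<lambda>x. sm (et a1 x) w))"
    by (simp only: conv_l_def[abs_def] bind_under_bind2 d_m_K bind_sm_ret_swap bind_sm_swap bind_sm_nested)
  have 3: "bind (m a b) (\<lambda>x. conv_l et x c) = ?S (\<lambda>a1 b1 c1 w. bind (m a1 b1) (\<lambda>x. sm (et x c1) w))"
    by (simp only: conv_l_def d_m_K bind_under_bind2 bind_sm_ret_swap bind_sm_swap bind_sm_nested m_assoc)
  have 4: "bind (conv_l et a b) (\<lambda>x. m x c) = ?S (\<lambda>a1 b1 c1 w. sm (e c1) (sm (et a1 b1) w))"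
    by (simp add: conv_l_def bind_assocs bind_sm_left bind_sm bind2_sm m_assoc
        sm_commute[of "e c" "et a b" for a b c] d_counit_left_K)
  show "bind (conv_l et b c) (m a) + bind (m b c) (conv_l et a) =
      bind (m a b) (\<lambda>x. conv_l et x c) + bind (conv_l et a b) (\<lambda>x. m x c)"
    unfolding 1 2 3 4 by (simp only: bind_add[symmetric] bind2_right(1)[symmetric] et_K)
qed

lemma hoch_conv_cobd: "hoch (conv_cobd et)"
  unfolding conv_cobd_def[abs_def] by (intro hoch_diff hoch_conv_l hoch_conv_r)

end

end

section \<open>The projection of the bosonization onto H\<close>

context bos_data
begin

sublocale A: graded_counital mA dA dgA eA
proof unfold_locales
  show "bind2 (dA a) (\<lambda>x y. sm (eA x) (ret y)) = ret a" for a by (rule dA_counit_left_K)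
  show "bind2 (dA a) (\<lambda>x y. sm (eA y) (ret x)) = ret a" for a by (rule dA_counit_right_K)
  show "bind (mA a b) (\<lambda>x. sm (eA x) (ret ())) = sm (eA a * eA b) (ret ())" for a b by (rule eA_mA_K)
qed (rule dA_coassoc)

text \<open>The projection pi of the statement, called \<open>bos_pi\<close> there.\<close>

definition H_part :: "'b \<times> 'h \<Rightarrow> ('h \<Rightarrow>\<^sub>0 'k)" where
  "H_part = (\<lambda>(u, g). sm (eB u) (ret g))"

lemma H_part_simp: "H_part (u, g) = sm (eB u) (ret g)"
  by (simp add: H_part_def)

lemma H_part_LA: "bind (LA h a) H_part = bind (H_part a) (mH h)"
proof -
  obtain u g where a: "a = (u, g)" by (cases a)
  have "bind (LA h a) H_part = bind2 (dH h) (\<lambda>h1 h2. sm (eH h1) (sm (eB u) (mH h2 g)))"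
    by (simp add: a LA_def H_part_simp bind_assocs bind_sm_ret_swap eB_act_K)
      (simp add: bind_sm_ret_swap eB_act_K bind_sm sm_mult)
  then show ?thesis
    by (simp add: dH_counit_left_K a H_part_simp bind_sm_left)
qed

lemma H_part_RA: "bind (RA h a) H_part = bind (H_part a) (\<lambda>k. mH k h)"
  by (cases a) (simp add: RA_def H_part_simp bind_assocs bind_sm bind_sm_left)

text \<open>By connectedness an element of degree 0 has first tensor factor on the line of
  \<open>b0\<close>, so pi determines it; in this degree nothing is lost by passing to H.\<close>

lemma H_part_degree_0:
  assumes "\<And>u g. (u, g) \<in> keys v \<Longrightarrow> deg u = 0"
  shows "v = bind uB (\<lambda>u. bind (bind v H_part) (\<lambda>g. ret (u, g)))"
proof -
  obtain c where c: "eB b0 * c = 1" "\<And>f. bind uB f = sm c (f b0 :: 'b \<times> 'h \<Rightarrow>\<^sub>0 'k)"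
    using uB_scale[where 'c = "'b \<times> 'h"] by blast
  have "v = bind v ret" by simp
  also have "\<dots> = bind v (\<lambda>w. sm c (sm (eB (fst w)) (ret (b0, snd w))))"
  proof (rule bind_cong[OF refl])
    fix w assume w: "w \<in> keys v"
    obtain u g where ug: "w = (u, g)" by (cases w)
    with assms w connected have "u = b0" by auto
    then show "ret w = sm c (sm (eB (fst w)) (ret (b0, snd w)))"
      using c(1) by (simp add: ug mult.commute flip: sm_mult)
  qed
  also have "\<dots> = bind uB (\<lambda>u. bind (bind v H_part) (\<lambda>g. ret (u, g)))"
    by (simp add: c(2) bind_assocs H_part_def case_prod_beta bind_sm_left bind_sm)
  finally show ?thesis .
qed

text \<open>Multiplicativity of pi for coproducts, with a functional already applied to the second
  leg, which is how lambda is used.\<close>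

lemma H_part_dA: "bind2 (dA a) (\<lambda>a1 a2. bind (H_part a2) (\<lambda>k. sm (\<phi> k) (H_part a1))) =
   bind (H_part a) (\<lambda>g. bind2 (dH g) (\<lambda>h1 h2. sm (\<phi> h2) (ret h1)))"
proof -
  obtain b h where a: "a = (b, h)" by (cases a)
  have "bind2 (dA a) (\<lambda>a1 a2. bind (H_part a2) (\<lambda>k. sm (\<phi> k) (H_part a1))) =
    bind2 (dB b) (\<lambda>b1 b2. bind2 (coact b2) (\<lambda>y b2'. sm (eB b2') (bind2 (dH h) (\<lambda>h1 h2.
       sm (\<phi> h2) (sm (eB b1) (mH y h1))))))"
    by (simp add: a dA_K H_part_simp bind_sm_left bind_sm bind2_sm)
  also have "\<dots> = bind2 (dB b) (\<lambda>b1 b2. sm (eB b2) (sm (eB b1) (bind2 (dH h) (\<lambda>h1 h2. sm (\<phi> h2) (ret h1)))))"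
    by (simp add: eB_coact_K bind_under_bind2 bind_sm mH_unit_left bind2_sm sm_commute[of "\<phi> _" "eB _"])
  also have "\<dots> = bind (H_part a) (\<lambda>g. bind2 (dH g) (\<lambda>h1 h2. sm (\<phi> h2) (ret h1)))"
    by (simp add: dB_counit_right_K a H_part_simp bind_sm_left)
  finally show ?thesis .
qed

end

section \<open>The cocycle on \<open>B\<close>\<close>

locale bos_L = bos_data mH uH dH eH SH act coact mB uB dB eB deg b0
  for mH :: "'h \<Rightarrow> 'h \<Rightarrow> ('h \<Rightarrow>\<^sub>0 'k::field)" and uH dH eH SH
    and act :: "'h \<Rightarrow> 'b \<Rightarrow> ('b \<Rightarrow>\<^sub>0 'k)" and coact mB uB dB eB deg b0 +
  fixes L :: nat
  assumes L_pos: "L > 0"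
begin

sublocale C: graded_cocycles mA dA dgA L ..

text \<open>Values of \<open>F\<close> cannot have negative degree, and two positive legs have total
  degree at least 2, whence the bound \<open>L + 2\<close> for \<open>G\<close>.\<close>

lemma cocyc_low:
  assumes "C.cocyc F G"
  shows "dgA a + dgA b < L \<Longrightarrow> F a b = 0" "dgA c < L + 2 \<Longrightarrow> G c = 0"
proof -
  assume ab: "dgA a + dgA b < L"
  have "c \<notin> keys (F a b)" for c
  proof
    assume "c \<in> keys (F a b)"
    with assms have "dgA c + L = dgA a + dgA b"
      unfolding C.cocyc_def by blast
    with ab show False by linarith
  qed
  then have "keys (F a b) = {}" by blast
  then show "F a b = 0" by simp
next
  assume c: "dgA c < L + 2"
  have "xy \<notin> keys (G c)" for xy
  proof
    assume xy: "xy \<in> keys (G c)"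
    obtain x y where "xy = (x, y)" by (cases xy)
    with xy assms have "dgA x > 0" "dgA y > 0" "dgA x + dgA y + L = dgA c"
      unfolding C.cocyc_def by blast+
    with c show False by linarith
  qed
  then have "keys (G c) = {}" by blast
  then show "G c = 0" by simp
qed

lemma cocycD:
  assumes "C.cocyc F G"
  shows "A.hoch F" "A.compat F G" "dgA a = 0 \<or> dgA b = 0 \<Longrightarrow> F a b = 0"
    "c \<in> keys (F a b) \<Longrightarrow> dgA c + L = dgA a + dgA b"
proof -
  note * = assms[unfolded C.cocyc_def]
  show "A.hoch F" by (rule *[THEN conjunct1])
  show "A.compat F G" by (rule *[THEN conjunct2, THEN conjunct1])
  show "dgA a = 0 \<or> dgA b = 0 \<Longrightarrow> F a b = 0"
    by (rule *[THEN conjunct2, THEN conjunct2, THEN conjunct1, rule_format])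
  show "c \<in> keys (F a b) \<Longrightarrow> dgA c + L = dgA a + dgA b"
    by (rule *[THEN conjunct2, THEN conjunct2, THEN conjunct2, THEN conjunct2, THEN conjunct1, rule_format])
qed

lemma FB_zero:
  assumes "C.cocyc F G" "deg x = 0 \<or> deg y = 0"
  shows "FB F x y = 0"
  unfolding FB_def by (intro bind_eq_0 cocycD(3)[OF assms(1)]) (use assms(2) in simp)

lemma FB_deg:
  assumes "C.cocyc F G" "w \<in> keys (FB F x y)"
  shows "dgA w + L = deg x + deg y"
proof -
  obtain e e' where "w \<in> keys (F (x, e) (y, e'))"
    using assms(2) unfolding FB_def by (blast dest: keys_bindD)
  from cocycD(4)[OF assms(1) this] show ?thesis by simp
qed

end

locale bos_lam = bos_L mH uH dH eH SH act coact mB uB dB eB deg b0 L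
  for mH :: "'h \<Rightarrow> 'h \<Rightarrow> ('h \<Rightarrow>\<^sub>0 'k::field)" and uH dH eH SH
    and act :: "'h \<Rightarrow> 'b \<Rightarrow> ('b \<Rightarrow>\<^sub>0 'k)" and coact mB uB dB eB deg b0 L +
  fixes lam :: "'h \<Rightarrow> 'k" and F G
  assumes lam_uH: "fa lam uH = 1"
    and lam_dH: "bind2 (dH h) (\<lambda>x y. sm (lam y) (ret x)) = sm (lam h) uH"
    and lam_adj: "fa lam (bind2 (dH h) (\<lambda>x y. bind (mH x k) (\<lambda>p. bind (SH y) (\<lambda>s. mH p s)))) = eH h * lam k"
    and FG: "C.cocyc F G"
begin

lemma lam_adj_K: "bind2 (dH h) (\<lambda>x y. bind (mH x k) (\<lambda>p. bind (SH y) (\<lambda>s. bind (mH p s) (\<lambda>r. sm (lam r) w)))) =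
   sm (eH h * lam k) w"
proof -
  have "sm (eH h * lam k) w = bind (bind2 (dH h) (\<lambda>x y. bind (mH x k) (\<lambda>p. bind (SH y) (\<lambda>s. mH p s)))) (\<lambda>r. sm (lam r) w)"
    by (simp only: bind_fa lam_adj)
  then show ?thesis by (simp add: bind_assocs)
qed

text \<open>In total degree L the values of F_B have degree 0 and \<open>FH\<close> carries all of
  F_B; in every other degree it is zero.\<close>

definition FH where "FH x y = bind (FB F x y) H_part"

definition eta where "eta x y = - fa lam (FH x y)"

lemma FH_lam: "bind (FH x y) (\<lambda>k. sm (lam k) w) = sm (- eta x y) w"
  by (simp add: bind_fa eta_def)

lemma lam_uH_K: "bind uH (\<lambda>x. sm (lam x) w) = w"
  by (simp add: bind_fa lam_uH)

lemma FB_lam_K: "bind (FB F x y) (\<lambda>w. bind (H_part w) (\<lambda>k. sm (lam k) v)) = sm (- eta x y) v"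
  using FH_lam[of x y v] by (simp only: FH_def bind_assocs)

lemma eta_support: "eta x y \<noteq> 0 \<Longrightarrow> deg x + deg y = L \<and> deg x > 0 \<and> deg y > 0"
proof (rule ccontr)
  assume e: "eta x y \<noteq> 0" and n: "\<not> (deg x + deg y = L \<and> deg x > 0 \<and> deg y > 0)"
  have "FH x y = 0"
  proof (cases "deg x > 0 \<and> deg y > 0")
    case False
    then show ?thesis using FB_zero[OF FG] by (auto simp: FH_def)
  next
    case True
    with n have "deg x + deg y \<noteq> L" by simp
    then show ?thesis
      unfolding FH_def by (intro bind_eq_0) (use FB_deg[OF FG] eB_deg in \<open>fastforce simp: H_part_def\<close>)
  qed
  then show False using e by (simp add: eta_def fa_def)
qed

lemma hF: "A.hoch F" and F0: "dgA a = 0 \<or> dgA b = 0 \<Longrightarrow> F a b = 0" and cF: "A.compat F G"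
  using cocycD[OF FG] by simp_all

text \<open>Apply pi \<otimes> (lambda pi) to \<open>FB_compat\<close>. On the left, the condition
  h_1 lambda(h_2) = lambda(h) 1 turns the coproduct into a scalar; on the right, lambda(1) = 1
  isolates F_B(x,y).\<close>

lemma FH_eq:
  assumes "deg x > 0" "deg y > 0" "deg x + deg y = L"
  shows "FH x y = bind2 (coact x) (\<lambda>g x'. bind2 (coact y) (\<lambda>g' y'. bind (mH g g') (\<lambda>p. sm (eta x' y') (ret p))))
     - sm (eta x y) uH"
proof -
  let ?K = "\<lambda>a1 a2. bind (H_part a2) (\<lambda>k. sm (lam k) (H_part a1))"
  \<comment> \<open>The product of x and y has degree L, below the first degree L + 2 where
    \<open>G\<close> can be nonzero.\<close>
  have G: "bind (mB x y) (\<lambda>z. bind uH (\<lambda>e. G (z, e))) = 0"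
    by (intro bind_eq_0 cocyc_low(2)[OF FG]) (use mB_deg assms in force)
  have "bind (FB F x y) dA = bind (FB F x y) (\<lambda>w. bind uH (\<lambda>e. bind uB (\<lambda>u. ret (w, (u, e)))))
    + bind2 (coact x) (\<lambda>g x'. bind2 (coact y) (\<lambda>g' y'. bind (mH g g') (\<lambda>p. bind uB (\<lambda>u.
        bind (FB F x' y') (\<lambda>w. ret ((u, p), w))))))"
    using FB_compat[OF cF, of x y] cocyc_low[OF FG] assms G by simp
  then have "bind2 (bind (FB F x y) dA) ?K = bind2 (bind (FB F x y) (\<lambda>w. bind uH (\<lambda>e. bind uB (\<lambda>u. ret (w, (u, e)))))) ?K
    + bind2 (bind2 (coact x) (\<lambda>g x'. bind2 (coact y) (\<lambda>g' y'. bind (mH g g') (\<lambda>p. bind uB (\<lambda>u.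
        bind (FB F x' y') (\<lambda>w. ret ((u, p), w))))))) ?K"
    by (simp add: bind2_left)
  moreover have "bind2 (bind (FB F x y) dA) ?K = sm (- eta x y) uH"
  proof -
    have "bind2 (bind (FB F x y) dA) ?K = bind (FH x y) (\<lambda>g. bind2 (dH g) (\<lambda>h1 h2. sm (lam h2) (ret h1)))"
      by (simp only: bind_assocs H_part_dA FH_def)
    then show ?thesis by (simp only: lam_dH FH_lam)
  qed
  moreover have "bind2 (bind (FB F x y) (\<lambda>w. bind uH (\<lambda>e. bind uB (\<lambda>u. ret (w, (u, e)))))) ?K = FH x y"
    by (simp only: bind_assocs bind2_ret H_part_simp bind_sm_left bind_ret eB_uB_K lam_uH_K FH_def)
  moreover have "bind2 (bind2 (coact x) (\<lambda>g x'. bind2 (coact y) (\<lambda>g' y'. bind (mH g g') (\<lambda>p. bind uB (\<lambda>u.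
        bind (FB F x' y') (\<lambda>w. ret ((u, p), w))))))) ?K =
    bind2 (coact x) (\<lambda>g x'. bind2 (coact y) (\<lambda>g' y'. bind (mH g g') (\<lambda>p. sm (- eta x' y') (ret p))))"
    by (simp only: bind_assocs bind2_ret FB_lam_K, simp only: H_part_simp, simp only: bind_sm eB_uB_K)
  ultimately have "sm (- eta x y) uH = FH x y +
    bind2 (coact x) (\<lambda>g x'. bind2 (coact y) (\<lambda>g' y'. bind (mH g g') (\<lambda>p. sm (- eta x' y') (ret p))))"
    by (simp only:)
  then have "- sm (eta x y) uH = FH x y -
    bind2 (coact x) (\<lambda>g x'. bind2 (coact y) (\<lambda>g' y'. bind (mH g g') (\<lambda>p. sm (eta x' y') (ret p))))"
    by (simp only: sm_minus_left bind_minus bind2_right) simp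
  then show ?thesis
    by (simp add: algebra_simps)
qed

lemma FH_mH: "bind (FH x y) (mH h) = bind2 (dH h) (\<lambda>h1 h'. bind2 (dH h') (\<lambda>h2 h3.
    bind (act h1 x) (\<lambda>x'. bind (act h2 y) (\<lambda>y'. bind (FH x' y') (\<lambda>k. mH k h3)))))"
proof -
  have "bind (FH x y) (mH h) = bind (bind (FB F x y) (LA h)) H_part"
    by (simp only: bind_assocs H_part_LA FH_def)
  also have "\<dots> = bind (bind2 (dH h) (\<lambda>h1 h'. bind2 (dH h') (\<lambda>h2 h3.
    bind (act h1 x) (\<lambda>x'. bind (act h2 y) (\<lambda>y'. bind (FB F x' y') (RA h3)))))) H_part"
    by (subst FB_LA[OF hF F0]) auto
  finally show ?thesis
    by (simp only: bind_assocs H_part_RA FH_def)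
qed

text \<open>Multiply \<open>FH_mH\<close> by the antipode of the last component of h: F_B(h_1 x, h_2
  y) becomes h_1 F_B(x,y) S(h_2) after pi, the adjoint action.\<close>

lemma FH_adjoint: "bind2 (dH h) (\<lambda>h1 h2. bind (act h1 x) (\<lambda>x'. bind (act h2 y) (\<lambda>y'. FH x' y'))) =
   bind2 (dH h) (\<lambda>p q. bind (FH x y) (\<lambda>k. bind (mH p k) (\<lambda>t. bind (SH q) (\<lambda>s. mH t s))))"
proof -
  have "bind2 (dH h) (\<lambda>p q. bind (FH x y) (\<lambda>k. bind (mH p k) (\<lambda>t. bind (SH q) (\<lambda>s. mH t s)))) =
    bind2 (dH h) (\<lambda>p q. bind (bind (FH x y) (mH p)) (\<lambda>t. bind (SH q) (\<lambda>s. mH t s)))"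
    by (simp add: bind_assocs)
  also have "\<dots> = bind2 (dH h) (\<lambda>p q. bind2 (dH p) (\<lambda>h1 h'. bind2 (dH h') (\<lambda>h2 h3.
    bind (act h1 x) (\<lambda>x'. bind (act h2 y) (\<lambda>y'. bind (FH x' y') (\<lambda>k. bind (mH k h3) (\<lambda>t. bind (SH q) (\<lambda>s. mH t s))))))))"
    by (simp only: FH_mH bind_assocs)
  also have "\<dots> = bind2 (dH h) (\<lambda>h1 p. bind2 (dH p) (\<lambda>h2 p'.
    bind (act h1 x) (\<lambda>x'. bind (act h2 y) (\<lambda>y'. bind (FH x' y') (\<lambda>k.
     bind2 (dH p') (\<lambda>h3 q. bind (SH q) (\<lambda>s. bind (mH h3 s) (\<lambda>t. mH k t))))))))"
    by (simp add: dH_coassoc_K bind_under_bind2 bind_commute[of "mH a b" "SH c" for a b c] mH_assoc)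
  also have "\<dots> = bind2 (dH h) (\<lambda>h1 p. bind2 (dH p) (\<lambda>h2 p'. sm (eH p')
    (bind (act h1 x) (\<lambda>x'. bind (act h2 y) (\<lambda>y'. FH x' y')))))"
    by (simp add: SH_right_K mH_unit_right bind_sm)
  finally show ?thesis by (simp add: dH_counit_right_K)
qed

text \<open>Immediate from \<open>FH_adjoint\<close>, as lambda is invariant under the adjoint
  action.\<close>

lemma eta_stable: "bind2 (dH h) (\<lambda>h1 h2. bind (act h1 x) (\<lambda>x'. bind (act h2 y) (\<lambda>y'. sm (eta x' y') w))) =
   sm (eH h * eta x y) w"
proof -
  have "bind2 (dH h) (\<lambda>h1 h2. bind (act h1 x) (\<lambda>x'. bind (act h2 y) (\<lambda>y'. sm (- eta x' y') w))) =
    bind (bind2 (dH h) (\<lambda>h1 h2. bind (act h1 x) (\<lambda>x'. bind (act h2 y) (\<lambda>y'. FH x' y')))) (\<lambda>k. sm (lam k) w)"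
    by (simp add: bind_assocs FH_lam)
  also have "\<dots> = bind (FH x y) (\<lambda>k. bind2 (dH h) (\<lambda>p q. bind (mH p k) (\<lambda>t. bind (SH q) (\<lambda>s. bind (mH t s) (\<lambda>r. sm (lam r) w)))))"
    by (simp only: FH_adjoint bind_assocs bind2_bind_commute)
  also have "\<dots> = sm (eH h) (sm (- eta x y) w)"
    by (simp only: lam_adj_K sm_mult bind_sm FH_lam)
  finally have "- bind2 (dH h) (\<lambda>h1 h2. bind (act h1 x) (\<lambda>x'. bind (act h2 y) (\<lambda>y'. sm (eta x' y') w))) =
      - sm (eH h) (sm (eta x y) w)"
    by (simp only: sm_minus_left bind_minus bind2_right sm_minus)
  then show ?thesis
    by (simp add: sm_mult)
qed

end

section \<open>The Hochschild cocycle on B and its extension to A\<close>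

context bos_data
begin

lemma mB_b0: "mB b0 b = sm (eB b0) (ret b)" "mB b b0 = sm (eB b0) (ret b)"
proof -
  obtain c where c: "eB b0 * c = 1" "\<And>f. bind uB f = sm c (f b0 :: 'b \<Rightarrow>\<^sub>0 'k)"
    using uB_scale[where 'c = 'b] by blast
  have "sm c (mB b0 b) = ret b" "sm c (mB b b0) = ret b"
    using mB_unit_left[of b] mB_unit_right[of b] by (simp_all add: c(2))
  then have "sm (eB b0) (sm c (mB b0 b)) = sm (eB b0) (ret b)" "sm (eB b0) (sm c (mB b b0)) = sm (eB b0) (ret b)"
    by simp_all
  then show "mB b0 b = sm (eB b0) (ret b)" "mB b b0 = sm (eB b0) (ret b)"
    using c(1) by (simp_all flip: sm_mult)
qed

end

context bos_lam
begin

lemma eta_eq_fa: "sm (eta x y) w = - bind (FB F x y) (\<lambda>a. bind (H_part a) (\<lambda>k. sm (lam k) w))"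
  by (simp add: FB_lam_K sm_minus_left)

text \<open>If a or c is \<open>b0\<close>, then \<open>eta\<close> vanishes on it and
  multiplication by \<open>b0\<close> is the scalar epsilon(\<open>b0\<close>). Otherwise epsilon
  kills a and c, and what remains is balancedness of F_B, in total degree L the only nontrivial
  case.\<close>

lemma eta_cocycle: "sm (eB a) (sm (eta b c) w) + bind (mB b c) (\<lambda>x. sm (eta a x) w) =
   bind (mB a b) (\<lambda>x. sm (eta x c) w) + sm (eB c) (sm (eta a b) w)"
proof -
  have z: "eta b0 x = 0" "eta x b0 = 0" for x
    using eta_support[of b0 x] eta_support[of x b0] connected[of b0] by auto
  have ez: "bind v (\<lambda>x. sm (eta x b0) w) = 0" "bind v (\<lambda>x. sm (eta b0 x) w) = 0" for v
    by (simp_all add: z)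
  consider "a = b0" | "c = b0" | "deg a > 0" "deg c > 0"
    using connected by (metis bot_nat_0.not_eq_extremum)
  then show ?thesis
  proof cases
    case 1
    then show ?thesis by (simp add: z ez mB_b0 bind_sm_left)
  next
    case 2
    then show ?thesis by (simp add: z ez mB_b0 bind_sm_left)
  next
    case 3
    have "bind (mB b c) (\<lambda>x. sm (eta a x) w) = bind (mB a b) (\<lambda>x. sm (eta x c) w)"
    proof (cases "deg a + deg b + deg c = L")
      case True
      have bal: "bind (mB a b) (\<lambda>x. FB F x c) = bind (mB b c) (\<lambda>x. FB F a x)"
        by (rule FB_balanced[OF hF F0]) (use 3 True cocyc_low[OF FG] in auto)
      have "bind (mB b c) (\<lambda>x. sm (eta a x) w) =
        - bind (bind (mB b c) (\<lambda>x. FB F a x)) (\<lambda>a. bind (H_part a) (\<lambda>k. sm (lam k) w))"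
        by (simp only: eta_eq_fa bind_assocs bind_minus)
      also have "\<dots> = bind (mB a b) (\<lambda>x. sm (eta x c) w)"
        by (simp only: eta_eq_fa bind_assocs bind_minus bal[symmetric])
      finally show ?thesis .
    next
      case False
      have "sm (eta a x) w = 0" if "x \<in> keys (mB b c)" for x
        using eta_support[of a x] mB_deg[OF that] False by (cases "eta a x = 0") auto
      moreover have "sm (eta x c) w = 0" if "x \<in> keys (mB a b)" for x
        using eta_support[of x c] mB_deg[OF that] False by (cases "eta x c = 0") auto
      ultimately show ?thesis by (simp add: bind_eq_0)
    qed
    then show ?thesis using 3 eB_deg by simp
  qed
qed

definition eta_t :: "'b \<times> 'h \<Rightarrow> 'b \<times> 'h \<Rightarrow> 'k" where
  "eta_t = (\<lambda>(b, h) (c, k). fa (eta b) (act h c) * eH k)"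

lemma eta_t_K: "sm (eta_t (b, h) (c, k)) w = sm (eH k) (bind (act h c) (\<lambda>c'. sm (eta b c') w))"
  by (simp add: eta_t_def bind_fa mult.commute flip: sm_mult)

lemma eta_t_support: "eta_t a b \<noteq> 0 \<Longrightarrow> dgA a + dgA b = L \<and> dgA a > 0 \<and> dgA b > 0"
proof -
  assume n: "eta_t a b \<noteq> 0"
  obtain x h y k where a: "a = (x, h)" "b = (y, k)" by (cases a, cases b)
  with n have "fa (eta x) (act h y) \<noteq> 0" by (auto simp: eta_t_def)
  then obtain c where "c \<in> keys (act h y)" "eta x c \<noteq> 0"
    unfolding fa_def by (metis (no_types, lifting) mult_zero_right sum.neutral)
  then show ?thesis using eta_support[of x c] act_deg by (auto simp: a)
qed

text \<open>Everything reduces to \<open>eta_cocycle\<close> at x, h_1 y, h_2 k z, where a = x # h,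
  b = y # k and z is the B-part of c. Stability of \<open>eta\<close> is what brings the term
  without x into this form.\<close>

lemma eta_t_cocycle: "A.scalar_cocycle eta_t"
  unfolding A.scalar_cocycle_def
proof (intro allI)
  fix a b c :: "'b \<times> 'h"
  let ?w = "ret () :: unit \<Rightarrow>\<^sub>0 'k"
  obtain x h where a: "a = (x, h)" by (cases a)
  obtain y k where b: "b = (y, k)" by (cases b)
  obtain z l where c: "c = (z, l)" by (cases c)
  \<comment> \<open>The common context of the four terms; \<open>Q\<close> receives h_1 y and h_2 k
    z.\<close>
  let ?S = "\<lambda>Q. sm (eH l) (bind (act k z) (\<lambda>z'. bind2 (dH h) (\<lambda>h1 h2. bind (act h1 y) (\<lambda>y'. bind (act h2 z') (\<lambda>z''.
      Q y' z'')))))"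
  have 1: "sm (eA a) (sm (eta_t b c) ?w) = ?S (\<lambda>y z. sm (eB x) (sm (eta y z) ?w))"
    by (simp add: a b c eta_t_K bind_sm bind2_sm eta_stable sm_mult sm_commute[of "eH l"])
  have 2: "bind (mA b c) (\<lambda>v. sm (eta_t a v) ?w) = ?S (\<lambda>y z. bind (mB y z) (\<lambda>v. sm (eta x v) ?w))"
  proof -
    have "bind (mA b c) (\<lambda>v. sm (eta_t a v) ?w) = bind2 (dH k) (\<lambda>h1 h2. sm (eH h2) (sm (eH l)
      (bind (act h1 z) (\<lambda>w. bind (mB y w) (\<lambda>v. bind (act h v) (\<lambda>c'. sm (eta x c') ?w))))))"
      by (simp add: a b c mA_K eta_t_K eH_mH_K sm_mult bind_sm)
    then show ?thesis
      by (simp add: dH_counit_right_K act_mB_K bind_sm)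
  qed
  have 3: "bind (mA a b) (\<lambda>v. sm (eta_t v c) ?w) = ?S (\<lambda>y z. bind (mB x y) (\<lambda>v. sm (eta v z) ?w))"
    by (simp add: a b c mA_K eta_t_K act_mH_K sink_products bind_sm bind2_sm bind_commute[of "act h1 y" "act k z" for h1])
  have 4: "sm (eA c) (sm (eta_t a b) ?w) = ?S (\<lambda>y z. sm (eB z) (sm (eta x y) ?w))"
  proof -
    have "?S (\<lambda>y z. sm (eB z) (sm (eta x y) ?w)) = sm (eH l) (bind (act k z) (\<lambda>z'. sm (eB z') (bind2 (dH h) (\<lambda>h1 h2. sm (eH h2)
       (bind (act h1 y) (\<lambda>y'. sm (eta x y') ?w))))))"
      by (simp add: eB_act_K bind_sm bind2_sm sm_mult sm_commute[of "eH i" "eB j" for i j])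
    then show ?thesis
      by (simp add: a b c eta_t_K dH_counit_right_K eB_act_K sm_mult sm_commute[of "eH l"] sm_commute[of "eH i" "eB j" for i j])
  qed
  show "sm (eA a) (sm (eta_t b c) ?w) + bind (mA b c) (\<lambda>v. sm (eta_t a v) ?w) =
     bind (mA a b) (\<lambda>v. sm (eta_t v c) ?w) + sm (eA c) (sm (eta_t a b) ?w)"
    unfolding 1 2 3 4
    by (simp only: sm_add[symmetric] bind_add[symmetric] bind2_right(1)[symmetric] eta_cocycle)
qed

definition D where "D a b = F a b - A.conv_cobd eta_t a b"

lemma conv_cobd_zero: "dgA a = 0 \<or> dgA b = 0 \<Longrightarrow> A.conv_cobd eta_t a b = 0"
proof -
  assume z: "dgA a = 0 \<or> dgA b = 0"
  have "A.conv_l eta_t a b = 0" "A.conv_r eta_t a b = 0"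
    unfolding A.conv_l_def A.conv_r_def
    by (intro bind2_eq_0; metis z dA_deg eta_t_support sm_simps(2) add_is_0 less_numeral_extra(3))+
  then show ?thesis by (simp add: A.conv_cobd_def)
qed

lemma keys_sm: "x \<in> keys (sm c v) \<Longrightarrow> c \<noteq> 0 \<and> x \<in> keys v"
  by (auto simp: in_keys_iff)

lemma conv_cobd_homog: "c \<in> keys (A.conv_cobd eta_t a b) \<Longrightarrow> dgA c + L = dgA a + dgA b"
proof -
  assume "c \<in> keys (A.conv_cobd eta_t a b)"
  then consider "c \<in> keys (A.conv_r eta_t a b)" | "c \<in> keys (A.conv_l eta_t a b)"
    unfolding A.conv_cobd_def by (blast dest: keys_diffD)
  then obtain a1 a2 b1 b2 where d: "(a1, a2) \<in> keys (dA a)" "(b1, b2) \<in> keys (dA b)" and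
    "(eta_t a2 b2 \<noteq> 0 \<and> c \<in> keys (mA a1 b1)) \<or> (eta_t a1 b1 \<noteq> 0 \<and> c \<in> keys (mA a2 b2))"
    unfolding A.conv_l_def A.conv_r_def by cases (blast dest!: keys_bind2D dest: keys_sm)+
  then have "(dgA a2 + dgA b2 = L \<and> dgA c = dgA a1 + dgA b1) \<or> (dgA a1 + dgA b1 = L \<and> dgA c = dgA a2 + dgA b2)"
    using eta_t_support mA_deg by blast
  then show ?thesis
    using dA_deg[OF d(1)] dA_deg[OF d(2)] by linarith
qed

text \<open>The second component stays \<open>G\<close>, since \<partial>^c of a scalar cocycle is
  compatible with zero.\<close>

lemma D_cocyc: "C.cocyc D G"
proof -
  note * = FG[unfolded C.cocyc_def]
  have h: "A.hoch D"
    unfolding D_def by (intro A.hoch_diff hF A.hoch_conv_cobd eta_t_cocycle)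
  have c: "A.compat D G"
    using A.compat_diff[OF cF A.compat_conv_cobd] unfolding D_def by simp
  have z: "D a b = 0" if "dgA a = 0 \<or> dgA b = 0" for a b
    using F0[OF that] conv_cobd_zero[OF that] by (simp add: D_def)
  have g: "dgA c + L = dgA a + dgA b" if "c \<in> keys (D a b)" for a b c
    using that cocycD(4)[OF FG] conv_cobd_homog unfolding D_def by (blast dest: keys_diffD)
  show ?thesis
    unfolding C.cocyc_def using h c z g * by blast
qed

text \<open>\<open>eta_t\<close> vanishes below total degree L, so \<open>FB_dA_left\<close> and
  \<open>FB_dA_right\<close> apply to it as a cochain with values over \<open>unit\<close>. The
  result is 1 # the right-hand side of \<open>FH_eq\<close>.\<close>

lemma FB_conv_cobd:
  assumes xy: "deg x + deg y = L"
  shows "FB (A.conv_cobd eta_t) x y = bind uB (\<lambda>u. bind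
     (bind2 (coact x) (\<lambda>g x'. bind2 (coact y) (\<lambda>g' y'. bind (mH g g') (\<lambda>p. sm (eta x' y') (ret p)))) - sm (eta x y) uH)
     (\<lambda>g. ret (u, g)))"
proof -
  let ?et = "\<lambda>a b. sm (eta_t a b) (ret ())"
  have e0: "?et a b = 0" if "dgA a + dgA b < deg x + deg y" for a b
    using eta_t_support[of a b] that xy by (cases "eta_t a b = 0") auto
  have FBe: "FB ?et x y = sm (eta x y) (ret ())" for x y
    by (simp add: FB_def eta_t_K sm_commute[of "eH _"])
      (simp add: bind_sm eH_uH_K act_uH_K)
  have l: "A.conv_l eta_t a b = bind2 (bind2 (dA a) (\<lambda>a1 a2. bind2 (dA b) (\<lambda>b1 b2. tn (?et a1 b1) (mA a2 b2)))) (\<lambda>_ w. ret w)" for a b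
    by (simp add: A.conv_l_def bind_assocs bind2_tn bind_sm_left)
  have r: "A.conv_r eta_t a b = bind2 (bind2 (dA a) (\<lambda>a1 a2. bind2 (dA b) (\<lambda>b1 b2. tn (mA a1 b1) (?et a2 b2)))) (\<lambda>w _. ret w)" for a b
    by (simp add: A.conv_r_def bind_assocs bind2_tn bind_sm_left bind_sm)
  have "FB (A.conv_cobd eta_t) x y =
    bind2 (bind uH (\<lambda>e. bind uH (\<lambda>e'. bind2 (dA (x, e)) (\<lambda>a1 a2. bind2 (dA (y, e')) (\<lambda>b1 b2. tn (mA a1 b1) (?et a2 b2)))))) (\<lambda>w _. ret w)
    - bind2 (bind uH (\<lambda>e. bind uH (\<lambda>e'. bind2 (dA (x, e)) (\<lambda>a1 a2. bind2 (dA (y, e')) (\<lambda>b1 b2. tn (?et a1 b1) (mA a2 b2)))))) (\<lambda>_ w. ret w)"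
    by (simp only: FB_def A.conv_cobd_def l r bind_assocs bind_diff)
  also have "\<dots> = bind2 (coact x) (\<lambda>g x'. bind2 (coact y) (\<lambda>g' y'. bind (mH g g') (\<lambda>p. bind uB (\<lambda>u. sm (eta x' y') (ret (u, p))))))
     - sm (eta x y) (bind uH (\<lambda>e. bind uB (\<lambda>u. ret (u, e))))"
    by (simp only: FB_dA_left[OF e0] FB_dA_right[OF e0] FBe bind_assocs bind_sm_left bind2_left bind_ret bind2_ret bind_sm)
  also have "\<dots> = bind uB (\<lambda>u. bind
     (bind2 (coact x) (\<lambda>g x'. bind2 (coact y) (\<lambda>g' y'. bind (mH g g') (\<lambda>p. sm (eta x' y') (ret p)))) - sm (eta x y) uH)
     (\<lambda>g. ret (u, g)))"
    by (simp add: bind_diff_left bind_diff bind_assocs bind_sm_left bind_sm bind_under_bind2 bind_commute[of uB "mH a b" for a b] bind_commute[of uB uH])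
  finally show ?thesis .
qed

text \<open>In degree L, \<open>FH_eq\<close> and \<open>FB_conv_cobd\<close> agree on B \<otimes>
  B, and \<open>F_reduce\<close> extends the vanishing to A \<otimes> A.\<close>

lemma D_zero: "C.zero_upto L D"
  unfolding C.zero_upto_def
proof (intro allI impI)
  fix a b assume ab: "dgA a + dgA b \<le> L"
  note D0 = cocycD(3)[OF D_cocyc]
  have FB0: "FB D x y = 0" if xy: "deg x + deg y = L" for x y
  proof (cases "deg x > 0 \<and> deg y > 0")
    case False
    then show ?thesis using FB_zero[OF D_cocyc] by simp
  next
    case True
    have "FB D x y = FB F x y - FB (A.conv_cobd eta_t) x y"
      by (simp add: FB_def D_def bind_diff)
    moreover have "FB F x y = bind uB (\<lambda>u. bind (FH x y) (\<lambda>g. ret (u, g)))"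
      unfolding FH_def
    proof (rule H_part_degree_0)
      fix u g assume "(u, g) \<in> keys (FB F x y)"
      from FB_deg[OF FG this] xy show "deg u = 0" by simp
    qed
    ultimately show ?thesis
      using True xy by (simp only: FH_eq FB_conv_cobd) simp
  qed
  show "D a b = 0"
  proof (cases "dgA a + dgA b = L")
    case False
    then show ?thesis using cocyc_low(1)[OF D_cocyc] ab by simp
  next
    case True
    obtain x h y k where a: "a = (x, h)" "b = (y, k)" by (cases a, cases b)
    have "D (x, h) (y, k) = bind2 (dH h) (\<lambda>h1 h2. bind (act h1 y) (\<lambda>z. bind (mH h2 k) (\<lambda>g. bind (FB D x z) (RA g))))"
      by (rule F_reduce[OF cocycD(1)[OF D_cocyc] D0])
    also have "\<dots> = 0"
    proof (intro bind2_eq_0 bind_eq_0[of "act _ _"])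
      fix h1 h2 z assume "z \<in> keys (act h1 y)"
      then have "FB D x z = 0" using True act_deg a by (intro FB0) simp
      then show "bind (mH h2 k) (\<lambda>g. bind (FB D x z) (RA g)) = 0" by simp
    qed
    finally show ?thesis by (simp add: a)
  qed
qed

end

section \<open>Slices along H and the projection onto B\<close>

lemma bind_sum: "bind v (\<lambda>x. \<Sum>i\<in>S. f i x) = (\<Sum>i\<in>S. bind v (f i))"
  by (induction S rule: infinite_finite_induct) (auto simp: bind_add)

text \<open>The coefficient of the basis vector \<open>g\<close> in the second factor. Slicing
  reduces statements about (B \<otimes> B) \<otimes> H to B \<otimes> B.\<close>

definition slice :: "('a \<times> 'b \<Rightarrow>\<^sub>0 'k::comm_ring_1) \<Rightarrow> 'b \<Rightarrow> ('a \<Rightarrow>\<^sub>0 'k)" where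
  "slice T g = bind2 T (\<lambda>p g'. if g' = g then ret p else 0)"

lemma bind_slice: "bind (slice T g) Q = bind2 T (\<lambda>p g'. if g' = g then Q p else 0)"
  unfolding slice_def bind_assocs by (rule bind2_cong) simp

lemma bind2_slices: "bind2 T Q = (\<Sum>g\<in>snd ` keys T. bind (slice T g) (\<lambda>p. Q p g))"
proof -
  have "(\<Sum>g\<in>snd ` keys T. bind (slice T g) (\<lambda>p. Q p g)) =
    bind2 T (\<lambda>p g'. \<Sum>g\<in>snd ` keys T. if g' = g then Q p g else 0)"
    by (simp only: bind_slice bind2_def bind_sum)
  also have "\<dots> = bind2 T Q"
    by (rule bind2_cong) (force simp: sum.delta)
  finally show ?thesis by simp
qed

lemma keys_sliceD: "p \<in> keys (slice T g) \<Longrightarrow> (p, g) \<in> keys T"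
  unfolding slice_def by (auto dest!: keys_bind2D split: if_splits)

context bos_data
begin

text \<open>The map theta = id \<otimes> epsilon from B # H to B.\<close>

definition B_part :: "'b \<times> 'h \<Rightarrow> ('b \<Rightarrow>\<^sub>0 'k)" where
  "B_part = (\<lambda>(b, k). sm (eH k) (ret b))"

lemma B_part_simp: "B_part (b, k) = sm (eH k) (ret b)"
  by (simp add: B_part_def)

text \<open>With \<open>B_part_RA\<close> this turns h F_B(x,y) = F_B(h_1 x, h_2 y) h_3 into
  H-linearity of theta F_B.\<close>

lemma B_part_LA: "bind (LA h a) B_part = bind (B_part a) (act h)"
proof -
  obtain u g where a: "a = (u, g)" by (cases a)
  have "bind (LA h a) B_part = bind2 (dH h) (\<lambda>h1 h2. sm (eH h2) (sm (eH g) (act h1 u)))"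
    by (simp add: a LA_def B_part_simp bind_assocs eH_mH_K sm_mult bind_sm)
  then show ?thesis
    by (simp add: dH_counit_right_K a B_part_simp bind_sm_left)
qed

lemma B_part_RA: "bind (RA h a) B_part = sm (eH h) (B_part a)"
  by (cases a) (simp add: RA_def B_part_simp bind_assocs eH_mH_K mult.commute flip: sm_mult)

lemma B_part_dA: "bind2 (dA a) (\<lambda>a1 a2. bind (B_part a1) (\<lambda>x. bind (B_part a2) (\<lambda>y. ret (x, y)))) = bind (B_part a) dB"
proof -
  obtain b h where a: "a = (b, h)" by (cases a)
  have "bind2 (dA a) (\<lambda>a1 a2. bind (B_part a1) (\<lambda>x. bind (B_part a2) (\<lambda>y. ret (x, y)))) =
    bind2 (dB b) (\<lambda>b1 b2. bind2 (coact b2) (\<lambda>y b2'. sm (eH y) (bind2 (dH h) (\<lambda>h1 h2. sm (eH h1) (sm (eH h2) (ret (b1, b2')))))))"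
    by (simp add: a dA_K B_part_simp bind_sm_left eH_mH_K sm_mult bind2_sm bind_sm)
  then show ?thesis
    by (simp add: dH_counit_left_K coact_eH_K a B_part_simp bind_sm_left bind_sm bind2_sm sm_commute[of "eH i" "eH h" for i])
qed

text \<open>The decomposition A = B # H: the map (theta \<otimes> pi) Delta is the identity. It
  detects whether an element lies in B # 1.\<close>

lemma B_part_H_part_dA: "bind2 (dA a) (\<lambda>a1 a2. bind (B_part a1) (\<lambda>b. bind (H_part a2) (\<lambda>k. ret (b, k)))) = ret a"
proof -
  obtain b h where a: "a = (b, h)" by (cases a)
  have "bind2 (dA a) (\<lambda>a1 a2. bind (B_part a1) (\<lambda>b. bind (H_part a2) (\<lambda>k. ret (b, k)))) =
    bind2 (dB b) (\<lambda>b1 b2. bind2 (coact b2) (\<lambda>y b2'. sm (eB b2') (sm (eH y) (bind2 (dH h) (\<lambda>h1 h2. sm (eH h1) (ret (b1, h2)))))))"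
    by (simp add: a dA_K B_part_simp H_part_simp bind_sm_left eH_mH_K sm_mult bind2_sm bind_sm sm_commute[of "eH i" "eB j" for i j])
  then show ?thesis
    by (simp add: dH_counit_left_K eB_coact_K eH_uH_K dB_counit_right_K a)
qed

text \<open>On B # 1 the map (pi \<otimes> theta) Delta recovers the coaction of B.\<close>

lemma H_part_B_part_dA: "bind2 (dA (b, h)) (\<lambda>a1 a2. bind (H_part a1) (\<lambda>k. bind (B_part a2) (\<lambda>b. ret (k, b)))) =
   bind2 (coact b) (\<lambda>y b'. bind (mH y h) (\<lambda>g. ret (g, b')))"
proof -
  have "bind2 (dA (b, h)) (\<lambda>a1 a2. bind (H_part a1) (\<lambda>k. bind (B_part a2) (\<lambda>b. ret (k, b)))) =
    bind2 (dB b) (\<lambda>b1 b2. sm (eB b1) (bind2 (coact b2) (\<lambda>y b'. bind2 (dH h) (\<lambda>h1 h2. sm (eH h2) (bind (mH y h1) (\<lambda>g. ret (g, b')))))))"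
    by (simp add: dA_K B_part_simp H_part_simp bind_sm_left bind2_sm bind_sm)
  then show ?thesis
    by (simp add: dH_counit_right_K dB_counit_left_K)
qed

definition Kp :: "('b \<times> 'b \<Rightarrow>\<^sub>0 'k) \<Rightarrow> bool" where
  "Kp t \<longleftrightarrow> (\<forall>x y. (x, y) \<in> keys t \<longrightarrow> deg x > 0 \<and> deg y > 0) \<and> bind2 t mB = 0"

end

section \<open>The restriction to \<open>M(B)\<close>\<close>

text \<open>\<open>no_YD\<close> restates the vanishing hypothesis for maps given on all of B
  \<otimes> B. Balancedness and H-linearity are demanded there, primitivity and colinearity on the
  kernel \<open>Kp\<close>, where the disturbing G-term is absent.\<close>

locale bos_gen = bos_L mH uH dH eH SH act coact mB uB dB eB deg b0 L
  for mH :: "'h \<Rightarrow> 'h \<Rightarrow> ('h \<Rightarrow>\<^sub>0 'k::field)" and uH dH eH SH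
    and act :: "'h \<Rightarrow> 'b \<Rightarrow> ('b \<Rightarrow>\<^sub>0 'k)" and coact mB uB dB eB deg b0 L +
  assumes B_decomposable: "deg x > L \<Longrightarrow>
      \<exists>t. (\<forall>y z. (y, z) \<in> keys t \<longrightarrow> deg y > 0 \<and> deg z > 0 \<and> deg y + deg z = deg x) \<and> bind2 t mB = ret x"
    and no_YD: "\<And>\<Phi> t. (\<And>x y z. deg x > 0 \<Longrightarrow> deg z > 0 \<Longrightarrow> bind (mB x y) (\<lambda>w. \<Phi> w z) = bind (mB y z) (\<lambda>w. \<Phi> x w)) \<Longrightarrow>
      (\<And>t. Kp t \<Longrightarrow> bind (bind2 t \<Phi>) dB =
          bind (bind2 t \<Phi>) (\<lambda>w. bind uB (\<lambda>u. ret (w, u))) + bind (bind2 t \<Phi>) (\<lambda>w. bind uB (\<lambda>u. ret (u, w)))) \<Longrightarrow>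
      (\<And>h x y. bind (\<Phi> x y) (act h) = bind2 (dH h) (\<lambda>h1 h2. bind (act h1 x) (\<lambda>x'. bind (act h2 y) (\<lambda>y'. \<Phi> x' y')))) \<Longrightarrow>
      (\<And>t. Kp t \<Longrightarrow> bind (bind2 t \<Phi>) coact = bind2 t (\<lambda>x y. bind2 (coact x) (\<lambda>g x'. bind2 (coact y) (\<lambda>g' y'.
          bind (mH g g') (\<lambda>p. bind (\<Phi> x' y') (\<lambda>w. ret (p, w))))))) \<Longrightarrow>
      (\<And>x y w. w \<in> keys (\<Phi> x y) \<Longrightarrow> deg w + L = deg x + deg y) \<Longrightarrow>
      Kp t \<Longrightarrow> bind2 t \<Phi> = 0"
begin

text \<open>A decomposition of x lifts to A because (y # 1)(z # h) = yz # h.\<close>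

sublocale C: generated_cocycles mA dA dgA L
proof
  fix a assume a: "dgA a > L"
  obtain x h where xh: "a = (x, h)" by (cases a)
  with a obtain t where t: "\<And>y z. (y, z) \<in> keys t \<Longrightarrow> deg y > 0 \<and> deg z > 0 \<and> deg y + deg z = deg x" "bind2 t mB = ret x"
    using B_decomposable[of x] by auto
  let ?t = "bind2 t (\<lambda>y z. bind uH (\<lambda>e. ret ((y, e), (z, h))))"
  have "bind uH (\<lambda>e. mA (y, e) (z, h)) = bind (mB y z) (\<lambda>x. ret (x, h))" for y z
    by (simp add: mA_eq dH_uH_K bind_commute[of uH "act i j" for i j] bind_commute[of uH "mB i j" for i j] mH_unit_left_K act_uH_K)
  then have "bind2 ?t mA = bind (bind2 t mB) (\<lambda>x. ret (x, h))"
    by (simp add: bind_assocs)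
  moreover have "C.hom_pos (dgA a) ?t"
    unfolding C.hom_pos_def using t(1) by (fastforce dest!: keys_bind2D keys_bindD simp: xh)
  ultimately show "\<exists>t. C.hom_pos (dgA a) t \<and> bind2 t mA = ret a"
    by (intro exI[of _ ?t]) (simp add: t(2) xh)
qed

context
  fixes F G n
  assumes FG: "C.cocyc F G" and n: "n \<ge> L" and Fn: "C.zero_upto n F"
begin

lemma hF: "A.hoch F" and F0: "dgA a = 0 \<or> dgA b = 0 \<Longrightarrow> F a b = 0" and cF: "A.compat F G"
  using cocycD[OF FG] by simp_all

lemma Fn': "dgA a + dgA b < Suc n \<Longrightarrow> F a b = 0"
  using Fn unfolding C.zero_upto_def by (meson less_Suc_eq_le)

text \<open>A nonzero value has total argument degree above n, hence above L; lowering by L leaves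
  something positive. So pi annihilates F_B, in contrast to total degree L.\<close>

lemma FB_positive: "w \<in> keys (FB F x y) \<Longrightarrow> dgA w > 0"
proof -
  assume w: "w \<in> keys (FB F x y)"
  have "FB F x y = 0" if "deg x + deg y \<le> n"
    unfolding FB_def by (intro bind_eq_0 Fn') (use that in simp)
  then have "deg x + deg y > n" using w by fastforce
  then show ?thesis using FB_deg[OF FG w] n by simp
qed

lemma FB_H_part: "bind (FB F x y) (\<lambda>w. bind (H_part w) K) = 0"
proof (rule bind_eq_0)
  fix w assume "w \<in> keys (FB F x y)"
  then have "dgA w > 0" by (rule FB_positive)
  then show "bind (H_part w) K = 0"
    using eB_deg by (cases w) (simp add: H_part_simp bind_sm_left)
qed

definition homK :: "('b \<times> 'b \<Rightarrow>\<^sub>0 'k) \<Rightarrow> bool" where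
  "homK t \<longleftrightarrow> (\<forall>x y. (x, y) \<in> keys t \<longrightarrow> deg x > 0 \<and> deg y > 0 \<and> deg x + deg y = Suc n) \<and> bind2 t mB = 0"

text \<open>Summed over \<open>t\<close>, the terms G(xy) of \<open>FB_compat\<close> become G of
  the product, which is zero on the kernel.\<close>

lemma kernel_compat:
  assumes t: "homK t"
  shows "bind (bind2 t (FB F)) dA = bind (bind2 t (FB F)) (\<lambda>w. bind uH (\<lambda>e. bind uB (\<lambda>u. ret (w, (u, e)))))
    + bind2 t (\<lambda>x y. bind2 (coact x) (\<lambda>g x'. bind2 (coact y) (\<lambda>g' y'. bind (mH g g') (\<lambda>p. bind uB (\<lambda>u.
        bind (FB F x' y') (\<lambda>w. ret ((u, p), w)))))))"
proof -
  have "bind (bind2 t (FB F)) dA = bind2 t (\<lambda>x y. bind (FB F x y) dA)"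
    by (simp add: bind_assocs)
  also have "\<dots> = bind2 t (\<lambda>x y. bind (FB F x y) (\<lambda>w. bind uH (\<lambda>e. bind uB (\<lambda>u. ret (w, (u, e)))))
    + bind2 (coact x) (\<lambda>g x'. bind2 (coact y) (\<lambda>g' y'. bind (mH g g') (\<lambda>p. bind uB (\<lambda>u.
        bind (FB F x' y') (\<lambda>w. ret ((u, p), w))))))
    - bind (mB x y) (\<lambda>z. bind uH (\<lambda>e. G (z, e))))"
  proof (rule bind2_cong)
    fix x y assume "(x, y) \<in> keys t"
    then have xy: "deg x > 0" "deg y > 0" "deg x + deg y = Suc n"
      using t by (auto simp: homK_def)
    show "bind (FB F x y) dA = bind (FB F x y) (\<lambda>w. bind uH (\<lambda>e. bind uB (\<lambda>u. ret (w, (u, e)))))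
    + bind2 (coact x) (\<lambda>g x'. bind2 (coact y) (\<lambda>g' y'. bind (mH g g') (\<lambda>p. bind uB (\<lambda>u.
        bind (FB F x' y') (\<lambda>w. ret ((u, p), w))))))
    - bind (mB x y) (\<lambda>z. bind uH (\<lambda>e. G (z, e)))"
      by (rule FB_compat[OF cF]) (use xy Fn' C.G_vanish[OF FG Fn] in auto)
  qed
  also have "\<dots> = bind2 t (\<lambda>x y. bind (FB F x y) (\<lambda>w. bind uH (\<lambda>e. bind uB (\<lambda>u. ret (w, (u, e))))))
    + bind2 t (\<lambda>x y. bind2 (coact x) (\<lambda>g x'. bind2 (coact y) (\<lambda>g' y'. bind (mH g g') (\<lambda>p. bind uB (\<lambda>u.
        bind (FB F x' y') (\<lambda>w. ret ((u, p), w)))))))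
    - bind (bind2 t mB) (\<lambda>z. bind uH (\<lambda>e. G (z, e)))"
    by (simp only: bind2_right bind_bind2_assoc)
  also have "bind2 t mB = 0" using t by (simp add: homK_def)
  finally show ?thesis
    by (simp only: bind_assocs bind_zero_left diff_zero)
qed

text \<open>Apply theta \<otimes> theta to \<open>kernel_compat\<close>; the counit of H collapses
  the coactions.\<close>

lemma kernel_primitive:
  assumes t: "homK t"
  defines "v \<equiv> bind (bind2 t (FB F)) B_part"
  shows "bind v dB = bind v (\<lambda>w. bind uB (\<lambda>u. ret (w, u))) + bind v (\<lambda>w. bind uB (\<lambda>u. ret (u, w)))"
proof -
  let ?K = "\<lambda>a1 a2. bind (B_part a1) (\<lambda>x. bind (B_part a2) (\<lambda>y. ret (x, y)))"
  have "bind v dB = bind2 (bind (bind2 t (FB F)) dA) ?K"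
    by (simp only: v_def bind_assocs B_part_dA)
  also have "\<dots> = bind (bind2 t (FB F)) (\<lambda>w. bind uH (\<lambda>e. bind uB (\<lambda>u. ?K w (u, e)))) +
    bind2 t (\<lambda>x y. bind2 (coact x) (\<lambda>g x'. bind2 (coact y) (\<lambda>g' y'. bind (mH g g') (\<lambda>p. bind uB (\<lambda>u.
        bind (FB F x' y') (\<lambda>w. ?K (u, p) w))))))"
    unfolding kernel_compat[OF t] bind2_left by (simp only: bind_assocs bind2_ret)
  also have "bind (bind2 t (FB F)) (\<lambda>w. bind uH (\<lambda>e. bind uB (\<lambda>u. ?K w (u, e)))) = bind v (\<lambda>w. bind uB (\<lambda>u. ret (w, u)))"
    by (simp only: v_def bind_assocs B_part_simp bind_sm_left bind_ret bind_sm eH_uH_K)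
     (simp only: bind_commute[of uB "B_part a" for a])
  also have "bind2 t (\<lambda>x y. bind2 (coact x) (\<lambda>g x'. bind2 (coact y) (\<lambda>g' y'. bind (mH g g') (\<lambda>p. bind uB (\<lambda>u.
        bind (FB F x' y') (\<lambda>w. ?K (u, p) w)))))) = bind v (\<lambda>w. bind uB (\<lambda>u. ret (u, w)))"
  proof -
    have "bind2 t (\<lambda>x y. bind2 (coact x) (\<lambda>g x'. bind2 (coact y) (\<lambda>g' y'. bind (mH g g') (\<lambda>p. bind uB (\<lambda>u.
        bind (FB F x' y') (\<lambda>w. ?K (u, p) w)))))) =
      bind2 t (\<lambda>x y. bind2 (coact x) (\<lambda>g x'. sm (eH g) (bind2 (coact y) (\<lambda>g' y'. sm (eH g') (bind uB (\<lambda>u.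
        bind (FB F x' y') (\<lambda>w. bind (B_part w) (\<lambda>w. ret (u, w)))))))))"
      by (simp only: B_part_simp bind_sm_left bind_ret bind_sm eH_mH_K sm_mult bind2_sm)
    then show ?thesis
      by (simp only: coact_eH_K v_def bind_assocs)
       (simp only: bind_commute[of uB "FB F x y" for x y] bind_commute[of uB "B_part a" for a])
  qed
  finally show ?thesis .
qed

text \<open>Apply theta \<otimes> pi: the left side is the element itself, and the coaction term
  dies because pi kills F_B. So the value lies in B # 1.\<close>

lemma kernel_B:
  assumes t: "homK t"
  shows "bind2 t (FB F) = bind (bind (bind2 t (FB F)) B_part) (\<lambda>b. bind uH (\<lambda>e. ret (b, e)))"
proof -
  let ?K = "\<lambda>a1 a2. bind (B_part a1) (\<lambda>b. bind (H_part a2) (\<lambda>k. ret (b, k)))"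
  have "bind2 t (FB F) = bind2 (bind (bind2 t (FB F)) dA) ?K"
    by (simp only: bind_assocs B_part_H_part_dA bind_ret_right)
  also have "\<dots> = bind (bind2 t (FB F)) (\<lambda>w. bind uH (\<lambda>e. bind uB (\<lambda>u. ?K w (u, e)))) +
    bind2 t (\<lambda>x y. bind2 (coact x) (\<lambda>g x'. bind2 (coact y) (\<lambda>g' y'. bind (mH g g') (\<lambda>p. bind uB (\<lambda>u.
        bind (FB F x' y') (\<lambda>w. ?K (u, p) w))))))"
    unfolding kernel_compat[OF t] bind2_left by (simp only: bind_assocs bind2_ret)
  also have "bind2 t (\<lambda>x y. bind2 (coact x) (\<lambda>g x'. bind2 (coact y) (\<lambda>g' y'. bind (mH g g') (\<lambda>p. bind uB (\<lambda>u.
        bind (FB F x' y') (\<lambda>w. ?K (u, p) w)))))) = 0"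
    by (simp only: B_part_simp bind_sm_left bind_ret bind_sm FB_H_part) simp
  also have "bind (bind2 t (FB F)) (\<lambda>w. bind uH (\<lambda>e. bind uB (\<lambda>u. ?K w (u, e)))) =
      bind (bind (bind2 t (FB F)) B_part) (\<lambda>b. bind uH (\<lambda>e. ret (b, e)))"
    by (simp only: bind_assocs H_part_simp bind_sm_left bind_ret)
      (simp only: bind_commute[of uH "B_part a" for a] bind_commute[of uB "B_part a" for a] bind_sm eB_uB_K)
  finally show ?thesis unfolding add_0_right .
qed

text \<open>Apply pi \<otimes> theta. By \<open>kernel_B\<close> the left side is the coaction of B,
  and here it is the term with right leg 1 that dies.\<close>

lemma kernel_coact:
  assumes t: "homK t"
  shows "bind (bind (bind2 t (FB F)) B_part) coact = bind2 t (\<lambda>x y. bind2 (coact x) (\<lambda>g x'. bind2 (coact y) (\<lambda>g' y'.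
          bind (mH g g') (\<lambda>p. bind (bind (FB F x' y') B_part) (\<lambda>w. ret (p, w))))))"
proof -
  let ?K = "\<lambda>a1 a2. bind (H_part a1) (\<lambda>k. bind (B_part a2) (\<lambda>b. ret (k, b)))"
  have u: "bind uH (\<lambda>e. bind2 (coact b) (\<lambda>y b'. bind (mH y e) (\<lambda>g. ret (g, b')))) = coact b" for b
    by (simp add: bind_under_bind2 mH_unit_right_K)
  have "bind (bind (bind2 t (FB F)) B_part) coact =
    bind2 (bind (bind (bind (bind2 t (FB F)) B_part) (\<lambda>b. bind uH (\<lambda>e. ret (b, e)))) dA) ?K"
    by (simp only: bind_assocs bind_ret H_part_B_part_dA u)
  also have "\<dots> = bind2 (bind (bind2 t (FB F)) dA) ?K"
    by (simp only: kernel_B[OF t, symmetric])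
  also have "\<dots> = bind (bind2 t (FB F)) (\<lambda>w. bind uH (\<lambda>e. bind uB (\<lambda>u. ?K w (u, e)))) +
    bind2 t (\<lambda>x y. bind2 (coact x) (\<lambda>g x'. bind2 (coact y) (\<lambda>g' y'. bind (mH g g') (\<lambda>p. bind uB (\<lambda>u.
        bind (FB F x' y') (\<lambda>w. ?K (u, p) w))))))"
    unfolding kernel_compat[OF t] bind2_left by (simp only: bind_assocs bind2_ret)
  also have "bind (bind2 t (FB F)) (\<lambda>w. bind uH (\<lambda>e. bind uB (\<lambda>u. ?K w (u, e)))) = 0"
    by (simp only: bind_assocs bind_commute[of uB "H_part a" for a] bind_commute[of uH "H_part a" for a] FB_H_part) simp
  finally show ?thesis
    by (simp only: add_0_left H_part_simp bind_sm_left bind_ret bind_sm eB_uB_K bind_assocs)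
qed

text \<open>Off the kernel F_B need not take values in B, so theta is applied to get a map into B.
  The other degrees are cut off because the kernel lemmas concern degree
  \<open>Suc n\<close>.\<close>

definition \<Phi> where "\<Phi> x y = (if deg x + deg y = Suc n then bind (FB F x y) B_part else 0)"

text \<open>Multiplication is graded, so the degree \<open>Suc n\<close> component of a kernel
  element is again in the kernel.\<close>

lemma Kp_restrict:
  assumes t: "Kp t"
  defines "t' \<equiv> bind2 t (\<lambda>x y. if deg x + deg y = Suc n then ret (x, y) else 0)"
  shows "homK t'" "(\<And>x y. deg x + deg y \<noteq> Suc n \<Longrightarrow> Q x y = 0) \<Longrightarrow> bind2 t Q = bind2 t' Q"
proof -
  show Q: "bind2 t Q = bind2 t' Q" if "\<And>x y. deg x + deg y \<noteq> Suc n \<Longrightarrow> Q x y = 0"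
    for Q :: "'b \<Rightarrow> 'b \<Rightarrow> 'c \<Rightarrow>\<^sub>0 'k"
    unfolding t'_def bind_assocs by (rule bind2_cong) (simp add: that)
  have "bind2 t' mB = bind (bind2 t mB) (\<lambda>w. if deg w = Suc n then ret w else 0)"
    unfolding t'_def bind_assocs
  proof (rule bind2_cong)
    fix x y
    have "bind (mB x y) (\<lambda>w. if deg w = Suc n then ret w else 0) = bind (mB x y) (\<lambda>w. if deg x + deg y = Suc n then ret w else 0)"
      by (rule bind_cong[OF refl]) (simp add: mB_deg)
    then show "bind2 (if deg x + deg y = Suc n then ret (x, y) else 0) mB = bind (mB x y) (\<lambda>w. if deg w = Suc n then ret w else 0)"
      by simp
  qed
  then have "bind2 t' mB = 0" using t by (simp add: Kp_def)
  then show "homK t'"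
    using t unfolding homK_def Kp_def t'_def by (auto dest!: keys_bind2D split: if_splits)
qed

text \<open>\<open>\<Phi>\<close> meets the requirements of \<open>no_YD\<close>: balancedness comes
  from \<open>FB_balanced\<close>, linearity from \<open>FB_LA\<close>, and the conditions on the
  kernel from the two lemmas before \<open>\<Phi>\<close>, after restriction to degree
  \<open>Suc n\<close>.\<close>

lemma \<Phi>_zero: "Kp t \<Longrightarrow> bind2 t \<Phi> = 0"
proof (rule no_YD)
  show "bind (mB x y) (\<lambda>w. \<Phi> w z) = bind (mB y z) (\<lambda>w. \<Phi> x w)" if "deg x > 0" "deg z > 0" for x y z
  proof -
    have *: "bind (mB x y) (\<lambda>w. \<Phi> w z) = bind (mB x y) (\<lambda>w. if deg x + deg y + deg z = Suc n then bind (FB F w z) B_part else 0)"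
      "bind (mB y z) (\<lambda>w. \<Phi> x w) = bind (mB y z) (\<lambda>w. if deg x + deg y + deg z = Suc n then bind (FB F x w) B_part else 0)"
      by (rule bind_cong[OF refl]; simp add: \<Phi>_def mB_deg add.assoc)+
    show ?thesis
    proof (cases "deg x + deg y + deg z = Suc n")
      case True
      have "bind (mB x y) (\<lambda>w. FB F w z) = bind (mB y z) (\<lambda>w. FB F x w)"
        by (rule FB_balanced[OF hF F0]) (use True that Fn' in auto)
      from arg_cong[OF this, of "\<lambda>v. bind v B_part"] True show ?thesis
        unfolding * by (simp add: bind_assocs)
    qed (simp add: *)
  qed
  show "bind (bind2 t \<Phi>) dB = bind (bind2 t \<Phi>) (\<lambda>w. bind uB (\<lambda>u. ret (w, u))) + bind (bind2 t \<Phi>) (\<lambda>w. bind uB (\<lambda>u. ret (u, w)))"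
    if "Kp t" for t
  proof -
    let ?t = "bind2 t (\<lambda>x y. if deg x + deg y = Suc n then ret (x, y) else 0)"
    have "bind2 t \<Phi> = bind2 ?t \<Phi>"
      by (rule Kp_restrict(2)[OF that]) (simp add: \<Phi>_def)
    also have "\<dots> = bind2 ?t (\<lambda>x y. bind (FB F x y) B_part)"
      using Kp_restrict(1)[OF that] unfolding homK_def by (intro bind2_cong) (simp add: \<Phi>_def)
    also have "\<dots> = bind (bind2 ?t (FB F)) B_part"
      by (simp only: bind_bind2_assoc)
    finally have e: "bind2 t \<Phi> = bind (bind2 ?t (FB F)) B_part" .
    show ?thesis
      unfolding e by (rule kernel_primitive[OF Kp_restrict(1)[OF that]])
  qed
  show "bind (bind2 t \<Phi>) coact = bind2 t (\<lambda>x y. bind2 (coact x) (\<lambda>g x'. bind2 (coact y) (\<lambda>g' y'.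
          bind (mH g g') (\<lambda>p. bind (\<Phi> x' y') (\<lambda>w. ret (p, w))))))" if "Kp t" for t
  proof -
    let ?t = "bind2 t (\<lambda>x y. if deg x + deg y = Suc n then ret (x, y) else 0)"
    note hk = Kp_restrict(1)[OF that]
    have "bind2 t \<Phi> = bind2 ?t \<Phi>"
      by (rule Kp_restrict(2)[OF that]) (simp add: \<Phi>_def)
    also have "\<dots> = bind2 ?t (\<lambda>x y. bind (FB F x y) B_part)"
      using hk unfolding homK_def by (intro bind2_cong) (simp add: \<Phi>_def)
    also have "\<dots> = bind (bind2 ?t (FB F)) B_part"
      by (simp only: bind_bind2_assoc)
    finally have e: "bind2 t \<Phi> = bind (bind2 ?t (FB F)) B_part" .
    let ?Q = "\<lambda>\<Psi> x y. bind2 (coact x) (\<lambda>g x'. bind2 (coact y) (\<lambda>g' y'. bind (mH g g') (\<lambda>p. bind (\<Psi> x' y') (\<lambda>w. ret (p, w)))))"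
    have Q: "?Q \<Phi> x y = (if deg x + deg y = Suc n then ?Q (\<lambda>x y. bind (FB F x y) B_part) x y else 0)" for x y
    proof -
      have "?Q \<Phi> x y = ?Q (\<lambda>x' y'. if deg x + deg y = Suc n then bind (FB F x' y') B_part else 0) x y"
        by (intro bind2_cong) (simp add: \<Phi>_def coact_deg)
      then show ?thesis by simp
    qed
    have "bind2 t (?Q \<Phi>) = bind2 ?t (?Q \<Phi>)"
      by (rule Kp_restrict(2)[OF that]) (simp add: Q)
    also have "\<dots> = bind2 ?t (?Q (\<lambda>x y. bind (FB F x y) B_part))"
      by (rule bind2_cong, use hk in \<open>simp only: Q homK_def\<close>) simp
    finally show ?thesis
      unfolding e kernel_coact[OF hk] by simp
  qed
  show "bind (\<Phi> x y) (act h) = bind2 (dH h) (\<lambda>h1 h2. bind (act h1 x) (\<lambda>x'. bind (act h2 y) (\<lambda>y'. \<Phi> x' y')))" for h x y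
  proof -
    have "bind (bind (FB F x y) B_part) (act h) = bind (bind (FB F x y) (LA h)) B_part"
      by (simp only: bind_assocs B_part_LA)
    also have "\<dots> = bind2 (dH h) (\<lambda>h1 h'. bind2 (dH h') (\<lambda>h2 h3. sm (eH h3)
      (bind (act h1 x) (\<lambda>x'. bind (act h2 y) (\<lambda>y'. bind (FB F x' y') B_part)))))"
      by (subst FB_LA[OF hF F0]) (simp_all only: bind_assocs B_part_RA bind_sm)
    finally have 1: "bind (bind (FB F x y) B_part) (act h) = bind2 (dH h) (\<lambda>h1 h2.
      bind (act h1 x) (\<lambda>x'. bind (act h2 y) (\<lambda>y'. bind (FB F x' y') B_part)))"
      by (simp only: dH_counit_right_K)
    have "bind2 (dH h) (\<lambda>h1 h2. bind (act h1 x) (\<lambda>x'. bind (act h2 y) (\<lambda>y'. \<Phi> x' y'))) =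
      bind2 (dH h) (\<lambda>h1 h2. bind (act h1 x) (\<lambda>x'. bind (act h2 y) (\<lambda>y'. if deg x + deg y = Suc n then bind (FB F x' y') B_part else 0)))"
      by (intro bind2_cong bind_cong refl) (simp add: \<Phi>_def act_deg)
    then show ?thesis using 1 by (simp add: \<Phi>_def)
  qed
  show "deg w + L = deg x + deg y" if "w \<in> keys (\<Phi> x y)" for x y w
  proof -
    from that obtain a where a: "a \<in> keys (FB F x y)" "w \<in> keys (B_part a)"
      by (auto simp: \<Phi>_def dest: keys_bindD split: if_splits)
    then have "deg w = dgA a"
      by (cases a) (auto simp: B_part_simp in_keys_iff lookup_single when_def split: if_splits)
    with FB_deg[OF FG a(1)] show ?thesis by simp
  qed
qed

lemma homK_FB:
  assumes t: "homK t"
  shows "bind2 t (FB F) = 0"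
proof -
  have "Kp t" using t by (simp add: homK_def Kp_def)
  then have "bind2 t \<Phi> = 0" by (rule \<Phi>_zero)
  moreover have "bind2 t \<Phi> = bind (bind2 t (FB F)) B_part"
    unfolding bind_bind2_assoc using t unfolding homK_def by (intro bind2_cong) (simp add: \<Phi>_def)
  ultimately show ?thesis
    using kernel_B[OF t] by simp
qed

text \<open>The passage from the kernel for B to the kernel for A, sorting by the
  H-component.\<close>

lemma kernel_F:
  assumes t: "C.hom_pos (Suc n) t" and m: "bind2 t mA = 0"
  shows "bind2 t F = 0"
proof -
  \<comment> \<open>\<open>T\<close> collects x \<otimes> h_1 y \<otimes> h_2 k for the terms (x #
    h) \<otimes> (y # k) of \<open>t\<close>. Both \<open>F\<close> (by \<open>F_reduce\<close>) and
    the multiplication of A factor through it.\<close>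
  define T where "T = bind2 t (\<lambda>a b. bind2 (dH (snd a)) (\<lambda>h1 h2. bind (act h1 (fst b)) (\<lambda>z. bind (mH h2 (snd b)) (\<lambda>g.
     ret ((fst a, z), g)))))"
  have F: "bind2 t F = bind2 T (\<lambda>p g. bind (FB F (fst p) (snd p)) (RA g))"
    unfolding T_def bind_assocs
  proof (rule bind2_cong)
    fix a b :: "'b \<times> 'h"
    obtain x h y k where ab: "a = (x, h)" "b = (y, k)" by (cases a, cases b)
    show "F a b = bind2 (dH (snd a)) (\<lambda>h1 h2. bind (act h1 (fst b)) (\<lambda>z. bind (mH h2 (snd b)) (\<lambda>g.
      bind2 (ret ((fst a, z), g)) (\<lambda>p g. bind (FB F (fst p) (snd p)) (RA g)))))"
      using F_reduce[OF hF F0, of x h y k] by (simp add: ab)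
  qed
  have M: "bind2 t mA = bind2 T (\<lambda>p g. bind (mB (fst p) (snd p)) (\<lambda>w. ret (w, g)))"
    unfolding T_def bind_assocs
    by (rule bind2_cong) (simp add: mA_def tn_def bind_assocs case_prod_beta bind_commute[of "mH i j" "mB i' j'" for i j i' j'])
  \<comment> \<open>Since m(t) is the sum of m(p) # g over the terms p \<otimes> g of
    \<open>T\<close>, its vanishing forces every slice into the kernel for B.\<close>
  have "homK (slice T g)" for g
    unfolding homK_def
  proof (intro conjI allI impI)
    fix x y assume "(x, y) \<in> keys (slice T g)"
    then have "((x, y), g) \<in> keys T" by (rule keys_sliceD)
    then obtain a b h1 where "(a, b) \<in> keys t" "x = fst a" "y \<in> keys (act h1 (fst b))"
      unfolding T_def by (auto dest!: keys_bind2D keys_bindD split: if_splits)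
    then show "deg x > 0" "deg y > 0" "deg x + deg y = Suc n"
      using t act_deg unfolding C.hom_pos_def dgA_def by metis+
  next
    have "bind2 (slice T g) mB = bind2 (bind2 t mA) (\<lambda>w g'. if g' = g then ret w else 0)"
      unfolding M bind_assocs bind2_def[of "slice T g"] bind_slice by (rule bind2_cong) simp
    then show "bind2 (slice T g) mB = 0" by (simp add: m)
  qed
  then have "bind2 (slice T g) (FB F) = 0" for g by (rule homK_FB)
  then have "bind (slice T g) (\<lambda>p. bind (FB F (fst p) (snd p)) (RA g)) = 0" for g
    by (simp add: bind2_def flip: bind_assoc)
  then show ?thesis
    unfolding F by (subst bind2_slices) simp
qed

end

end

locale bos_main = bos_lam mH uH dH eH SH act coact mB uB dB eB deg b0 L lam F G +
    bos_gen mH uH dH eH SH act coact mB uB dB eB deg b0 L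
  for mH :: "'h \<Rightarrow> 'h \<Rightarrow> ('h \<Rightarrow>\<^sub>0 'k::field)" and uH dH eH SH
    and act :: "'h \<Rightarrow> 'b \<Rightarrow> ('b \<Rightarrow>\<^sub>0 'k)" and coact mB uB dB eB deg b0 L lam F G
begin

theorem D_coboundary: "\<exists>s. (\<forall>a b. D a b = A.hoch_cobd s a b) \<and> (\<forall>c. G c = A.co_cobd s c)"
  by (rule C.coboundary[OF D_cocyc D_zero kernel_F])

end

section \<open>Transfer to functions with finite support\<close>

lemma supp_lookup [simp]: "supp (lookup v) = keys v"
  by (auto simp: supp_def in_keys_iff)

lemma fs_lookup [simp]: "fs (lookup v)"
  by (simp add: fs_def)

lemma linmap_lookup [simp]: "linmap (\<lambda>b. lookup (L b))"
  by (simp add: linmap_def)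

lemma fs_eq_lookup: "fs v \<Longrightarrow> lookup (Abs_poly_mapping v) = v"
  by (simp add: fs_def supp_def)

lemma bas_lookup: "bas = (\<lambda>b. lookup (ret b))"
  by (intro ext) (simp add: bas_def lookup_single when_def)

lemma ext_lookup: "ext (\<lambda>b. lookup (L b)) (lookup v) = lookup (bind v L)"
  by (auto simp: ext_def lookup_bind)

lemma ext_pair_lookup: "ext (\<lambda>(x, y). lookup (L x y)) (lookup v) = lookup (bind2 v L)"
  using ext_lookup[of "\<lambda>p. L (fst p) (snd p)" v] by (simp add: bind2_def case_prod_beta')

lemma ext_triple_lookup: "ext (\<lambda>(x, y, z). lookup (L x y z)) (lookup v) = lookup (bind2 v (\<lambda>x p. L x (fst p) (snd p)))"
  using ext_lookup[of "\<lambda>p. L (fst p) (fst (snd p)) (snd (snd p))" v] by (simp add: bind2_def case_prod_beta')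

lemma tens_lookup: "tens (lookup v) (lookup w) = lookup (tn v w)"
  by (auto simp: tens_def lookup_tn)

lemma tmap_lookup: "tmap (\<lambda>a. lookup (L a)) (\<lambda>b. lookup (M b)) = (\<lambda>(a, b). lookup (tn (L a) (M b)))"
  by (simp add: tmap_def tens_lookup)

lemma ext2_lookup: "ext2 (\<lambda>a b. lookup (m a b)) (lookup v) (lookup w) = lookup (bind v (\<lambda>a. bind w (\<lambda>b. m a b)))"
  by (simp add: ext2_def tens_lookup ext_pair_lookup bind2_tn)

lemma ext2_pair_lookup: "ext2 (\<lambda>(a1, a2) (b1, b2). lookup (m a1 a2 b1 b2)) (lookup v) (lookup w) =
   lookup (bind2 v (\<lambda>a1 a2. bind2 w (\<lambda>b1 b2. m a1 a2 b1 b2)))"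
  using ext2_lookup[of "\<lambda>p q. m (fst p) (snd p) (fst q) (snd q)" v w] by (simp add: bind2_def case_prod_beta')

lemma sc_lookup: "sc c (lookup v) = lookup (sm c v)"
  by (auto simp: sc_def)

lemma rassoc_lookup: "rassoc (lookup v) = lookup (bind2 v (\<lambda>p z. ret (fst p, snd p, z)))"
proof (rule ext, clarify)
  fix x y z
  have "lookup (bind2 v (\<lambda>p z. ret (fst p, snd p, z))) (x, y, z) = (\<Sum>p\<in>keys v. if p = ((x, y), z) then lookup v p else 0)"
    unfolding bind2_def lookup_bind by (rule sum.cong) (auto simp: lookup_single when_def)
  then show "rassoc (lookup v) (x, y, z) = lookup (bind2 v (\<lambda>p z. ret (fst p, snd p, z))) (x, y, z)"
    by (simp add: rassoc_def in_keys_iff)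
qed

lemma plus_lookup: "lookup v + lookup w = lookup (v + w)"
  and minus_lookup: "lookup v - lookup w = lookup (v - w)"
  and uminus_lookup: "- lookup v = lookup (- v)"
  and zero_lookup: "0 = lookup 0"
  by (auto simp: fun_eq_iff lookup_add lookup_minus)

lemma fapp_lookup: "fapp \<phi> (lookup v) = fa \<phi> v"
  by (simp add: fapp_def fa_def)

lemma fa_bind: "fa \<phi> (bind v f) = fa (\<lambda>x. fa \<phi> (f x)) v"
proof -
  have "sm (fa \<phi> (bind v f)) (ret ()) = sm (fa (\<lambda>x. fa \<phi> (f x)) v) (ret ())"
    by (simp add: bind_assoc flip: bind_fa)
  then show ?thesis
    by (metis lookup_sm lookup_single_eq mult.right_neutral)
qed

lemma fapp2_lookup: "fapp2 eta (lookup v) (lookup w) = fa (\<lambda>x. fa (eta x) w) v"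
  by (simp add: fapp2_def tens_lookup fapp_lookup tn_def fa_bind)

lemma homog_lookup: "homog d n (lookup v) \<longleftrightarrow> (\<forall>x\<in>keys v. int (d x) = n)"
  by (auto simp: homog_def in_keys_iff)

lemma tprod_lookup: "tprod (\<lambda>a b. lookup (m a b)) = (\<lambda>(a1, a2) (b1, b2). lookup (tn (m a1 b1) (m a2 b2)))"
  by (simp add: tprod_def tens_lookup)

lemmas to_lookup = bas_lookup ext_lookup ext_pair_lookup ext_triple_lookup tens_lookup tmap_lookup ext2_lookup
  ext2_pair_lookup sc_lookup rassoc_lookup plus_lookup minus_lookup uminus_lookup fapp_lookup fapp2_lookup tprod_lookup
  poly_mapping.lookup_inject

lemma tn_ret: "tn (ret b) (ret c) = ret (b, c)"
  by (simp add: tn_def)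

lemma actT_lookup: "actT (\<lambda>h b. lookup (act h b)) (\<lambda>h. lookup (dH h)) h =
   (\<lambda>(b, c). lookup (bind2 (dH h) (\<lambda>h1 h2. tn (act h1 b) (act h2 c))))"
  by (simp add: actT_def to_lookup)

lemma coactT_lookup: "coactT (\<lambda>a b. lookup (mH a b)) (\<lambda>b. lookup (coact b)) =
   (\<lambda>(b, c). lookup (bind2 (coact b) (\<lambda>x b0. bind2 (coact c) (\<lambda>y c0. tn (mH x y) (ret (b0, c0))))))"
  by (simp add: coactT_def to_lookup tn_ret)

lemma bprod_lookup: "bprod (\<lambda>a b. lookup (mB a b)) (\<lambda>h b. lookup (act h b)) (\<lambda>b. lookup (coact b)) =
   (\<lambda>(x1, x2) (y1, y2). lookup (bind2 (coact x2) (\<lambda>z x20. tn (bind (act z y1) (mB x1)) (mB x20 y2))))"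
  by (simp add: bprod_def to_lookup)

lemma hopf_transfer:
  assumes "is_hopf (\<lambda>a b. lookup (mH a b)) (lookup uH) (\<lambda>a. lookup (dH a)) eH (\<lambda>a. lookup (SH a))"
  shows "hopf_data mH uH dH (eH :: _ \<Rightarrow> 'k::field) SH"
proof -
  note * = assms[unfolded is_hopf_def is_algebra_def is_coalgebra_def, simplified to_lookup, simplified]
  show ?thesis
    using * by unfold_locales (simp_all add: bind2_def bind_assocs tn_def)
qed

lemma bos_transfer:
  fixes mH :: "'h \<Rightarrow> 'h \<Rightarrow> ('h \<Rightarrow>\<^sub>0 'k::field)" and act :: "'h \<Rightarrow> 'b \<Rightarrow> ('b \<Rightarrow>\<^sub>0 'k)"
  assumes hopf: "is_hopf (\<lambda>a b. lookup (mH a b)) (lookup uH) (\<lambda>a. lookup (dH a)) eH (\<lambda>a. lookup (SH a))"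
    and YD: "is_YD (\<lambda>a b. lookup (mH a b)) (lookup uH) (\<lambda>a. lookup (dH a)) eH (\<lambda>a. lookup (SH a))
      (\<lambda>h b. lookup (act h b)) (\<lambda>b. lookup (coact b))"
    and B: "is_gc_YD_bialg (\<lambda>a b. lookup (mH a b)) (lookup uH) (\<lambda>a. lookup (dH a)) eH
      (\<lambda>h b. lookup (act h b)) (\<lambda>b. lookup (coact b))
      (\<lambda>a b. lookup (mB a b)) (lookup uB) (\<lambda>b. lookup (dB b)) eB deg"
  shows "\<exists>b0. bos_data mH uH dH eH SH act coact mB uB dB eB deg b0"
proof -
  interpret hopf_data mH uH dH eH SH by (rule hopf_transfer[OF hopf])
  note Y = YD[unfolded is_YD_def, simplified to_lookup, simplified]
  have mB: "(\<lambda>(x, y). lookup (mB x y)) = (\<lambda>p. lookup (mB (fst p) (snd p)))"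
    by (simp add: case_prod_beta')
  note B1 = B[unfolded is_gc_YD_bialg_def is_algebra_def is_coalgebra_def, simplified actT_lookup coactT_lookup bprod_lookup,
      unfolded mB, simplified to_lookup homog_lookup, simplified]
  from B1 obtain b0 where b0: "\<And>b. deg b = 0 \<longleftrightarrow> b = b0"
    by metis
  have hm: "\<forall>b c. homog deg (int (deg b + deg c)) (lookup (mB b c))"
    using B unfolding is_gc_YD_bialg_def by (elim conjE)
  have hd: "\<forall>b. homog (deg2 deg) (int (deg b)) (lookup (dB b))"
    using B unfolding is_gc_YD_bialg_def by (elim conjE)
  have dm: "deg x = deg b + deg c" if "x \<in> keys (mB b c)" for x b c
    using hm that by (simp add: homog_lookup flip: of_nat_add)
  have dd: "deg x + deg y = deg b" if "(x, y) \<in> keys (dB b)" for x y b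
    using hd that by (fastforce simp add: homog_lookup deg2_def)
  have "bos_data mH uH dH eH SH act coact mB uB dB eB deg b0"
    by (unfold_locales; (rule dm, assumption | rule dd, assumption |
        insert Y B1 b0, simp add: ext_lookup ext_pair_lookup poly_mapping.lookup_inject bind2_def bind_assocs tn_def in_keys_iff))
  then show ?thesis ..
qed

lemma lookup_restrict: "lookup (bind v (\<lambda>p. if P p then ret p else 0)) q = (if P q then lookup v q else 0)"
proof -
  have "lookup (bind v (\<lambda>p. if P p then ret p else 0)) q = (\<Sum>p\<in>keys v. if p = q then (if P q then lookup v q else 0) else 0)"
    unfolding lookup_bind by (rule sum.cong) (auto simp: lookup_single when_def)
  then show ?thesis by (simp add: in_keys_iff)
qed

section \<open>The Yetter-Drinfeld and generation hypotheses\<close>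

context bos_data
begin

lemma Kset_lookup: "lookup t \<in> Kset (\<lambda>a b. lookup (mB a b)) deg \<longleftrightarrow> Kp t"
proof -
  have "ext (\<lambda>(x, y). lookup (mB x y)) (lookup t) = 0 \<longleftrightarrow> bind2 t mB = 0"
    by (simp only: ext_pair_lookup zero_lookup poly_mapping.lookup_inject)
  then show ?thesis
    by (auto simp: Kset_def Kp_def in_keys_iff)
qed

lemma Kset_Kp: "T \<in> Kset (\<lambda>a b. lookup (mB a b)) deg \<Longrightarrow> \<exists>t. T = lookup t \<and> Kp t"
proof -
  assume T: "T \<in> Kset (\<lambda>a b. lookup (mB a b)) deg"
  then have "lookup (Abs_poly_mapping T) = T"
    by (intro fs_eq_lookup) (simp add: Kset_def)
  with T Kset_lookup[of "Abs_poly_mapping T"] show ?thesis by metis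
qed

lemma no_YD_transfer:
  assumes Z: "YD_MP_zero (\<lambda>a b. lookup (mH a b)) (\<lambda>h. lookup (dH h)) (\<lambda>h b. lookup (act h b)) (\<lambda>b. lookup (coact b))
      (\<lambda>a b. lookup (mB a b)) (lookup uB) (\<lambda>b. lookup (dB b)) deg (- int L)"
    and R: "\<And>x y z. deg x > 0 \<Longrightarrow> deg z > 0 \<Longrightarrow> bind (mB x y) (\<lambda>w. \<Phi> w z) = bind (mB y z) (\<lambda>w. \<Phi> x w)"
    and P: "\<And>t. Kp t \<Longrightarrow> bind (bind2 t \<Phi>) dB =
          bind (bind2 t \<Phi>) (\<lambda>w. bind uB (\<lambda>u. ret (w, u))) + bind (bind2 t \<Phi>) (\<lambda>w. bind uB (\<lambda>u. ret (u, w)))"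
    and H: "\<And>h x y. bind (\<Phi> x y) (act h) = bind2 (dH h) (\<lambda>h1 h2. bind (act h1 x) (\<lambda>x'. bind (act h2 y) (\<lambda>y'. \<Phi> x' y')))"
    and C: "\<And>t. Kp t \<Longrightarrow> bind (bind2 t \<Phi>) coact = bind2 t (\<lambda>x y. bind2 (coact x) (\<lambda>g x'. bind2 (coact y) (\<lambda>g' y'.
          bind (mH g g') (\<lambda>p. bind (\<Phi> x' y') (\<lambda>w. ret (p, w))))))"
    and D: "\<And>x y w. w \<in> keys (\<Phi> x y) \<Longrightarrow> deg w + L = deg x + deg y"
    and t: "Kp t"
  shows "bind2 t \<Phi> = 0"
proof -
  let ?K = "Kset (\<lambda>a b. lookup (mB a b)) deg"
  \<comment> \<open>The test map must be defined on all functions. On finitely supported ones, which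
    include all of \<open>Kset\<close>, it is the linear extension of \<open>\<Phi>\<close>.\<close>
  define \<phi> where "\<phi> T = lookup (bind2 (Abs_poly_mapping T) \<Phi>)" for T
  have \<phi>: "\<phi> (lookup t) = lookup (bind2 t \<Phi>)" for t
    by (simp add: \<phi>_def lookup_inverse)
  have "\<forall>T\<in>?K. \<phi> T = 0"
  proof (rule mp[OF spec[OF Z[unfolded YD_MP_zero_def], of \<phi>]], intro conjI ballI allI impI)
    fix T U assume "T \<in> ?K" "U \<in> ?K"
    then obtain t u where "T = lookup t" "U = lookup u" using Kset_Kp by metis
    then show "\<phi> (T + U) = \<phi> T + \<phi> U" by (simp only: plus_lookup \<phi> bind2_left)
  next
    fix c T assume "T \<in> ?K"
    then obtain t where "T = lookup t" using Kset_Kp by metis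
    then show "\<phi> (sc c T) = sc c (\<phi> T)" by (simp only: sc_lookup \<phi> bind2_left)
  next
    fix x y z assume xz: "0 < deg x" "0 < deg z"
    show "\<phi> (tens (lookup (mB x y)) (bas z) - tens (bas x) (lookup (mB y z))) = 0"
      by (simp only: bas_lookup tens_lookup minus_lookup \<phi> bind2_left bind2_tn bind_ret R[OF xz]) (simp add: zero_lookup)
  next
    fix T assume "T \<in> ?K"
    then obtain t where T: "T = lookup t" "Kp t" using Kset_Kp by metis
    show "fs (\<phi> T)" by (simp add: T \<phi>)
    show "ext (\<lambda>b. lookup (dB b)) (\<phi> T) = tens (\<phi> T) (lookup uB) + tens (lookup uB) (\<phi> T)"
      unfolding T \<phi> ext_lookup tens_lookup plus_lookup poly_mapping.lookup_inject P[OF T(2)]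
      by (simp add: tn_def bind_commute[of uB])
  next
    fix h T assume "T \<in> ?K"
    then obtain t where T: "T = lookup t" "Kp t" using Kset_Kp by metis
    show "\<phi> (ext (actT (\<lambda>h b. lookup (act h b)) (\<lambda>h. lookup (dH h)) h) T) = ext (\<lambda>b. lookup (act h b)) (\<phi> T)"
      unfolding actT_lookup T ext_pair_lookup ext_lookup \<phi>
      by (simp only: bind_assocs H bind2_tn)
  next
    fix T x b assume "T \<in> ?K"
    then obtain t where T: "T = lookup t" "Kp t" using Kset_Kp by metis
    define Z where "Z = bind2 t (\<lambda>b c. bind2 (coact b) (\<lambda>x b0. bind2 (coact c) (\<lambda>y c0. tn (mH x y) (ret (b0, c0)))))"
    \<comment> \<open>Colinearity in the hypothesis is stated coefficientwise in H; the coefficient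
      of \<open>x\<close> is written as a finitely supported vector so that \<open>\<phi>\<close>
      can be evaluated on it.\<close>
    have sl: "(\<lambda>p. lookup Z (x, p)) = lookup (bind2 Z (\<lambda>g q. if g = x then ret q else 0))"
    proof
      fix p
      have "lookup (bind2 Z (\<lambda>g q. if g = x then ret q else 0)) p = (\<Sum>gq\<in>keys Z. if gq = (x, p) then lookup Z gq else 0)"
        unfolding bind2_def lookup_bind by (rule sum.cong) (auto simp: lookup_single when_def)
      then show "lookup Z (x, p) = lookup (bind2 Z (\<lambda>g q. if g = x then ret q else 0)) p"
        by (simp add: in_keys_iff)
    qed
    have "ext (\<lambda>b. lookup (coact b)) (\<phi> T) (x, b) = lookup (bind2 Z (\<lambda>g q. tn (ret g) (\<Phi> (fst q) (snd q)))) (x, b)"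
      unfolding T \<phi> ext_lookup C[OF T(2)] Z_def by (simp add: bind_assocs tn_def)
    also have "\<dots> = lookup (bind2 Z (\<lambda>g q. if g = x then \<Phi> (fst q) (snd q) else 0)) b"
      unfolding bind2_def lookup_bind
      by (rule sum.cong) (auto simp: lookup_tn lookup_single when_def)
    also have "\<dots> = \<phi> (\<lambda>p. lookup Z (x, p)) b"
      unfolding sl \<phi> bind_assocs by (rule arg_cong[of _ _ "\<lambda>v. lookup v b"], rule bind2_cong) (simp add: bind2_def)
    finally show "ext (\<lambda>b. lookup (coact b)) (\<phi> T) (x, b) =
        \<phi> (\<lambda>p. ext (coactT (\<lambda>a b. lookup (mH a b)) (\<lambda>b. lookup (coact b))) T (x, p)) b"
      unfolding coactT_lookup T ext_pair_lookup Z_def .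
  next
    fix T p assume "T \<in> ?K" and h: "homog (deg2 deg) p T"
    then obtain t where T: "T = lookup t" "Kp t" using Kset_Kp by metis
    show "homog deg (p + - int L) (\<phi> T)"
      unfolding T \<phi> homog_lookup
    proof
      fix w assume "w \<in> keys (bind2 t \<Phi>)"
      then obtain x y where xy: "(x, y) \<in> keys t" "w \<in> keys (\<Phi> x y)" by (blast dest: keys_bind2D)
      from h xy(1) have "int (deg x + deg y) = p" by (fastforce simp: T homog_lookup deg2_def)
      with D[OF xy(2)] show "int (deg w) = p + - int L" by linarith
    qed
  qed
  moreover have "lookup t \<in> ?K" using t by (simp add: Kset_lookup)
  ultimately have "lookup (bind2 t \<Phi>) = 0" by (metis \<phi>)
  then show ?thesis by (simp only: zero_lookup poly_mapping.lookup_inject)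
qed

lemma bind_at: "bind v (\<lambda>x. if x = a then w else 0) = sm (lookup v a) w"
proof (rule poly_mapping_eqI)
  fix k
  have "lookup (bind v (\<lambda>x. if x = a then w else 0)) k = (\<Sum>x\<in>keys v. if x = a then lookup v a * lookup w k else 0)"
    unfolding lookup_bind by (rule sum.cong) auto
  then show "lookup (bind v (\<lambda>x. if x = a then w else 0)) k = lookup (sm (lookup v a) w) k"
    by (simp add: in_keys_iff)
qed

definition hom_pair :: "nat \<Rightarrow> ('b \<times> 'b \<Rightarrow>\<^sub>0 'k) \<Rightarrow> bool" where
  "hom_pair n t \<longleftrightarrow> (\<forall>y z. (y, z) \<in> keys t \<longrightarrow> deg y > 0 \<and> deg z > 0 \<and> deg y + deg z = n)"

lemma hom_pair_add: "hom_pair n t \<Longrightarrow> hom_pair n u \<Longrightarrow> hom_pair n (t + u)"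
  unfolding hom_pair_def by (blast dest: keys_addD)

lemma hom_pair_sm: "hom_pair n t \<Longrightarrow> hom_pair n (sm c t)"
  unfolding hom_pair_def by (auto simp: in_keys_iff)

definition part :: "nat \<Rightarrow> ('b \<Rightarrow>\<^sub>0 'k) \<Rightarrow> ('b \<Rightarrow>\<^sub>0 'k)" where
  "part n v = bind v (\<lambda>x. if deg x = n then ret x else 0)"

text \<open>The claim concerns the homogeneous components of degree above \<open>L\<close>, since
  sums and products of generators are not homogeneous. Generators and the unit have no such
  component.\<close>

lemma subalg_decomposable:
  assumes "v \<in> subalg (\<lambda>a b. lookup (mB a b)) (lookup uB) {w. fs w \<and> (\<exists>d::nat. int d \<le> int L \<and> homog deg (int d) w)}"
  shows "\<exists>V. v = lookup V \<and> (\<forall>n>L. \<exists>t. hom_pair n t \<and> bind2 t mB = part n V)"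
  using assms
proof (induction rule: subalg.induct)
  case (gen v)
  then obtain d where d: "fs v" "d \<le> L" "homog deg (int d) v" by auto
  define V where "V = Abs_poly_mapping v"
  have v: "v = lookup V" unfolding V_def using fs_eq_lookup[OF d(1)] by simp
  have "part n V = 0" if "n > L" for n
    unfolding part_def using d(2,3) that by (intro bind_eq_0) (auto simp: v homog_lookup)
  then show ?case
    by (intro exI[of _ V] conjI v allI impI exI[of _ 0]) (auto simp: hom_pair_def)
next
  case one
  have "part n uB = 0" if "n > L" for n
    unfolding part_def using uB_deg that by (intro bind_eq_0) auto
  then show ?case
    by (intro exI[of _ uB] conjI refl allI impI exI[of _ 0]) (auto simp: hom_pair_def)
next
  case (add v w)
  then obtain V W where V: "v = lookup V" "\<And>n. n > L \<Longrightarrow> \<exists>t. hom_pair n t \<and> bind2 t mB = part n V"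
    and W: "w = lookup W" "\<And>n. n > L \<Longrightarrow> \<exists>t. hom_pair n t \<and> bind2 t mB = part n W" by blast
  show ?case
  proof (intro exI[of _ "V + W"] conjI allI impI)
    show "v + w = lookup (V + W)" by (simp only: V W plus_lookup)
    fix n assume "n > L"
    then obtain t u where "hom_pair n t \<and> bind2 t mB = part n V" "hom_pair n u \<and> bind2 u mB = part n W"
      using V(2) W(2) by blast
    then show "\<exists>t. hom_pair n t \<and> bind2 t mB = part n (V + W)"
      by (intro exI[of _ "t + u"]) (simp add: hom_pair_add part_def bind_linear)
  qed
next
  case (smult v c)
  then obtain V where V: "v = lookup V" "\<And>n. n > L \<Longrightarrow> \<exists>t. hom_pair n t \<and> bind2 t mB = part n V" by blast
  show ?case
  proof (intro exI[of _ "sm c V"] conjI allI impI)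
    show "sc c v = lookup (sm c V)" by (simp only: V sc_lookup)
    fix n assume "n > L"
    then obtain t where "hom_pair n t \<and> bind2 t mB = part n V" using V(2) by blast
    then show "\<exists>t. hom_pair n t \<and> bind2 t mB = part n (sm c V)"
      by (intro exI[of _ "sm c t"]) (simp add: hom_pair_sm part_def bind_sm_left bind2_left)
  qed
next
  case (mult v w)
  then obtain V W where V: "v = lookup V" "\<And>n. n > L \<Longrightarrow> \<exists>t. hom_pair n t \<and> bind2 t mB = part n V"
    and W: "w = lookup W" "\<And>n. n > L \<Longrightarrow> \<exists>t. hom_pair n t \<and> bind2 t mB = part n W" by blast
  show ?case
  proof (intro exI[of _ "bind V (\<lambda>a. bind W (mB a))"] conjI allI impI)
    show "ext2 (\<lambda>a b. lookup (mB a b)) v w = lookup (bind V (\<lambda>a. bind W (mB a)))"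
      by (simp only: V W ext2_lookup)
    fix n assume n: "n > L"
    then obtain t u where t: "hom_pair n t" "bind2 t mB = part n V" and u: "hom_pair n u" "bind2 u mB = part n W"
      using V(2) W(2) by blast
    define A :: "'b \<Rightarrow> 'b \<Rightarrow> ('b \<times> 'b \<Rightarrow>\<^sub>0 'k)" where "A a b = (if deg a > 0 \<and> deg b > 0 \<and> deg a + deg b = n then ret (a, b) else 0)" for a b
    \<comment> \<open>A pair of positive degrees is its own decomposition. If one factor is
      \<open>b0\<close>, the product is a multiple of the other factor, whose component is
      decomposed by the induction hypothesis.\<close>
    have A: "bind (mB a b) (\<lambda>x. if deg x = n then ret x else 0) =
      bind2 (A a b) mB + (if a = b0 then sm (eB b0) (if deg b = n then ret b else 0) else 0)
      + (if b = b0 then sm (eB b0) (if deg a = n then ret a else 0) else 0)" for a b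
    proof -
      have "bind (mB a b) (\<lambda>x. if deg x = n then ret x else 0) = bind (mB a b) (\<lambda>x. if deg a + deg b = n then ret x else 0)"
        by (rule bind_cong[OF refl]) (simp add: mB_deg)
      also have "\<dots> = (if deg a + deg b = n then mB a b else 0)" by simp
      also have "\<dots> = bind2 (A a b) mB + (if a = b0 then sm (eB b0) (if deg b = n then ret b else 0) else 0)
      + (if b = b0 then sm (eB b0) (if deg a = n then ret a else 0) else 0)"
        using n connected[of a] connected[of b] connected[of b0] by (auto simp: A_def mB_b0)
      finally show ?thesis .
    qed
    have "part n (bind V (\<lambda>a. bind W (mB a))) = bind2 (bind V (\<lambda>a. bind W (A a))) mB
      + bind V (\<lambda>a. if a = b0 then sm (eB b0) (part n W) else 0)
      + bind V (\<lambda>a. sm (lookup W b0) (sm (eB b0) (if deg a = n then ret a else 0)))"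
    proof -
      have "bind W (\<lambda>b. if a = b0 then sm (eB b0) (if deg b = n then ret b else 0) else 0) =
        (if a = b0 then sm (eB b0) (part n W) else 0)" for a
        by (simp add: part_def bind_sm)
      then show ?thesis
        unfolding part_def[of n "bind V _"] bind_assocs A bind_add by (simp only: bind_at)
    qed
    also have "\<dots> = bind2 (bind V (\<lambda>a. bind W (A a)) + sm (lookup V b0) (sm (eB b0) u) + sm (lookup W b0) (sm (eB b0) t)) mB"
      by (simp only: bind_at bind_sm bind2_left t u part_def[of n V, symmetric])
    finally have e: "part n (bind V (\<lambda>a. bind W (mB a))) = \<dots>" .
    have "hom_pair n (bind V (\<lambda>a. bind W (A a)))"
      unfolding hom_pair_def A_def by (auto dest!: keys_bindD split: if_splits)
    with t u e show "\<exists>t. hom_pair n t \<and> bind2 t mB = part n (bind V (\<lambda>a. bind W (mB a)))"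
      by (metis hom_pair_add hom_pair_sm)
  qed
qed

end

section \<open>Translation of the cocycle conditions\<close>

lemma lookup_eq_zero: "lookup v = 0 \<longleftrightarrow> v = 0"
  by (simp only: zero_lookup poly_mapping.lookup_inject)

lemma sm_unitD: "sm c (ret ()) = sm c' (ret ()) \<Longrightarrow> c = c'"
  by (drule arg_cong[of _ _ "\<lambda>v. lookup v ()"]) simp

context bos_data
begin

lemma bos_mult_lookup: "bos_mult (\<lambda>a b. lookup (mB a b)) (\<lambda>h b. lookup (act h b)) (\<lambda>a b. lookup (mH a b)) (\<lambda>h. lookup (dH h)) =
    (\<lambda>a b. lookup (mA a b))"
  by (intro ext) (simp add: bos_mult_def mA_def to_lookup split: prod.split)

lemma bos_comult_lookup: "bos_comult (\<lambda>b. lookup (dB b)) (\<lambda>b. lookup (coact b)) (\<lambda>a b. lookup (mH a b)) (\<lambda>h. lookup (dH h)) =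
    (\<lambda>a. lookup (dA a))"
  by (intro ext) (simp add: bos_comult_def dA_def to_lookup tn_ret split: prod.split)

lemma bos_counit_lookup: "bos_counit eB eH = eA"
  by (simp add: bos_counit_def eA_def)

lemma bos_deg_lookup: "bos_deg deg = dgA"
  by (auto simp: bos_deg_def dgA_def)

lemma bos_unit_lookup: "bos_unit (lookup uB) (lookup uH) = lookup (tn uB uH)"
  by (simp add: bos_unit_def to_lookup)

lemmas bos_lookup = bos_mult_lookup bos_comult_lookup bos_counit_lookup bos_deg_lookup bos_unit_lookup

text \<open>The conditions on the second component alone. They are kept as one block because
  \<open>G\<close> is the same before and after subtracting \<partial>^c.\<close>

definition co_cond :: "('b \<times> 'h \<Rightarrow> ('b \<times> 'h) \<times> ('b \<times> 'h) \<Rightarrow> 'k) \<Rightarrow> bool" where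
  "co_cond g \<longleftrightarrow> linmap g \<and> ext g (lookup (tn uB uH)) = 0 \<and>
     (\<forall>c. ext (\<lambda>(x, y). sc (eA x) (bas y)) (g c) = 0 \<and> ext (\<lambda>(x, y). sc (eA y) (bas x)) (g c) = 0) \<and>
     (\<forall>c. ext (tmap bas g) (lookup (dA c)) + ext (tmap bas (\<lambda>a. lookup (dA a))) (g c) =
          rassoc (ext (tmap (\<lambda>a. lookup (dA a)) bas) (g c) + ext (tmap g bas) (lookup (dA c))))"

lemma Zhat_lookup:
  "Zhat (\<lambda>a b. lookup (mA a b)) (lookup (tn uB uH)) (\<lambda>a. lookup (dA a)) eA (\<lambda>a b. lookup (F a b)) (\<lambda>c. lookup (G c)) \<longleftrightarrow>
    (\<forall>a. bind (tn uB uH) (\<lambda>x. F x a) = 0 \<and> bind (tn uB uH) (F a) = 0) \<and> (\<forall>a b. fa eA (F a b) = 0) \<and>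
    co_cond (\<lambda>c. lookup (G c)) \<and> A.hoch F \<and> A.compat F G"
proof -
  have h: "A.hoch F \<longleftrightarrow> (\<forall>a b c. ext2 (\<lambda>a b. lookup (mA a b)) (bas a) (lookup (F b c)) + ext2 (\<lambda>a b. lookup (F a b)) (bas a) (lookup (mA b c)) =
      ext2 (\<lambda>a b. lookup (F a b)) (lookup (mA a b)) (bas c) + ext2 (\<lambda>a b. lookup (mA a b)) (lookup (F a b)) (bas c))"
    by (simp only: A.hoch_def to_lookup bind_ret)
  have c: "A.compat F G \<longleftrightarrow> (\<forall>a b. ext2 (\<lambda>(a1, a2) (b1, b2). tens (lookup (F a1 b1)) (lookup (mA a2 b2))) (lookup (dA a)) (lookup (dA b)) - ext (\<lambda>a. lookup (dA a)) (lookup (F a b))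
             + ext2 (\<lambda>(a1, a2) (b1, b2). tens (lookup (mA a1 b1)) (lookup (F a2 b2))) (lookup (dA a)) (lookup (dA b))
           = - ext2 (tprod (\<lambda>a b. lookup (mA a b))) (lookup (dA a)) (lookup (G b)) + ext (\<lambda>c. lookup (G c)) (lookup (mA a b))
             - ext2 (tprod (\<lambda>a b. lookup (mA a b))) (lookup (G a)) (lookup (dA b)))"
    by (simp only: A.compat_def to_lookup)
  have u: "(\<forall>a. bind (tn uB uH) (\<lambda>x. F x a) = 0 \<and> bind (tn uB uH) (F a) = 0) \<longleftrightarrow>
     (\<forall>a. ext2 (\<lambda>a b. lookup (F a b)) (lookup (tn uB uH)) (bas a) = 0 \<and> ext2 (\<lambda>a b. lookup (F a b)) (bas a) (lookup (tn uB uH)) = 0)"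
    by (simp only: to_lookup bind_ret lookup_eq_zero)
  show ?thesis
    unfolding Zhat_def co_cond_def h c u by (simp add: fapp_lookup) blast
qed

text \<open>On degree 0 the projection is multiplication by epsilon(\<open>b0\<close>), which is
  invertible, and on positive degrees it is zero. So the part of \<open>g\<close> whose left leg has
  degree 0 can be recovered from its image and must vanish.\<close>

lemma bitrivial_left:
  assumes "ext (tmap (bos_pi eB) bas) (lookup g) = 0" and xy: "(x, y) \<in> keys g"
  shows "dgA x > 0"
proof (rule ccontr)
  assume "\<not> dgA x > 0"
  then have x: "dgA x = 0" by simp
  have pi: "bos_pi eB = (\<lambda>a. lookup (H_part a))"
    by (intro ext) (simp add: bos_pi_def H_part_def to_lookup case_prod_beta)
  have "bind2 g (\<lambda>x y. tn (H_part x) (ret y)) = 0"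
    using assms(1) by (simp only: pi to_lookup lookup_eq_zero)
  \<comment> \<open>Reinserting \<open>b0\<close> as the first factor undoes the projection on
    degree 0 up to the scalar epsilon(\<open>b0\<close>).\<close>
  then have "bind2 (bind2 g (\<lambda>x y. tn (H_part x) (ret y))) (\<lambda>h y. ret ((b0, h), y)) = 0"
    by simp
  then have "bind2 g (\<lambda>x y. sm (eB (fst x)) (ret ((b0, snd x), y))) = 0"
    by (simp add: bind_assocs bind2_tn H_part_def case_prod_beta bind_sm_left)
  also have "bind2 g (\<lambda>x y. sm (eB (fst x)) (ret ((b0, snd x), y))) =
    bind2 g (\<lambda>x y. sm (eB b0) (if dgA x = 0 then ret (x, y) else 0))"
  proof (rule bind2_cong)
    fix a y
    show "sm (eB (fst a)) (ret ((b0, snd a), y)) = sm (eB b0) (if dgA a = 0 then ret (a, y) else 0)"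
      using connected[of "fst a"] eB_deg[of "fst a"] by (cases a) auto
  qed
  finally have z: "sm (eB b0) (bind g (\<lambda>p. if dgA (fst p) = 0 then ret p else 0)) = 0"
    by (simp only: bind2_sm bind2_def prod.collapse)
  obtain c where "eB b0 * c = 1" using uB_scale by blast
  then have "eB b0 \<noteq> 0" by auto
  moreover have "eB b0 * lookup g (x, y) = 0"
    using arg_cong[OF z, of "\<lambda>v. lookup v (x, y)"] x by (simp add: lookup_restrict)
  ultimately show False using xy by (simp add: in_keys_iff)
qed

lemma bitrivial_right:
  assumes "ext (tmap bas (bos_pi eB)) (lookup g) = 0" and xy: "(x, y) \<in> keys g"
  shows "dgA y > 0"
proof -
  let ?g = "bind2 g (\<lambda>x y. ret (y, x))"
  have pi: "bos_pi eB = (\<lambda>a. lookup (H_part a))"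
    by (intro ext) (simp add: bos_pi_def H_part_def to_lookup case_prod_beta)
  have "bind2 g (\<lambda>x y. tn (ret x) (H_part y)) = 0"
    using assms(1) by (simp only: pi to_lookup lookup_eq_zero)
  then have "bind2 (bind2 g (\<lambda>x y. tn (ret x) (H_part y))) (\<lambda>x y. ret (y, x)) = 0"
    by simp
  then have "ext (tmap (bos_pi eB) bas) (lookup ?g) = 0"
    by (simp only: pi to_lookup lookup_eq_zero) (simp add: bind_assocs bind2_tn tn_def)
  moreover have "lookup ?g (y, x) = lookup g (x, y)"
  proof -
    have "lookup ?g (y, x) = (\<Sum>p\<in>keys g. if p = (x, y) then lookup g (x, y) else 0)"
      unfolding bind2_def lookup_bind by (rule sum.cong) (auto simp: lookup_single when_def)
    then show ?thesis by (simp add: in_keys_iff)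
  qed
  then have "(y, x) \<in> keys ?g" using xy by (simp add: in_keys_iff)
  ultimately show ?thesis by (rule bitrivial_left)
qed

end

context bos_L
begin

lemma cocyc_transfer:
  assumes Z: "Ztilde (\<lambda>a b. lookup (mH a b)) (lookup uH) (\<lambda>h. lookup (dH h)) eH (\<lambda>h b. lookup (act h b)) (\<lambda>b. lookup (coact b))
      (\<lambda>a b. lookup (mB a b)) (lookup uB) (\<lambda>b. lookup (dB b)) eB deg (\<lambda>a b. lookup (F a b)) (\<lambda>c. lookup (G c))"
    and hp: "homog_pair deg (- int L) (\<lambda>a b. lookup (F a b)) (\<lambda>c. lookup (G c))"
  shows "C.cocyc F G"
proof -
  have Zh: "A.hoch F" "A.compat F G"
    using Z unfolding Ztilde_def bos_lookup Zhat_lookup by blast+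
  have t: "F a b = 0" if "dgA a = 0 \<or> dgA b = 0" for a b
    using Z that unfolding Ztilde_def bos_lookup lookup_eq_zero by blast
  have g: "dgA x > 0 \<and> dgA y > 0" if "(x, y) \<in> keys (G c)" for x y c
    using Z that bitrivial_left[of "G c"] bitrivial_right[of "G c"] unfolding Ztilde_def by blast
  have dF: "dgA c + L = dgA a + dgA b" if "c \<in> keys (F a b)" for a b c
  proof -
    have "int (dgA c) = int (dgA a + dgA b) + - int L"
      using hp that unfolding homog_pair_def bos_lookup homog_lookup by blast
    then show ?thesis by linarith
  qed
  have dG: "dgA x + dgA y + L = dgA c" if "(x, y) \<in> keys (G c)" for x y c
  proof -
    have "int (deg2 dgA (x, y)) = int (dgA c) + - int L"
      using hp that unfolding homog_pair_def bos_lookup homog_lookup by blast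
    then show ?thesis by (simp add: deg2_def)
  qed
  show ?thesis
    unfolding C.cocyc_def using Zh t g dF dG by blast
qed

end

context bos_lam
begin

lemma eta_tilde_eq: "eta_tilde eH (\<lambda>h b. lookup (act h b)) eta = eta_t"
  by (intro ext) (simp add: eta_tilde_def eta_t_def to_lookup case_prod_beta)

lemma dc_lookup: "dc (\<lambda>a b. lookup (mA a b)) (\<lambda>a. lookup (dA a)) eta_t a b = lookup (A.conv_cobd eta_t a b)"
  unfolding dc_def by (simp only: to_lookup A.conv_cobd_def A.conv_l_def A.conv_r_def bind2_right)

lemma hoch_cocycle_eta: "hoch_cocycle (\<lambda>a b. lookup (mB a b)) eB eta"
  unfolding hoch_cocycle_def
proof (intro allI)
  fix a b c
  have "sm (eB a * eta b c + fa (eta a) (mB b c)) (ret ()) = sm (fa (\<lambda>x. eta x c) (mB a b) + eB c * eta a b) (ret ())"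
    using eta_cocycle[of a b c "ret ()"] by (simp only: bind_fa sm_add_left sm_mult)
  then have "eB a * eta b c + fa (eta a) (mB b c) = fa (\<lambda>x. eta x c) (mB a b) + eB c * eta a b"
    by (rule sm_unitD)
  then show "eB a * eta b c - fapp2 eta (lookup (mB a b)) (bas c) + fapp2 eta (bas a) (lookup (mB b c)) - eta a b * eB c = 0"
    by (simp add: to_lookup algebra_simps)
qed

lemma hact_coch_eta: "hact_coch (\<lambda>h. lookup (dH h)) (\<lambda>h b. lookup (act h b)) eta h b c = eH h * eta b c"
proof -
  have "sm (fa (\<lambda>p. fa (\<lambda>x. fa (eta x) (act (snd p) c)) (act (fst p) b)) (dH h)) (ret ()) = sm (eH h * eta b c) (ret ())"
    using eta_stable[of h b c "ret ()"] by (simp only: bind2_def bind_fa)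
  then have "fa (\<lambda>p. fa (\<lambda>x. fa (eta x) (act (snd p) c)) (act (fst p) b)) (dH h) = eH h * eta b c"
    by (rule sm_unitD)
  then show ?thesis
    by (simp add: hact_coch_def to_lookup case_prod_beta')
qed

text \<open>Normalization follows from vanishing on degree 0, where the unit lives; the counit
  condition follows from \<open>e_conv_cobd\<close>; the conditions on \<open>G\<close> are
  inherited.\<close>

lemma Ztilde_D:
  assumes Z: "Ztilde (\<lambda>a b. lookup (mH a b)) (lookup uH) (\<lambda>h. lookup (dH h)) eH (\<lambda>h b. lookup (act h b)) (\<lambda>b. lookup (coact b))
      (\<lambda>a b. lookup (mB a b)) (lookup uB) (\<lambda>b. lookup (dB b)) eB deg (\<lambda>a b. lookup (F a b)) (\<lambda>c. lookup (G c))"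
  shows "Ztilde (\<lambda>a b. lookup (mH a b)) (lookup uH) (\<lambda>h. lookup (dH h)) eH (\<lambda>h b. lookup (act h b)) (\<lambda>b. lookup (coact b))
      (\<lambda>a b. lookup (mB a b)) (lookup uB) (\<lambda>b. lookup (dB b)) eB deg (\<lambda>a b. lookup (D a b)) (\<lambda>c. lookup (G c))"
proof -
  note Z' = Z[unfolded Ztilde_def bos_lookup Zhat_lookup]
  have D0: "D a b = 0" if "dgA a = 0 \<or> dgA b = 0" for a b
    by (rule cocycD(3)[OF D_cocyc that])
  have uA: "dgA x = 0" if "x \<in> keys (tn uB uH)" for x
    using that uB_deg by (cases x) (auto dest: keys_tnD)
  have u: "bind (tn uB uH) (\<lambda>x. D x a) = 0" "bind (tn uB uH) (D a) = 0" for a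
    by (rule bind_eq_0, rule D0, simp add: uA)+
  have e: "fa eA (D a b) = 0" for a b
  proof -
    have "fa eA (F a b) = 0" using Z' by blast
    then have "bind (F a b) (\<lambda>x. sm (eA x) (ret ())) = 0"
      by (simp only: bind_fa sm_simps)
    then have "bind (D a b) (\<lambda>x. sm (eA x) (ret ())) = 0"
      by (simp only: D_def bind_diff_left A.e_conv_cobd diff_zero)
    then have "sm (fa eA (D a b)) (ret ()) = sm 0 (ret ())" by (simp only: bind_fa sm_simps)
    then show ?thesis by (rule sm_unitD)
  qed
  have G: "co_cond (\<lambda>c. lookup (G c))"
    "\<forall>c. ext (tmap (bos_pi eB) bas) (lookup (G c)) = 0 \<and> ext (tmap bas (bos_pi eB)) (lookup (G c)) = 0"
    using Z' by blast+
  show ?thesis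
    unfolding Ztilde_def bos_lookup Zhat_lookup lookup_eq_zero
    by (intro conjI G) (simp_all add: u e D0 cocycD[OF D_cocyc])
qed

end

context bos_main
begin

lemma Bhat_D: "Bhat (\<lambda>a b. lookup (mA a b)) (\<lambda>a. lookup (dA a)) (\<lambda>a b. lookup (D a b)) (\<lambda>c. lookup (G c))"
proof -
  obtain s where s: "\<And>a b. D a b = A.hoch_cobd s a b" "\<And>c. G c = A.co_cobd s c"
    using D_coboundary by blast
  show ?thesis
    unfolding Bhat_def
  proof (intro exI[of _ "\<lambda>a. lookup (s a)"] conjI allI)
    show "lookup (D a b) = ext2 (\<lambda>a b. lookup (mA a b)) (bas a) (lookup (s b)) - ext (\<lambda>a. lookup (s a)) (lookup (mA a b)) +
      ext2 (\<lambda>a b. lookup (mA a b)) (lookup (s a)) (bas b)" for a b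
      by (simp only: s A.hoch_cobd_def to_lookup bind_ret)
    show "lookup (G c) = - ext (tmap bas (\<lambda>a. lookup (s a))) (lookup (dA c)) + ext (\<lambda>a. lookup (dA a)) (lookup (s c)) -
      ext (tmap (\<lambda>a. lookup (s a)) bas) (lookup (dA c))" for c
      by (simp only: s A.co_cobd_def to_lookup)
  qed simp
qed

end

section \<open>Surjectivity of the connecting map\<close>

theorem main_lookup:
  fixes mH :: "'h \<Rightarrow> 'h \<Rightarrow> ('h \<Rightarrow>\<^sub>0 'k::field)" and act :: "'h \<Rightarrow> 'b \<Rightarrow> ('b \<Rightarrow>\<^sub>0 'k)"
    and F :: "'b \<times> 'h \<Rightarrow> 'b \<times> 'h \<Rightarrow> ('b \<times> 'h \<Rightarrow>\<^sub>0 'k)"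
  assumes hopf: "is_hopf (\<lambda>a b. lookup (mH a b)) (lookup uH) (\<lambda>a. lookup (dH a)) eH (\<lambda>a. lookup (SH a))"
    and YD: "is_YD (\<lambda>a b. lookup (mH a b)) (lookup uH) (\<lambda>a. lookup (dH a)) eH (\<lambda>a. lookup (SH a))
      (\<lambda>h b. lookup (act h b)) (\<lambda>b. lookup (coact b))"
    and B: "is_gc_YD_bialg (\<lambda>a b. lookup (mH a b)) (lookup uH) (\<lambda>a. lookup (dH a)) eH
      (\<lambda>h b. lookup (act h b)) (\<lambda>b. lookup (coact b))
      (\<lambda>a b. lookup (mB a b)) (lookup uB) (\<lambda>b. lookup (dB b)) eB deg"
    and lam: "lambda_cond (\<lambda>a b. lookup (mH a b)) (lookup uH) (\<lambda>a. lookup (dH a)) eH (\<lambda>a. lookup (SH a)) lam"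
    and l: "l < 0"
    and gen: "\<forall>v. fs v \<longrightarrow>
          v \<in> subalg (\<lambda>a b. lookup (mB a b)) (lookup uB) {w. fs w \<and> (\<exists>d::nat. int d \<le> - l \<and> homog deg (int d) w)}"
    and noYD: "YD_MP_zero (\<lambda>a b. lookup (mH a b)) (\<lambda>a. lookup (dH a)) (\<lambda>h b. lookup (act h b)) (\<lambda>b. lookup (coact b))
      (\<lambda>a b. lookup (mB a b)) (lookup uB) (\<lambda>b. lookup (dB b)) deg l"
    and Zt: "Ztilde (\<lambda>a b. lookup (mH a b)) (lookup uH) (\<lambda>h. lookup (dH h)) eH (\<lambda>h b. lookup (act h b)) (\<lambda>b. lookup (coact b))
      (\<lambda>a b. lookup (mB a b)) (lookup uB) (\<lambda>b. lookup (dB b)) eB deg (\<lambda>a b. lookup (F a b)) (\<lambda>c. lookup (G c))"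
    and hp: "homog_pair deg l (\<lambda>a b. lookup (F a b)) (\<lambda>c. lookup (G c))"
  shows "\<exists>eta. hoch_cocycle (\<lambda>a b. lookup (mB a b)) eB eta \<and>
      (\<forall>h b c. hact_coch (\<lambda>h. lookup (dH h)) (\<lambda>h b. lookup (act h b)) eta h b c = eH h * eta b c) \<and>
      (\<forall>b c. eta b c \<noteq> 0 \<longrightarrow> int (deg b + deg c) = - l) \<and>
      Btilde (\<lambda>a b. lookup (mH a b)) (lookup uH) (\<lambda>h. lookup (dH h)) eH (\<lambda>h b. lookup (act h b)) (\<lambda>b. lookup (coact b))
        (\<lambda>a b. lookup (mB a b)) (lookup uB) (\<lambda>b. lookup (dB b)) eB deg
        (\<lambda>a b. lookup (F a b) - dc (bos_mult (\<lambda>a b. lookup (mB a b)) (\<lambda>h b. lookup (act h b)) (\<lambda>a b. lookup (mH a b)) (\<lambda>h. lookup (dH h)))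
           (bos_comult (\<lambda>b. lookup (dB b)) (\<lambda>b. lookup (coact b)) (\<lambda>a b. lookup (mH a b)) (\<lambda>h. lookup (dH h)))
           (eta_tilde eH (\<lambda>h b. lookup (act h b)) eta) a b)
        (\<lambda>c. lookup (G c))"
proof -
  obtain b0 where "bos_data mH uH dH eH SH act coact mB uB dB eB deg b0"
    using bos_transfer[OF hopf YD B] by blast
  then interpret bos_data mH uH dH eH SH act coact mB uB dB eB deg b0 .
  define L where "L = nat (- l)"
  have L: "l = - int L" "L > 0" using l by (simp_all add: L_def)
  interpret bos_L mH uH dH eH SH act coact mB uB dB eB deg b0 L
    by unfold_locales (rule L(2))
  have "C.cocyc F G"
    by (rule cocyc_transfer[OF Zt hp[unfolded L(1)]])
  then interpret bos_lam mH uH dH eH SH act coact mB uB dB eB deg b0 L lam F G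
    using lam[unfolded lambda_cond_def, simplified to_lookup, simplified]
    by unfold_locales (simp_all add: bind2_def bind_assocs)
  interpret bos_gen mH uH dH eH SH act coact mB uB dB eB deg b0 L
  proof
    fix x assume x: "deg x > L"
    from gen have "bas x \<in> subalg (\<lambda>a b. lookup (mB a b)) (lookup uB) {w. fs w \<and> (\<exists>d::nat. int d \<le> int L \<and> homog deg (int d) w)}"
      by (simp add: L(1) bas_lookup)
    from subalg_decomposable[OF this] x obtain V t where V: "bas x = lookup V" "hom_pair (deg x) t" "bind2 t mB = part (deg x) V"
      by blast
    from V(1) have "V = ret x" by (simp only: bas_lookup poly_mapping.lookup_inject)
    with V show "\<exists>t. (\<forall>y z. (y, z) \<in> keys t \<longrightarrow> deg y > 0 \<and> deg z > 0 \<and> deg y + deg z = deg x) \<and> bind2 t mB = ret x"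
      by (intro exI[of _ t]) (simp add: hom_pair_def part_def)
  next
    fix \<Phi> t
    assume "\<And>x y z. deg x > 0 \<Longrightarrow> deg z > 0 \<Longrightarrow> bind (mB x y) (\<lambda>w. \<Phi> w z) = bind (mB y z) (\<lambda>w. \<Phi> x w)"
      "\<And>t. Kp t \<Longrightarrow> bind (bind2 t \<Phi>) dB =
          bind (bind2 t \<Phi>) (\<lambda>w. bind uB (\<lambda>u. ret (w, u))) + bind (bind2 t \<Phi>) (\<lambda>w. bind uB (\<lambda>u. ret (u, w)))"
      "\<And>h x y. bind (\<Phi> x y) (act h) = bind2 (dH h) (\<lambda>h1 h2. bind (act h1 x) (\<lambda>x'. bind (act h2 y) (\<lambda>y'. \<Phi> x' y')))"
      "\<And>t. Kp t \<Longrightarrow> bind (bind2 t \<Phi>) coact = bind2 t (\<lambda>x y. bind2 (coact x) (\<lambda>g x'. bind2 (coact y) (\<lambda>g' y'.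
          bind (mH g g') (\<lambda>p. bind (\<Phi> x' y') (\<lambda>w. ret (p, w))))))"
      "\<And>x y w. w \<in> keys (\<Phi> x y) \<Longrightarrow> deg w + L = deg x + deg y"
      "Kp t"
    then show "bind2 t \<Phi> = 0"
      by (rule no_YD_transfer[OF noYD[unfolded L(1)]])
  qed
  interpret bos_main mH uH dH eH SH act coact mB uB dB eB deg b0 L lam F G ..
  show ?thesis
  proof (intro exI[of _ eta] conjI allI impI)
    show "int (deg b + deg c) = - l" if "eta b c \<noteq> 0" for b c
      using eta_support[OF that] by (simp add: L(1))
    have D: "(\<lambda>a b. lookup (F a b) - dc (\<lambda>a b. lookup (mA a b)) (\<lambda>a. lookup (dA a)) eta_t a b) = (\<lambda>a b. lookup (D a b))"
      by (simp only: dc_lookup minus_lookup D_def)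
    show "Btilde (\<lambda>a b. lookup (mH a b)) (lookup uH) (\<lambda>h. lookup (dH h)) eH (\<lambda>h b. lookup (act h b)) (\<lambda>b. lookup (coact b))
        (\<lambda>a b. lookup (mB a b)) (lookup uB) (\<lambda>b. lookup (dB b)) eB deg
        (\<lambda>a b. lookup (F a b) - dc (bos_mult (\<lambda>a b. lookup (mB a b)) (\<lambda>h b. lookup (act h b)) (\<lambda>a b. lookup (mH a b)) (\<lambda>h. lookup (dH h)))
           (bos_comult (\<lambda>b. lookup (dB b)) (\<lambda>b. lookup (coact b)) (\<lambda>a b. lookup (mH a b)) (\<lambda>h. lookup (dH h)))
           (eta_tilde eH (\<lambda>h b. lookup (act h b)) eta) a b)
        (\<lambda>c. lookup (G c))"
      unfolding Btilde_def bos_mult_lookup bos_comult_lookup eta_tilde_eq D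
      using Ztilde_D[OF Zt] Bhat_D by blast
  qed (rule hoch_cocycle_eta hact_coch_eta)+
qed

theorem mainTheorem3:
  fixes mH :: "'h \<Rightarrow> 'h \<Rightarrow> 'h \<Rightarrow> 'k::field_char_0" and uH :: "'h \<Rightarrow> 'k"
    and dH :: "'h \<Rightarrow> 'h \<times> 'h \<Rightarrow> 'k" and eH :: "'h \<Rightarrow> 'k" and SH :: "'h \<Rightarrow> 'h \<Rightarrow> 'k"
    and lam :: "'h \<Rightarrow> 'k"
    and act :: "'h \<Rightarrow> 'b \<Rightarrow> 'b \<Rightarrow> 'k" and coact :: "'b \<Rightarrow> 'h \<times> 'b \<Rightarrow> 'k"
    and mB :: "'b \<Rightarrow> 'b \<Rightarrow> 'b \<Rightarrow> 'k" and uB :: "'b \<Rightarrow> 'k"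
    and dB :: "'b \<Rightarrow> 'b \<times> 'b \<Rightarrow> 'k" and eB :: "'b \<Rightarrow> 'k" and deg :: "'b \<Rightarrow> nat"
    and l :: int
    and F :: "'b \<times> 'h \<Rightarrow> 'b \<times> 'h \<Rightarrow> 'b \<times> 'h \<Rightarrow> 'k"
    and G :: "'b \<times> 'h \<Rightarrow> ('b \<times> 'h) \<times> ('b \<times> 'h) \<Rightarrow> 'k"
  assumes closed: "alg_closed TYPE('k)"
    and hopf: "is_hopf mH uH dH eH SH"
    and bij: "bijective_antipode SH"
    and YD: "is_YD mH uH dH eH SH act coact"
    and bialg: "is_gc_YD_bialg mH uH dH eH act coact mB uB dB eB deg"
    and lam: "lambda_cond mH uH dH eH SH lam"
    and l_neg: "l < 0"
    and generated: "\<forall>v. fs v \<longrightarrow>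
          v \<in> subalg mB uB {w. fs w \<and> (\<exists>d::nat. int d \<le> - l \<and> homog deg (int d) w)}"
    and noYD: "YD_MP_zero mH dH act coact mB uB dB deg l"
    and FG: "Ztilde mH uH dH eH act coact mB uB dB eB deg F G"
    and FG_deg: "homog_pair deg l F G"
  shows "\<exists>eta :: 'b \<Rightarrow> 'b \<Rightarrow> 'k.
      hoch_cocycle mB eB eta \<and>
      (\<forall>h b c. hact_coch dH act eta h b c = eH h * eta b c) \<and>
      (\<forall>b c. eta b c \<noteq> 0 \<longrightarrow> int (deg b + deg c) = - l) \<and>
      Btilde mH uH dH eH act coact mB uB dB eB deg
        (\<lambda>a b. F a b - dc (bos_mult mB act mH dH) (bos_comult dB coact mH dH) (eta_tilde eH act eta) a b)
        G"
proof -
  note h = hopf[unfolded is_hopf_def is_algebra_def is_coalgebra_def linmap_def]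
  note B = bialg[unfolded is_gc_YD_bialg_def, THEN conjunct1, unfolded is_algebra_def]
    bialg[unfolded is_gc_YD_bialg_def, THEN conjunct2, THEN conjunct1, unfolded is_coalgebra_def linmap_def]
  note Y = YD[unfolded is_YD_def linmap_def]
  note Z = FG[unfolded Ztilde_def Zhat_def linmap_def]
  \<comment> \<open>The axioms contain finiteness of all supports, so each structure map is the
    \<open>lookup\<close> of its \<open>Abs_poly_mapping\<close> and the version with finite support
    built in applies.\<close>
  have "fs (mH a b)" "fs uH" "fs (dH a)" "fs (SH a)" for a b using h by blast+
  moreover have "fs (act x b)" "fs (coact b)" for x b using Y by blast+
  moreover have "fs (mB a b)" "fs uB" "fs (dB a)" for a b using B by blast+
  moreover have "fs (F a b)" "fs (G a)" for a b using Z by blast+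
  ultimately have e: "\<And>a b. lookup (Abs_poly_mapping (mH a b)) = mH a b" "lookup (Abs_poly_mapping uH) = uH"
    "\<And>a. lookup (Abs_poly_mapping (dH a)) = dH a" "\<And>a. lookup (Abs_poly_mapping (SH a)) = SH a"
    "\<And>x b. lookup (Abs_poly_mapping (act x b)) = act x b" "\<And>b. lookup (Abs_poly_mapping (coact b)) = coact b"
    "\<And>a b. lookup (Abs_poly_mapping (mB a b)) = mB a b" "lookup (Abs_poly_mapping uB) = uB"
    "\<And>b. lookup (Abs_poly_mapping (dB b)) = dB b"
    "\<And>a b. lookup (Abs_poly_mapping (F a b)) = F a b" "\<And>a. lookup (Abs_poly_mapping (G a)) = G a"
    by (simp_all add: fs_eq_lookup)
  show ?thesis
    by (rule main_lookup[where mH = "\<lambda>a b. Abs_poly_mapping (mH a b)" and uH = "Abs_poly_mapping uH"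
        and dH = "\<lambda>a. Abs_poly_mapping (dH a)" and eH = eH and SH = "\<lambda>a. Abs_poly_mapping (SH a)"
        and act = "\<lambda>h b. Abs_poly_mapping (act h b)" and coact = "\<lambda>b. Abs_poly_mapping (coact b)"
        and mB = "\<lambda>a b. Abs_poly_mapping (mB a b)" and uB = "Abs_poly_mapping uB"
        and dB = "\<lambda>b. Abs_poly_mapping (dB b)" and eB = eB and deg = deg and lam = lam and l = l
        and F = "\<lambda>a b. Abs_poly_mapping (F a b)" and G = "\<lambda>a. Abs_poly_mapping (G a)", unfolded e])
      (fact hopf YD bialg lam l_neg generated noYD FG FG_deg)+
qed

end
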